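(* Let $\Omega_1,\Omega_2\subset\mathbb{R}^n$ be open, bounded, smooth and uniformly convex sets, and let $\mu=\rho_\mu\mathcal{L}_{\mathbb{R}^n}$ and $\nu=\rho_\nu\mathcal{L}_{\mathbb{R}^n}$ be two probability measures on $\mathbb{R}^n$ with densities $\rho_\mu:\Omega_1\to\mathbb{R}$ and $\rho_\nu:\Omega_2\to\mathbb{R}$ (so $\mu$ is concentrated on $\Omega_1$ and $\nu$ on $\Omega_2$). Assume that there exists $C>1$ such that $C\ge\rho_\mu\ge 1/C$ on $\Omega_1$ and $C\ge\rho_\nu\ge1/C$ on $\Omega_2$, and that $\rho_\mu\in C^\infty(\overline{\Omega}_1,\mathbb{R})$, $\rho_\nu\in C^\infty(\overline{\Omega}_2,\mathbb{R})$. Let $T:\overline{\Omega}_1\to\overline{\Omega}_2$ be the optimal transport map between $\mu$ and $\nu$ (for the squared Euclidean distance cost). Let $F_1,\dots,F_k$ be smooth, Lipschitz-continuous vector fields on $\mathbb{R}^n$ satisfying the Lie algebra strong approximating property, and let $\mathcal{U}:=L^2([0,1],\mathbb{R}^k)$. For $\beta>0$ define $$\mathcal{F}^{\infty,\beta}(u):=\int_{\mathbb{R}^n}|\Phi_u(x)-T(x)|_2^2\,d\mu(x)+\frac\beta2\|u\|_{L^2}^2,\qquad u\in\mathcal{U},$$ $$\kappa(\beta):=\sup\left\{\int_{\mathbb{R}^n}|\Phi_u(x)-T(x)|_2^2\,d\mu(x): u\in\arg\min_{\mathcal{U}}\mathcal{F}^{\infty,\beta}\right\}.$$ Then for every $\varepsilon>0$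 there exists $\bar\beta>0$ such that $\kappa(\beta)\le\varepsilon$ for every $\beta\in(0,\bar\beta]$.
   Context: Flow: for $u=(u_1,\dots,u_k)\in\mathcal{U}$, $\Phi_u:\mathbb{R}^n\to\mathbb{R}^n$ is defined by $\Phi_u(x):=x_u(1)$, where $x_u:[0,1]\to\mathbb{R}^n$ is the absolutely continuous solution of $\dot x_u(t)=\sum_{i=1}^kF_i(x_u(t))u_i(t)$ for a.e. $t\in[0,1]$, $x_u(0)=x$. Optimal transport map: a Borel map $T$ such that $(\mathrm{Id},T)_\#\mu$ minimizes $\int|x-y|^2\,d\gamma(x,y)$ among all probability measures $\gamma$ on $\mathbb{R}^n\times\mathbb{R}^n$ with marginals $\mu$ and $\nu$. Under the hypotheses it is unique up to $\mu$-a.e. equality; $T:\overline{\Omega}_1\to\overline{\Omega}_2$ denotes its continuous representative. Smooth and uniformly convex domain: a convex domain with $C^\infty$ boundary all of whose principal curvatures are bounded below by a positive constant. Lie algebra strong approximating property: let $\mathrm{Lie}(F_1,\dots,F_k):=\mathrm{span}\{[F_{i_s},[\dots,[F_{i_2},F_{i_1}],\dots]]: s\ge1,\ i_1,\dots,i_s\in\{1,\dots,k\}\}$, where $[\cdot,\cdot]$ is the Lie bracket of vector fields. For a vector field $X$ and a compact set $K\subset\mathbb{R}^n$ let $\|X\|_{1,K}:=\sup_{x\in K}\big(|X(x)|_2+\sum_{i=1}^n|D_{x_i}X(x)|_2\big)$, and for $\delta>0$ let $\mathrm{Lie}^\delta_{1,K}(F_1,\dots,F_k):=\{X\in\mathrm{Lie}(F_1,\dots,F_k):\|X\|_{1,K}\le\delta\}$.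 The fields satisfy the property if there exists $m\ge1$ such that, for every $C^m$-regular vector field $Y:\mathbb{R}^n\to\mathbb{R}^n$ and every compact set $K\subset\mathbb{R}^n$, there exists $\delta>0$ such that $\inf\{\sup_{x\in K}|X(x)-Y(x)|_2: X\in\mathrm{Lie}^\delta_{1,K}(F_1,\dots,F_k)\}=0$. *)

theory Defs
  imports "HOL-Probability.Probability"
begin

subsection \<open>Functions of class C^k\<close>

text \<open>The set S is always open here. Quantifying over all directions v instead of the
  coordinate directions changes nothing, as the derivative is linear in v.\<close>

primrec Ck_on :: "nat \<Rightarrow> 'a::euclidean_space set \<Rightarrow> ('a \<Rightarrow> 'b::real_normed_vector) \<Rightarrow> bool" where
  "Ck_on 0 S f \<longleftrightarrow> continuous_on S f"
| "Ck_on (Suc m) S f \<longleftrightarrow>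
     (\<forall>x\<in>S. f differentiable (at x)) \<and> (\<forall>v. Ck_on m S (\<lambda>x. frechet_derivative f (at x) v))"

definition smooth_on :: "'a::euclidean_space set \<Rightarrow> ('a \<Rightarrow> 'b::real_normed_vector) \<Rightarrow> bool" where
  "smooth_on S f \<longleftrightarrow> (\<forall>m. Ck_on m S f)"

text \<open>Regularity up to the boundary of an open set S: f is m times differentiable in S and all
  derivatives of order at most m extend continuously to the closure. Only the values of f on S
  matter.\<close>

primrec Ck_closure :: "nat \<Rightarrow> 'a::euclidean_space set \<Rightarrow> ('a \<Rightarrow> 'b::real_normed_vector) \<Rightarrow> bool" where
  "Ck_closure 0 S f \<longleftrightarrow> (\<exists>g. continuous_on (closure S) g \<and> (\<forall>x\<in>S. g x = f x))"
| "Ck_closure (Suc m) S f \<longleftrightarrow>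
     (\<exists>g. continuous_on (closure S) g \<and> (\<forall>x\<in>S. g x = f x)) \<and>
     (\<forall>x\<in>S. f differentiable (at x)) \<and>
     (\<forall>v. Ck_closure m S (\<lambda>x. frechet_derivative f (at x) v))"

definition smooth_closure :: "'a::euclidean_space set \<Rightarrow> ('a \<Rightarrow> 'b::real_normed_vector) \<Rightarrow> bool" where
  "smooth_closure S f \<longleftrightarrow> (\<forall>m. Ck_closure m S f)"


subsection \<open>Smooth and uniformly convex domains\<close>

definition gradient :: "(real^'n \<Rightarrow> real) \<Rightarrow> real^'n \<Rightarrow> real^'n" where
  "gradient f x = (\<chi> i. frechet_derivative f (at x) (axis i 1))"

definition local_defining_function ::
    "(real^'n) set \<Rightarrow> real^'n \<Rightarrow> (real^'n) set \<Rightarrow> (real^'n \<Rightarrow> real) \<Rightarrow> bool" where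
  "local_defining_function \<Omega> p V \<psi> \<longleftrightarrow>
     open V \<and> p \<in> V \<and> smooth_on V \<psi> \<and> (\<forall>x\<in>V. gradient \<psi> x \<noteq> 0) \<and>
     \<Omega> \<inter> V = {x\<in>V. \<psi> x < 0} \<and> frontier \<Omega> \<inter> V = {x\<in>V. \<psi> x = 0}"

definition smooth_boundary :: "(real^'n) set \<Rightarrow> bool" where
  "smooth_boundary \<Omega> \<longleftrightarrow> (\<forall>p\<in>frontier \<Omega>. \<exists>V \<psi>. local_defining_function \<Omega> p V \<psi>)"

text \<open>The principal curvatures at p are the eigenvalues of the shape operator, that is, of the
  differential at p of the outward unit normal field, restricted to the tangent space. They do not
  depend on the choice of the defining function; the sign makes them positive for balls.\<close>

definition principal_curvature :: "(real^'n) set \<Rightarrow> real^'n \<Rightarrow> real \<Rightarrow> bool" where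
  "principal_curvature \<Omega> p c \<longleftrightarrow>
     (\<exists>V \<psi> v. local_defining_function \<Omega> p V \<psi> \<and> v \<noteq> 0 \<and> v \<bullet> gradient \<psi> p = 0 \<and>
        frechet_derivative (\<lambda>x. gradient \<psi> x /\<^sub>R norm (gradient \<psi> x)) (at p) v = c *\<^sub>R v)"

definition smooth_uniformly_convex :: "(real^'n) set \<Rightarrow> bool" where
  "smooth_uniformly_convex \<Omega> \<longleftrightarrow>
     convex \<Omega> \<and> smooth_boundary \<Omega> \<and>
     (\<exists>c0>0. \<forall>p\<in>frontier \<Omega>. \<forall>c. principal_curvature \<Omega> p c \<longrightarrow> c \<ge> c0)"


subsection \<open>Optimal transport maps\<close>

definition couplings :: "(real^'n) measure \<Rightarrow> (real^'n) measure \<Rightarrow> ((real^'n) \<times> (real^'n)) measure set" where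
  "couplings \<mu> \<nu> =
     {\<gamma>. prob_space \<gamma> \<and> sets \<gamma> = sets borel \<and> distr \<gamma> borel fst = \<mu> \<and> distr \<gamma> borel snd = \<nu>}"

definition transport_cost :: "((real^'n) \<times> (real^'n)) measure \<Rightarrow> ennreal" where
  "transport_cost \<gamma> = (\<integral>\<^sup>+ z. ennreal ((norm (fst z - snd z))\<^sup>2) \<partial>\<gamma>)"

definition optimal_transport_map ::
    "(real^'n) measure \<Rightarrow> (real^'n) measure \<Rightarrow> (real^'n \<Rightarrow> real^'n) \<Rightarrow> bool" where
  "optimal_transport_map \<mu> \<nu> T \<longleftrightarrow>
     T \<in> borel_measurable borel \<and>
     is_arg_min transport_cost (\<lambda>\<gamma>. \<gamma> \<in> couplings \<mu> \<nu>) (distr \<mu> borel (\<lambda>x. (x, T x)))"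


subsection \<open>The Lie algebra strong approximating property\<close>

definition lie_bracket ::
    "(real^'n \<Rightarrow> real^'n) \<Rightarrow> (real^'n \<Rightarrow> real^'n) \<Rightarrow> real^'n \<Rightarrow> real^'n" where
  "lie_bracket X Y = (\<lambda>x. frechet_derivative Y (at x) (X x) - frechet_derivative X (at x) (Y x))"

inductive_set iterated_brackets :: "('k \<Rightarrow> real^'n \<Rightarrow> real^'n) \<Rightarrow> (real^'n \<Rightarrow> real^'n) set"
  for F :: "'k \<Rightarrow> real^'n \<Rightarrow> real^'n" where
  base: "F i \<in> iterated_brackets F"
| step: "X \<in> iterated_brackets F \<Longrightarrow> lie_bracket (F i) X \<in> iterated_brackets F"

text \<open>The function space carries no vector space structure in the library, so the span is written
  out as the set of finite linear combinations.\<close>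

definition Lie :: "('k \<Rightarrow> real^'n \<Rightarrow> real^'n) \<Rightarrow> (real^'n \<Rightarrow> real^'n) set" where
  "Lie F = {(\<lambda>x. \<Sum>X\<in>B. a X *\<^sub>R X x) | B a. finite B \<and> B \<subseteq> iterated_brackets F}"

text \<open>Suprema and infima are taken in the extended nonnegative reals, so that the supremum over
  the empty compact set is 0.\<close>

definition C1_norm :: "(real^'n) set \<Rightarrow> (real^'n \<Rightarrow> real^'n) \<Rightarrow> ennreal" where
  "C1_norm K X =
     (SUP x\<in>K. ennreal (norm (X x) + (\<Sum>i\<in>UNIV. norm (frechet_derivative X (at x) (axis i 1)))))"

definition Lie_bounded ::
    "real \<Rightarrow> (real^'n) set \<Rightarrow> ('k \<Rightarrow> real^'n \<Rightarrow> real^'n) \<Rightarrow> (real^'n \<Rightarrow> real^'n) set" where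
  "Lie_bounded \<delta> K F = {X \<in> Lie F. C1_norm K X \<le> ennreal \<delta>}"

definition lie_strong_approximating :: "('k \<Rightarrow> real^'n \<Rightarrow> real^'n) \<Rightarrow> bool" where
  "lie_strong_approximating F \<longleftrightarrow>
     (\<exists>m\<ge>1. \<forall>Y :: real^'n \<Rightarrow> real^'n. \<forall>K. Ck_on m UNIV Y \<longrightarrow> compact K \<longrightarrow>
        (\<exists>\<delta>>0. (INF X\<in>Lie_bounded \<delta> K F. SUP x\<in>K. ennreal (norm (X x - Y x))) = 0))"


subsection \<open>Controls, flows and the functional\<close>

text \<open>Controls are functions rather than almost-everywhere classes; trajectories and norms depend
  only on the class.\<close>

definition controls :: "(real \<Rightarrow> real^'k) set" where
  "controls = {u. u \<in> borel_measurable (lebesgue_on {0..1}) \<and>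
                  integrable (lebesgue_on {0..1}) (\<lambda>t. (norm (u t))\<^sup>2)}"

definition control_norm :: "(real \<Rightarrow> real^'k) \<Rightarrow> real" where
  "control_norm u = sqrt (\<integral>t. (norm (u t))\<^sup>2 \<partial>lebesgue_on {0..1})"

definition absolutely_continuous_path :: "real \<Rightarrow> real \<Rightarrow> (real \<Rightarrow> 'a::real_normed_vector) \<Rightarrow> bool" where
  "absolutely_continuous_path a b f \<longleftrightarrow>
     (\<forall>\<epsilon>>0. \<exists>\<delta>>0. \<forall>(N::nat) s t.
        (\<forall>i<N. a \<le> s i \<and> s i \<le> t i \<and> t i \<le> b) \<longrightarrow>
        disjoint_family_on (\<lambda>i. {s i<..<t i}) {..<N} \<longrightarrow>
        (\<Sum>i<N. t i - s i) < \<delta> \<longrightarrow> (\<Sum>i<N. norm (f (t i) - f (s i))) < \<epsilon>)"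

definition trajectory ::
    "('k::finite \<Rightarrow> real^'n \<Rightarrow> real^'n) \<Rightarrow> (real \<Rightarrow> real^'k) \<Rightarrow> real^'n \<Rightarrow> (real \<Rightarrow> real^'n) \<Rightarrow> bool" where
  "trajectory F u x0 x \<longleftrightarrow>
     absolutely_continuous_path 0 1 x \<and> x 0 = x0 \<and>
     (AE t in lebesgue_on {0..1}.
        (x has_vector_derivative (\<Sum>i\<in>UNIV. (u t $ i) *\<^sub>R F i (x t))) (at t within {0..1}))"

text \<open>For Lipschitz fields F and a control u, the trajectory exists and is unique on [0,1].\<close>

definition flow :: "('k::finite \<Rightarrow> real^'n \<Rightarrow> real^'n) \<Rightarrow> (real \<Rightarrow> real^'k) \<Rightarrow> real^'n \<Rightarrow> real^'n" where
  "flow F u x0 = (THE y. \<exists>x. trajectory F u x0 x \<and> y = x 1)"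

definition terminal_error ::
    "('k::finite \<Rightarrow> real^'n \<Rightarrow> real^'n) \<Rightarrow> (real^'n) measure \<Rightarrow> (real^'n \<Rightarrow> real^'n) \<Rightarrow>
     (real \<Rightarrow> real^'k) \<Rightarrow> ennreal" where
  "terminal_error F \<mu> T u = (\<integral>\<^sup>+ x. ennreal ((norm (flow F u x - T x))\<^sup>2) \<partial>\<mu>)"

definition functional ::
    "('k::finite \<Rightarrow> real^'n \<Rightarrow> real^'n) \<Rightarrow> (real^'n) measure \<Rightarrow> (real^'n \<Rightarrow> real^'n) \<Rightarrow> real \<Rightarrow>
     (real \<Rightarrow> real^'k) \<Rightarrow> ennreal" where
  "functional F \<mu> T \<beta> u = terminal_error F \<mu> T u + ennreal (\<beta> / 2 * (control_norm u)\<^sup>2)"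

definition kappa ::
    "('k::finite \<Rightarrow> real^'n \<Rightarrow> real^'n) \<Rightarrow> (real^'n) measure \<Rightarrow> (real^'n \<Rightarrow> real^'n) \<Rightarrow> real \<Rightarrow> ennreal" where
  "kappa F \<mu> T \<beta> =
     (SUP u\<in>{u. is_arg_min (functional F \<mu> T \<beta>) (\<lambda>v. v \<in> controls) u}. terminal_error F \<mu> T u)"

end

theory Submission
  imports Defs
begin

text \<open>
  No regularity theory for the transport map is needed. Optimality and continuity make \<open>T\<close> monotone
  on the convex set \<open>\<Omega>1\<close>, so \<open>T\<close> is a uniform limit of Lipschitz, strongly monotone maps \<open>G\<close>, and the
  displacement interpolation from the identity to such a \<open>G\<close> is driven by Lipschitz velocity fields.
  On the other side, call a field tangent if the control system can follow it to first order, locally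
  uniformly. Tangent fields form a closed linear space, and conjugation with the flow of \<open>F i\<close> makes it
  invariant under brackets with \<open>F i\<close>; hence it contains \<open>Lie F\<close>, by the approximating property all
  polynomial fields, and by Stone-Weierstrass all continuous fields. Euler's method along the
  interpolation then gives a control whose terminal error is at most \<open>\<epsilon> / 2\<close>, and comparing the
  minimizers with this one control bounds \<open>kappa\<close> for small \<open>\<beta>\<close>.
\<close>

subsection \<open>Calculus of functions of class C^k\<close>

text \<open>The commutator of two flows run for the same time moves points only quadratically in
  that time. The conjugation therefore uses two scales: the time \<open>t\<close> of the flow of
  \<open>F i\<close> is fixed first, and only then does the time \<open>k\<close> of the other field
  tend to zero. The displacement is \<open>- (k * t)\<close> times the bracket up to a small
  fraction, hence linear in \<open>k\<close> and of either sign. This is why tangency is formulated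
  with both signs of \<open>h\<close> and an error relative to \<open>\<bar>h\<bar>\<close>. The
  step size up to which a tangent field can be followed depends on the field in an uncontrolled way.
  Euler's method therefore freezes the velocity at finitely many times before it chooses its step.
  The controls obtained can be enormous, since every composition compresses time and every bracket
  divides by \<open>t\<close>. This is harmless: one control is fixed before \<open>\<beta>\<close>,
  and only the finiteness of its norm counts. For a merely monotone map the interpolation may lose
  injectivity at time 1, and then the velocity is no function of the position. A small multiple of
  the identity, added to the Lipschitz approximation of \<open>T\<close>, restores strong
  monotonicity.\<close>

lemma Ck_on_Suc_D:
  assumes "Ck_on (Suc m) UNIV f"
  shows "(f has_derivative frechet_derivative f (at x)) (at x)"
    and "Ck_on m UNIV (\<lambda>x. frechet_derivative f (at x) v)"
  using assms frechet_derivative_works by auto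

lemma Ck_on_Suc_I:
  assumes "\<And>x. (f has_derivative f' x) (at x)"
    and "\<And>v. Ck_on m UNIV (\<lambda>x. f' x v)"
  shows "Ck_on (Suc m) UNIV f"
proof -
  have "frechet_derivative f (at x) = f' x" for x
    using frechet_derivative_at[OF assms(1)] by simp
  then show ?thesis
    using assms by (auto simp: differentiable_def)
qed

lemma Ck_on_continuous:
  assumes "Ck_on m UNIV f"
  shows "continuous_on UNIV f"
proof (cases m)
  case 0
  then show ?thesis using assms by simp
next
  case (Suc k)
  then show ?thesis
    using assms differentiable_imp_continuous_within
    by (auto simp: continuous_on_eq_continuous_within)
qed

lemma Ck_on_lower: "Ck_on (Suc m) UNIV f \<Longrightarrow> Ck_on m UNIV f"
proof (induction m arbitrary: f)
  case 0
  then show ?case by (metis Ck_on.simps(1) Ck_on_continuous)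
next
  case (Suc m)
  show ?case
    using Ck_on_Suc_D[OF Suc.prems] Suc.IH by (intro Ck_on_Suc_I) auto
qed

lemma Ck_on_const: "Ck_on m UNIV (\<lambda>x. c)"
  by (induction m arbitrary: c) (auto intro!: Ck_on_Suc_I[where f'="\<lambda>x v. 0"])

lemma Ck_on_bounded_linear: 
  assumes "bounded_linear f"
  shows "Ck_on m UNIV f"
proof (cases m)
  case 0
  then show ?thesis using assms by (simp add: linear_continuous_on)
next
  case (Suc k)
  then show ?thesis
    using assms by (auto simp del: Ck_on.simps intro!: Ck_on_Suc_I[where f'="\<lambda>x. f"] Ck_on_const bounded_linear_imp_has_derivative)
qed

lemma Ck_on_add:
  "Ck_on m UNIV f \<Longrightarrow> Ck_on m UNIV g \<Longrightarrow> Ck_on m UNIV (\<lambda>x. f x + g x)"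
proof (induction m arbitrary: f g)
  case 0
  then show ?case by (auto intro: continuous_on_add)
next
  case (Suc m)
  show ?case
    using Ck_on_Suc_D[OF Suc.prems(1)] Ck_on_Suc_D[OF Suc.prems(2)]
    by (intro Ck_on_Suc_I[where f'="\<lambda>x v. frechet_derivative f (at x) v + frechet_derivative g (at x) v"]
        Suc.IH has_derivative_add) auto
qed

lemma Ck_on_scaleR:
  fixes f :: "'a::euclidean_space \<Rightarrow> real" and g :: "'a \<Rightarrow> 'b::real_normed_vector"
  shows "Ck_on m UNIV f \<Longrightarrow> Ck_on m UNIV g \<Longrightarrow> Ck_on m UNIV (\<lambda>x. f x *\<^sub>R g x)"
proof (induction m arbitrary: f g)
  case 0
  then show ?case by (auto intro: continuous_on_scaleR)
next
  case (Suc m)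
  show ?case
    using Ck_on_Suc_D[OF Suc.prems(1)] Ck_on_Suc_D[OF Suc.prems(2)] 
      Ck_on_lower[OF Suc.prems(1)] Ck_on_lower[OF Suc.prems(2)]
    by (intro Ck_on_Suc_I[where f'="\<lambda>x v. f x *\<^sub>R frechet_derivative g (at x) v + frechet_derivative f (at x) v *\<^sub>R g x"]
        Suc.IH has_derivative_scaleR Ck_on_add) auto
qed

lemma Ck_on_sum:
  assumes "\<And>i. i \<in> I \<Longrightarrow> Ck_on m UNIV (f i)"
  shows "Ck_on m UNIV (\<lambda>x. \<Sum>i\<in>I. f i x)"
proof (cases "finite I")
  case True
  then show ?thesis
    using assms by (induction I rule: finite_induct) (auto simp: Ck_on_const intro: Ck_on_add)
next
  case False
  then show ?thesis by (simp add: Ck_on_const)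
qed

lemma Ck_on_linear_comp:
  assumes "bounded_linear L"
  shows "Ck_on m UNIV f \<Longrightarrow> Ck_on m UNIV (\<lambda>x. L (f x))"
proof (induction m arbitrary: f)
  case 0
  then show ?case using assms by (auto intro: bounded_linear.continuous_on)
next
  case (Suc m)
  show ?case
  proof (rule Ck_on_Suc_I)
    show "((\<lambda>x. L (f x)) has_derivative (\<lambda>v. L (frechet_derivative f (at x) v))) (at x)" for x
      by (rule bounded_linear.has_derivative[OF assms Ck_on_Suc_D(1)[OF Suc.prems]])
    show "Ck_on m UNIV (\<lambda>x. L (frechet_derivative f (at x) v))" for v
      by (rule Suc.IH[OF Ck_on_Suc_D(2)[OF Suc.prems]])
  qed
qed

text \<open>\<open>Ck_on\<close> speaks of derivatives in fixed directions, while here the direction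
  moves with the point. Expanding it in the basis leaves a finite sum of products of functions of
  class C^m. The derivative costs one order, so \<open>X\<close> is taken of class C^(m+1).\<close>

lemma smooth_on_directional_derivative:
  fixes X :: "'a::euclidean_space \<Rightarrow> 'b::real_normed_vector" and Y :: "'a \<Rightarrow> 'a"
  assumes "smooth_on UNIV X" "smooth_on UNIV Y"
  shows "smooth_on UNIV (\<lambda>x. frechet_derivative X (at x) (Y x))"
  unfolding smooth_on_def
proof
  fix m
  have X: "Ck_on (Suc m) UNIV X" and Y: "Ck_on m UNIV Y"
    using assms unfolding smooth_on_def by blast+
  have "frechet_derivative X (at x) (Y x)
      = (\<Sum>b\<in>Basis. (Y x \<bullet> b) *\<^sub>R frechet_derivative X (at x) b)" for x
  proof -
    have lin: "linear (frechet_derivative X (at x))"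
      using Ck_on_Suc_D(1)[OF X] has_derivative_linear by blast
    show ?thesis
      by (subst (1) euclidean_representation[symmetric, of "Y x"])
        (simp add: linear_sum[OF lin] linear_cmul[OF lin])
  qed
  then show "Ck_on m UNIV (\<lambda>x. frechet_derivative X (at x) (Y x))"
    by (simp, intro Ck_on_sum Ck_on_scaleR Ck_on_linear_comp[OF _ Y] Ck_on_Suc_D(2)[OF X])
      (auto simp: bounded_linear_inner_left)
qed

lemma smooth_on_lie_bracket:
  assumes "smooth_on UNIV X" "smooth_on UNIV Y"
  shows "smooth_on UNIV (lie_bracket X Y)"
proof -
  note D = smooth_on_directional_derivative[OF assms(2,1)] smooth_on_directional_derivative[OF assms]
  have "Ck_on m UNIV (\<lambda>x. frechet_derivative Y (at x) (X x) + (-1) *\<^sub>R frechet_derivative X (at x) (Y x))" for m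
    using D unfolding smooth_on_def by (intro Ck_on_add Ck_on_scaleR Ck_on_const) auto
  then show ?thesis
    by (simp add: smooth_on_def lie_bracket_def)
qed

lemma smooth_on_iterated_brackets:
  assumes "\<And>i. smooth_on UNIV (F i)" "X \<in> iterated_brackets F"
  shows "smooth_on UNIV X"
  using assms(2) by induction (auto intro: assms(1) smooth_on_lie_bracket)

lemma Ck_on_polynomial_function:
  fixes p :: "'a::euclidean_space \<Rightarrow> 'b::euclidean_space"
  assumes "polynomial_function p"
  shows "Ck_on m UNIV p"
proof -
  have real: "Ck_on m UNIV q" if "real_polynomial_function q" for q :: "'a \<Rightarrow> real"
    using that
  proof induction
    case (mult f g)
    then show ?case using Ck_on_scaleR[of m f g] by simp
  qed (auto intro: Ck_on_bounded_linear Ck_on_const Ck_on_add)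
  have "Ck_on m UNIV (\<lambda>x. p x \<bullet> b)" if "b \<in> Basis" for b
  proof (rule real)
    show "real_polynomial_function (\<lambda>x. p x \<bullet> b)"
      using assms that polynomial_function_iff_Basis_inner by blast
  qed
  then have "Ck_on m UNIV (\<lambda>x. \<Sum>b\<in>Basis. (p x \<bullet> b) *\<^sub>R b)"
    by (intro Ck_on_sum Ck_on_scaleR Ck_on_const) auto
  then show ?thesis by (simp add: euclidean_representation)
qed

lemma smooth_on_imp_Ck_on: "smooth_on S f \<Longrightarrow> Ck_on m S f"
  by (simp add: smooth_on_def)

text \<open>Strict differentiability, with both points \<open>a\<close> and \<open>b\<close> free
  and the derivative taken at a third point \<open>c\<close>: this is what comparing two integral
  curves with one linear map requires. The derivative in each basis direction is uniformly
  continuous on the ball; \<open>\<eta> / n\<close> per direction sums to an operator norm of at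
  most \<open>\<eta>\<close>. The mean value inequality is then applied to \<open>X\<close> minus
  its linear part at \<open>c\<close>, on a convex intersection of two balls.\<close>

lemma C1_uniformly_strictly_differentiable:
  fixes X :: "'a::euclidean_space \<Rightarrow> 'b::real_normed_vector"
  assumes X: "Ck_on (Suc 0) UNIV X" and "\<eta> > 0"
  obtains \<delta> where "\<delta> > 0"
    "\<And>a b c. a \<in> cball 0 \<rho> \<Longrightarrow> b \<in> cball 0 \<rho> \<Longrightarrow> c \<in> cball 0 \<rho> \<Longrightarrow> dist a c < \<delta> \<Longrightarrow> dist b c < \<delta> \<Longrightarrow>
       norm (X a - X b - frechet_derivative X (at c) (a - b)) \<le> \<eta> * norm (a - b)"
proof -
  let ?D = "\<lambda>x. frechet_derivative X (at x)"
  define n where "n = real DIM('a)"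
  have n: "n > 0" by (simp add: n_def)
  have der: "(X has_derivative ?D x) (at x)" for x
    using Ck_on_Suc_D(1)[OF X] .
  have "\<exists>d>0. \<forall>x\<in>cball 0 \<rho>. \<forall>y\<in>cball 0 \<rho>. dist x y < d \<longrightarrow> dist (?D x v) (?D y v) < \<eta> / n" for v
  proof -
    have "continuous_on (cball 0 \<rho>) (\<lambda>x. ?D x v)"
      using Ck_on_Suc_D(2)[OF X] continuous_on_subset by fastforce
    then have "uniformly_continuous_on (cball 0 \<rho>) (\<lambda>x. ?D x v)"
      by (simp add: compact_uniformly_continuous)
    then show ?thesis
      using assms(2) n unfolding uniformly_continuous_on_def
      by (metis divide_pos_pos dist_commute)
  qed
  then obtain d where d: "\<And>v. d v > 0"
    "\<And>v x y. x \<in> cball 0 \<rho> \<Longrightarrow> y \<in> cball 0 \<rho> \<Longrightarrow> dist x y < d v \<Longrightarrow> dist (?D x v) (?D y v) < \<eta> / n"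
    by metis
  define \<delta> where "\<delta> = Min (d ` Basis)"
  have "\<delta> > 0" using d(1) by (simp add: \<delta>_def)
  moreover have "norm (X a - X b - ?D c (a - b)) \<le> \<eta> * norm (a - b)"
    if "a \<in> cball 0 \<rho>" "b \<in> cball 0 \<rho>" "c \<in> cball 0 \<rho>" "dist a c < \<delta>" "dist b c < \<delta>" for a b c
  proof -
    have lin: "linear (?D x)" for x
      using der has_derivative_linear by blast
    have on: "onorm (\<lambda>v. ?D x v - ?D c v) \<le> \<eta>" if x: "x \<in> cball 0 \<rho> \<inter> ball c \<delta>" for x
    proof (rule onorm_le)
      fix v :: 'a
      have "norm (?D x b - ?D c b) \<le> \<eta> / n" if "b \<in> Basis" for b
      proof -
        have "dist x c < d b"
          using x that by (auto simp: \<delta>_def dist_commute)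
        then show ?thesis
          using d(2)[of x c b] x \<open>c \<in> cball 0 \<rho>\<close> by (auto simp: dist_norm)
      qed
      then have *: "(\<Sum>b\<in>Basis. norm v * norm (?D x b - ?D c b)) \<le> (\<Sum>b\<in>(Basis::'a set). norm v * (\<eta> / n))"
        by (intro sum_mono mult_left_mono) auto
      have L: "linear (\<lambda>v. ?D x v - ?D c v)"
        using lin by (simp add: linear_compose_sub)
      have "norm (?D x v - ?D c v) = norm (\<Sum>b\<in>Basis. (v \<bullet> b) *\<^sub>R (?D x b - ?D c b))"
        by (subst (1 2) euclidean_representation[symmetric, of v])
          (simp add: linear_sum[OF lin] linear_cmul[OF lin] sum_subtractf scaleR_diff_right)
      also have "\<dots> \<le> (\<Sum>b\<in>Basis. norm v * norm (?D x b - ?D c b))"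
        by (intro sum_norm_le) (auto intro!: mult_right_mono Basis_le_norm)
      also have "\<dots> \<le> \<eta> * norm v"
        using * n by (simp add: n_def mult.commute)
      finally show "norm (?D x v - ?D c v) \<le> \<eta> * norm v" .
    qed
    let ?S = "cball 0 \<rho> \<inter> ball c \<delta>"
    have "norm ((X a - ?D c a) - (X b - ?D c b)) \<le> \<eta> * norm (a - b)"
    proof (rule differentiable_bound[where S="?S" and f'="\<lambda>x v. ?D x v - ?D c v"])
      show "convex ?S" by (simp add: convex_Int)
      show "((\<lambda>x. X x - ?D c x) has_derivative (\<lambda>v. ?D x v - ?D c v)) (at x within ?S)" for x
        by (intro has_derivative_diff has_derivative_at_withinI[OF der] linear_imp_has_derivative lin)
      show "a \<in> ?S" "b \<in> ?S" using that by (auto simp: dist_commute)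
    qed (use on in auto)
    moreover have "X a - ?D c a - (X b - ?D c b) = X a - X b - ?D c (a - b)"
      by (simp add: linear_diff[OF lin])
    ultimately show ?thesis by metis
  qed
  ultimately show ?thesis using that by blast
qed

subsection \<open>Absolutely continuous paths and uniqueness of trajectories\<close>

text \<open>The definition indexes the intervals by initial segments of the naturals, whereas tagged
  divisions are sets of pairs. A bijection carries the estimate over to arbitrary finite index
  sets.\<close>

lemma absolutely_continuous_path_finite_sum:
  fixes f :: "real \<Rightarrow> 'a::real_normed_vector"
  assumes "absolutely_continuous_path a b f" "\<epsilon> > 0"
  shows "\<exists>\<delta>>0. \<forall>(I::'i set) s t. finite I \<longrightarrow> (\<forall>i\<in>I. a \<le> s i \<and> s i \<le> t i \<and> t i \<le> b) \<longrightarrow>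
       disjoint_family_on (\<lambda>i. {s i<..<t i}) I \<longrightarrow> (\<Sum>i\<in>I. t i - s i) < \<delta> \<longrightarrow>
       (\<Sum>i\<in>I. norm (f (t i) - f (s i))) < \<epsilon>"
proof -
  obtain \<delta> where \<delta>: "\<delta> > 0" "\<And>(N::nat) s t. (\<forall>i<N. a \<le> s i \<and> s i \<le> t i \<and> t i \<le> b) \<Longrightarrow>
        disjoint_family_on (\<lambda>i. {s i<..<t i}) {..<N} \<Longrightarrow>
        (\<Sum>i<N. t i - s i) < \<delta> \<Longrightarrow> (\<Sum>i<N. norm (f (t i) - f (s i))) < \<epsilon>"
    using assms unfolding absolutely_continuous_path_def by blast
  have "(\<Sum>i\<in>I. norm (f (t i) - f (s i))) < \<epsilon>"
    if "finite I" "\<And>i. i \<in> I \<Longrightarrow> a \<le> s i \<and> s i \<le> t i \<and> t i \<le> b"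
      "disjoint_family_on (\<lambda>i. {s i<..<t i}) I" "(\<Sum>i\<in>I. t i - s i) < \<delta>" for I :: "'i set" and s t
  proof -
    obtain h where h: "bij_betw h {..<card I} I"
      using ex_bij_betw_nat_finite[OF \<open>finite I\<close>] by (auto simp: atLeast0LessThan)
    have "(\<Sum>i<card I. norm (f (t (h i)) - f (s (h i)))) < \<epsilon>"
    proof (rule \<delta>(2))
      show "\<forall>i<card I. a \<le> s (h i) \<and> s (h i) \<le> t (h i) \<and> t (h i) \<le> b"
        using that(2) h bij_betwE by blast
      show "disjoint_family_on (\<lambda>i. {s (h i)<..<t (h i)}) {..<card I}"
        using that(3) h unfolding disjoint_family_on_def bij_betw_def inj_on_def by blast
      show "(\<Sum>i<card I. t (h i) - s (h i)) < \<delta>"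
        using that(4) sum.reindex_bij_betw[OF h, of "\<lambda>i. t i - s i"] by simp
    qed
    then show ?thesis
      using sum.reindex_bij_betw[OF h, of "\<lambda>i. norm (f (t i) - f (s i))"] by simp
  qed
  then show ?thesis using \<delta>(1) by (intro exI[of _ \<delta>] conjI allI impI) simp_all
qed

text \<open>In a tagged division that is fine with respect to a suitable gauge, the intervals tagged in
  the exceptional null set have small total length, so absolute continuity controls them; the
  derivative bound controls the others.\<close>

lemma absolutely_continuous_path_mean_value_bound:
  fixes f :: "real \<Rightarrow> 'a::real_normed_vector"
  assumes ac: "absolutely_continuous_path a b f" and "a \<le> b" and "B \<ge> 0"
    and N: "negligible N"
    and der: "\<And>t. t \<in> {a..b} - N \<Longrightarrow> \<exists>v. (f has_vector_derivative v) (at t within {a..b}) \<and> norm v \<le> B"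
  shows "norm (f b - f a) \<le> B * (b - a)"
proof (rule field_le_epsilon)
  fix e :: real assume "e > 0"
  \<comment> \<open>The total error will be \<open>\<epsilon>\<close> from the intervals tagged in
    \<open>N\<close> plus \<open>\<epsilon> * (b - a)\<close> from the others; the denominator stays
    positive when \<open>a = b\<close>.\<close>
  define \<epsilon> where "\<epsilon> = e / (2 + (b - a))"
  have "\<epsilon> > 0" using \<open>e > 0\<close> \<open>a \<le> b\<close> by (simp add: \<epsilon>_def)
  obtain \<delta> where \<delta>: "\<delta> > 0" "\<And>(I::(real \<times> real set) set) s t. finite I \<Longrightarrow> (\<forall>i\<in>I. a \<le> s i \<and> s i \<le> t i \<and> t i \<le> b) \<Longrightarrow>
       disjoint_family_on (\<lambda>i. {s i<..<t i}) I \<Longrightarrow> (\<Sum>i\<in>I. t i - s i) < \<delta> \<Longrightarrow>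
       (\<Sum>i\<in>I. norm (f (t i) - f (s i))) < \<epsilon>"
    using absolutely_continuous_path_finite_sum[OF ac \<open>\<epsilon> > 0\<close>] by blast
  \<comment> \<open>Outer regularity bounds \<open>U - N\<close>, and since \<open>N\<close> is null
    this bounds the measure of \<open>U\<close> itself.\<close>
  obtain U where U: "open U" "N \<subseteq> U" "(U - N) \<in> lmeasurable" "emeasure lebesgue (U - N) < ennreal \<delta>"
    using sets_lebesgue_outer_open[of N \<delta>] \<delta>(1) N negligible_imp_sets by blast
  have "N \<in> null_sets lebesgue" using N negligible_iff_null_sets by blast
  then have "emeasure lebesgue U = emeasure lebesgue (U - N)"
    using emeasure_Un_null_set[OF fmeasurableD[OF U(3)], of N] U(2) by (simp add: sup_absorb1)
  then have em: "emeasure lebesgue U < ennreal \<delta>" using U(4) by simp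
  have Ulm: "U \<in> lmeasurable"
    using em U(1) by (intro fmeasurableI) (auto intro: less_trans[OF _ ennreal_less_top] borel_open)
  have Ulm': "measure lebesgue U < \<delta>"
    using em Ulm by (simp add: emeasure_eq_measure2 ennreal_less_iff)
  \<comment> \<open>The gauge keeps intervals tagged in \<open>N\<close> inside \<open>U\<close>,
    and elsewhere turns the derivative bound into a linear estimate between the tag and each
    endpoint.\<close>
  have "\<exists>r>0. (t \<in> N \<longrightarrow> ball t r \<subseteq> U) \<and>
    (t \<in> {a..b} - N \<longrightarrow> (\<forall>s\<in>ball t r \<inter> {a..b}. norm (f s - f t) \<le> (B + \<epsilon>) * \<bar>s - t\<bar>))" for t
  proof (cases "t \<in> N")
    case True
    then show ?thesis using U open_contains_ball by auto
  next
    case False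
    show ?thesis
    proof (cases "t \<in> {a..b}")
      case True
      then obtain v where v: "(f has_vector_derivative v) (at t within {a..b})" "norm v \<le> B"
        using der False by blast
      then obtain r where r: "r > 0" "\<And>s. s \<in> {a..b} \<Longrightarrow> norm (s - t) < r \<Longrightarrow>
          norm (f s - f t - (s - t) *\<^sub>R v) \<le> \<epsilon> * norm (s - t)"
        unfolding has_vector_derivative_def has_derivative_within_alt using \<open>\<epsilon> > 0\<close> by blast
      have "norm (f s - f t) \<le> (B + \<epsilon>) * \<bar>s - t\<bar>" if "s \<in> ball t r \<inter> {a..b}" for s
      proof -
        have "norm (f s - f t) \<le> norm (f s - f t - (s - t) *\<^sub>R v) + norm ((s - t) *\<^sub>R v)"
          by (metis diff_add_cancel norm_triangle_ineq)
        also have "\<dots> \<le> \<epsilon> * \<bar>s - t\<bar> + \<bar>s - t\<bar> * B"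
          using r(2)[of s] that v(2) by (intro add_mono) (auto simp: dist_norm norm_minus_commute intro!: mult_left_mono)
        finally show ?thesis by (simp add: algebra_simps)
      qed
      then show ?thesis using r(1) False by blast
    qed (use False in \<open>auto intro!: exI[of _ 1]\<close>)
  qed
  then obtain r where r: "\<And>t. r t > 0" "\<And>t. t \<in> N \<Longrightarrow> ball t (r t) \<subseteq> U"
    "\<And>t s. t \<in> {a..b} - N \<Longrightarrow> s \<in> ball t (r t) \<inter> {a..b} \<Longrightarrow> norm (f s - f t) \<le> (B + \<epsilon>) * \<bar>s - t\<bar>"
    by metis
  have "gauge (\<lambda>t. ball t (r t))" using r(1) by (simp add: gauge_def)
  then obtain p where p: "p tagged_division_of {a..b}" "(\<lambda>t. ball t (r t)) fine p"
    using fine_division_exists_real by blast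
  have fin: "finite p" using p(1) by blast
  have K: "\<exists>u v. k = {u..v} \<and> u \<le> v \<and> a \<le> u \<and> v \<le> b \<and> t \<in> {u..v} \<and> {u..v} \<subseteq> ball t (r t)"
    if tk: "(t, k) \<in> p" for t k
  proof -
    obtain u v where uv: "k = cbox u v" using tagged_division_ofD(4)[OF p(1) tk] by blast
    have "t \<in> k" "k \<subseteq> {a..b}" using tagged_division_ofD(2,3)[OF p(1) that] by auto
    moreover have "k \<subseteq> ball t (r t)" using fineD[OF p(2) that] .
    ultimately show ?thesis using uv by (intro exI[of _ u] exI[of _ v]) auto
  qed
  let ?s = "\<lambda>(t, k). Inf k :: real" and ?e = "\<lambda>(t, k). Sup k :: real"
  have KS: "Sup k - Inf k \<ge> 0" "a \<le> Inf k" "Sup k \<le> b" "t \<in> {Inf k..Sup k}"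
    "{Inf k..Sup k} = k" "k \<subseteq> ball t (r t)"  if "(t, k) \<in> p" for t k
    using K[OF that] by (auto simp: cInf_atLeastAtMost cSup_atLeastAtMost)
  define p1 where "p1 = {(t, k) \<in> p. t \<in> N}"
  define p2 where "p2 = {(t, k) \<in> p. t \<notin> N}"
  have pp: "p = p1 \<union> p2" "p1 \<inter> p2 = {}" "finite p1" "finite p2" "p1 \<subseteq> p" "p2 \<subseteq> p"
    using fin by (auto simp: p1_def p2_def intro: finite_subset[of _ p])
  have tele: "(\<Sum>(t,k)\<in>p. f (Sup k) - f (Inf k)) = f b - f a" for f :: "real \<Rightarrow> 'b::real_normed_vector"
    by (rule additive_tagged_division_1[OF \<open>a \<le> b\<close> p(1)])
  have "(\<Sum>i\<in>p1. norm (f (?e i) - f (?s i))) < \<epsilon>"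
  proof (rule \<delta>(2))
    show disj: "disjoint_family_on (\<lambda>i. {?s i<..<?e i}) p1"
      unfolding disjoint_family_on_def
    proof (intro ballI impI)
      fix i j assume ij: "i \<in> p1" "j \<in> p1" "i \<noteq> j"
      obtain t k t' k' where [simp]: "i = (t, k)" "j = (t', k')" by fastforce
      have "(t, k) \<in> p" "(t', k') \<in> p" "(t, k) \<noteq> (t', k')"
        using ij pp by auto
      then have "interior k \<inter> interior k' = {}"
        using tagged_division_ofD(5)[OF p(1)] by blast
      moreover have "{Inf k<..<Sup k} = interior k" "{Inf k'<..<Sup k'} = interior k'"
        using KS(5)[of t k] KS(5)[of t' k'] ij pp
        by (metis \<open>i = (t, k)\<close> \<open>j = (t', k')\<close> interior_atLeastAtMost_real subset_eq)+
      ultimately show "{?s i<..<?e i} \<inter> {?s j<..<?e j} = {}" by simp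
    qed
    have "(\<Sum>i\<in>p1. ?e i - ?s i) = (\<Sum>i\<in>p1. measure lebesgue {?s i<..<?e i})"
      using KS(1) pp(5) by (intro sum.cong) auto
    also have "\<dots> = measure lebesgue (\<Union>i\<in>p1. {?s i<..<?e i})"
      using disj pp(3) emeasure_bounded_finite[OF bounded_box, of _ "_::real"]
      by (intro measure_finite_Union[symmetric]) (auto simp: less_top box_real)
    also have "\<dots> \<le> measure lebesgue U"
    proof (rule measure_mono_fmeasurable)
      show "(\<Union>i\<in>p1. {?s i<..<?e i}) \<subseteq> U"
      proof (intro UN_least)
        fix i assume i: "i \<in> p1"
        obtain t k where [simp]: "i = (t, k)" by fastforce
        have "t \<in> N" "(t, k) \<in> p" using i by (auto simp: p1_def)
        then have "k \<subseteq> U" using r(2) KS(6) by blast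
        then show "{?s i<..<?e i} \<subseteq> U" using KS(5)[OF \<open>(t, k) \<in> p\<close>] by fastforce
      qed
    qed (use Ulm pp in auto)
    finally show "(\<Sum>i\<in>p1. ?e i - ?s i) < \<delta>" using Ulm' by simp
    show "\<forall>i\<in>p1. a \<le> ?s i \<and> ?s i \<le> ?e i \<and> ?e i \<le> b"
    proof
      fix i assume i: "i \<in> p1"
      obtain t k where [simp]: "i = (t, k)" by fastforce
      have "(t, k) \<in> p" using i pp(5) by auto
      from KS(1-3)[OF this] show "a \<le> ?s i \<and> ?s i \<le> ?e i \<and> ?e i \<le> b" by simp
    qed
  qed (rule pp(3))
  moreover have "(\<Sum>i\<in>p2. norm (f (?e i) - f (?s i))) \<le> (\<Sum>i\<in>p2. (B + \<epsilon>) * (?e i - ?s i))"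
  proof (rule sum_mono)
    fix i assume i: "i \<in> p2"
    obtain t k where [simp]: "i = (t, k)" by fastforce
    have tk: "t \<notin> N" "(t, k) \<in> p" using i by (auto simp: p2_def)
    note KS = KS[OF tk(2)]
    have *: "t \<in> {a..b} - N" "Inf k \<in> ball t (r t) \<inter> {a..b}" "Sup k \<in> ball t (r t) \<inter> {a..b}"
    proof -
      have le: "Inf k \<le> t" "t \<le> Sup k" using KS(4) by auto
      then show "t \<in> {a..b} - N" using KS(2,3) tk(1) by auto
      have "{Inf k..Sup k} \<subseteq> ball t (r t)" using KS(5,6) by simp
      moreover have "Inf k \<in> {Inf k..Sup k}" "Sup k \<in> {Inf k..Sup k}" using le by auto
      ultimately have "Inf k \<in> ball t (r t)" "Sup k \<in> ball t (r t)" by blast+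
      moreover have "Inf k \<in> {a..b}" "Sup k \<in> {a..b}" using le KS(2,3) by auto
      ultimately show "Inf k \<in> ball t (r t) \<inter> {a..b}" "Sup k \<in> ball t (r t) \<inter> {a..b}"
        by blast+
    qed
    have "norm (f (Sup k) - f (Inf k)) \<le> norm (f (Sup k) - f t) + norm (f (Inf k) - f t)"
      by (metis norm_minus_commute norm_triangle_sub dist_norm dist_triangle2)
    also have "\<dots> \<le> (B + \<epsilon>) * \<bar>Sup k - t\<bar> + (B + \<epsilon>) * \<bar>Inf k - t\<bar>"
      using r(3)[OF *(1,3)] r(3)[OF *(1,2)] by simp
    also have "\<dots> = (B + \<epsilon>) * (Sup k - Inf k)"
      using KS(4) by (simp add: algebra_simps)
    finally show "norm (f (?e i) - f (?s i)) \<le> (B + \<epsilon>) * (?e i - ?s i)" by simp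
  qed
  moreover have "(\<Sum>i\<in>p2. (B + \<epsilon>) * (?e i - ?s i)) \<le> (\<Sum>i\<in>p. (B + \<epsilon>) * (?e i - ?s i))"
    using KS(1) \<open>B \<ge> 0\<close> \<open>\<epsilon> > 0\<close> fin by (intro sum_mono2 pp) auto
  moreover have "(\<Sum>i\<in>p. (B + \<epsilon>) * (?e i - ?s i)) = (B + \<epsilon>) * (b - a)"
    using tele[of "\<lambda>t::real. t"] by (simp add: sum_distrib_left[symmetric] split_beta)
  moreover have "norm (f b - f a) \<le> (\<Sum>i\<in>p. norm (f (?e i) - f (?s i)))"
    unfolding tele[symmetric] by (rule sum_norm_le) auto
  moreover have "(\<Sum>i\<in>p. norm (f (?e i) - f (?s i))) =
      (\<Sum>i\<in>p1. norm (f (?e i) - f (?s i))) + (\<Sum>i\<in>p2. norm (f (?e i) - f (?s i)))"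
    unfolding pp(1) by (rule sum.union_disjoint[OF pp(3,4,2)])
  ultimately have "norm (f b - f a) \<le> \<epsilon> + (B + \<epsilon>) * (b - a)" by linarith
  also have "\<dots> = B * (b - a) + \<epsilon> * (1 + (b - a))" by (simp add: algebra_simps)
  also have "\<epsilon> * (1 + (b - a)) \<le> \<epsilon> * (2 + (b - a))" using \<open>\<epsilon> > 0\<close> by simp
  also have "\<dots> = e" using \<open>a \<le> b\<close> by (simp add: \<epsilon>_def)
  finally show "norm (f b - f a) \<le> B * (b - a) + e" by simp
qed

section \<open>Elementary properties of absolutely continuous paths\<close>

lemma absolutely_continuous_path_subinterval:
  assumes "absolutely_continuous_path a b f" "a \<le> a'" "b' \<le> b"
  shows "absolutely_continuous_path a' b' f"
  unfolding absolutely_continuous_path_def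
proof (intro allI impI)
  fix \<epsilon> :: real assume "\<epsilon> > 0"
  then obtain \<delta> where \<delta>: "\<delta> > 0" "\<And>(N::nat) s t. (\<forall>i<N. a \<le> s i \<and> s i \<le> t i \<and> t i \<le> b) \<Longrightarrow>
        disjoint_family_on (\<lambda>i. {s i<..<t i}) {..<N} \<Longrightarrow>
        (\<Sum>i<N. t i - s i) < \<delta> \<Longrightarrow> (\<Sum>i<N. norm (f (t i) - f (s i))) < \<epsilon>"
    using assms(1) unfolding absolutely_continuous_path_def by blast
  have "(\<Sum>i<N. norm (f (t i) - f (s i))) < \<epsilon>"
    if H: "\<forall>i<N. a' \<le> s i \<and> s i \<le> t i \<and> t i \<le> b'"
      "disjoint_family_on (\<lambda>i. {s i<..<t i}) {..<N}" "(\<Sum>i<N. t i - s i) < \<delta>" for N :: nat and s t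
    using H assms(2,3) by (intro \<delta>(2)) force+
  then show "\<exists>\<delta>>0. \<forall>(N::nat) s t. (\<forall>i<N. a' \<le> s i \<and> s i \<le> t i \<and> t i \<le> b') \<longrightarrow>
        disjoint_family_on (\<lambda>i. {s i<..<t i}) {..<N} \<longrightarrow>
        (\<Sum>i<N. t i - s i) < \<delta> \<longrightarrow> (\<Sum>i<N. norm (f (t i) - f (s i))) < \<epsilon>"
    using \<delta>(1) by (intro exI[of _ \<delta>] conjI allI impI) simp_all
qed

lemma absolutely_continuous_path_diff:
  assumes "absolutely_continuous_path a b f" "absolutely_continuous_path a b g"
  shows "absolutely_continuous_path a b (\<lambda>t. f t - g t)"
  unfolding absolutely_continuous_path_def
proof (intro allI impI)
  fix \<epsilon> :: real assume "\<epsilon> > 0"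
  then have e: "\<epsilon> / 2 > 0" by simp
  obtain \<delta> where \<delta>: "\<delta> > 0" "\<And>(N::nat) s t. (\<forall>i<N. a \<le> s i \<and> s i \<le> t i \<and> t i \<le> b) \<Longrightarrow>
        disjoint_family_on (\<lambda>i. {s i<..<t i}) {..<N} \<Longrightarrow>
        (\<Sum>i<N. t i - s i) < \<delta> \<Longrightarrow> (\<Sum>i<N. norm (f (t i) - f (s i))) < \<epsilon> / 2"
    using assms(1) e unfolding absolutely_continuous_path_def by blast
  obtain \<delta>' where \<delta>': "\<delta>' > 0" "\<And>(N::nat) s t. (\<forall>i<N. a \<le> s i \<and> s i \<le> t i \<and> t i \<le> b) \<Longrightarrow>
        disjoint_family_on (\<lambda>i. {s i<..<t i}) {..<N} \<Longrightarrow>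
        (\<Sum>i<N. t i - s i) < \<delta>' \<Longrightarrow> (\<Sum>i<N. norm (g (t i) - g (s i))) < \<epsilon> / 2"
    using assms(2) e unfolding absolutely_continuous_path_def by blast
  have "(\<Sum>i<N. norm (f (t i) - g (t i) - (f (s i) - g (s i)))) < \<epsilon>"
    if H: "\<forall>i<N. a \<le> s i \<and> s i \<le> t i \<and> t i \<le> b"
      "disjoint_family_on (\<lambda>i. {s i<..<t i}) {..<N}" "(\<Sum>i<N. t i - s i) < min \<delta> \<delta>'" for N :: nat and s t
  proof -
    have "(\<Sum>i<N. norm (f (t i) - g (t i) - (f (s i) - g (s i))))
      \<le> (\<Sum>i<N. norm (f (t i) - f (s i)) + norm (g (t i) - g (s i)))"
    proof (rule sum_mono)
      fix i
      show "norm (f (t i) - g (t i) - (f (s i) - g (s i))) \<le> norm (f (t i) - f (s i)) + norm (g (t i) - g (s i))"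
        using norm_triangle_ineq4[of "f (t i) - f (s i)" "g (t i) - g (s i)"] by (simp add: algebra_simps)
    qed
    also have "\<dots> < \<epsilon> / 2 + \<epsilon> / 2"
      unfolding sum.distrib using H by (intro add_strict_mono \<delta>(2) \<delta>'(2)) simp_all
    finally show ?thesis by simp
  qed
  then show "\<exists>\<delta>>0. \<forall>(N::nat) s t. (\<forall>i<N. a \<le> s i \<and> s i \<le> t i \<and> t i \<le> b) \<longrightarrow>
        disjoint_family_on (\<lambda>i. {s i<..<t i}) {..<N} \<longrightarrow>
        (\<Sum>i<N. t i - s i) < \<delta> \<longrightarrow> (\<Sum>i<N. norm (f (t i) - g (t i) - (f (s i) - g (s i)))) < \<epsilon>"
    using \<delta>(1) \<delta>'(1) by (intro exI[of _ "min \<delta> \<delta>'"] conjI allI impI) simp_all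
qed

lemma absolutely_continuous_path_continuous_on:
  assumes "absolutely_continuous_path a b f"
  shows "continuous_on {a..b} f"
  unfolding continuous_on_iff
proof (intro ballI allI impI)
  fix x \<epsilon> :: real assume x: "x \<in> {a..b}" and "\<epsilon> > 0"
  then obtain \<delta> where \<delta>: "\<delta> > 0" "\<And>(N::nat) s t. (\<forall>i<N. a \<le> s i \<and> s i \<le> t i \<and> t i \<le> b) \<Longrightarrow>
        disjoint_family_on (\<lambda>i. {s i<..<t i}) {..<N} \<Longrightarrow>
        (\<Sum>i<N. t i - s i) < \<delta> \<Longrightarrow> (\<Sum>i<N. norm (f (t i) - f (s i))) < \<epsilon>"
    using assms unfolding absolutely_continuous_path_def by blast
  have one: "norm (f t - f s) < \<epsilon>" if "a \<le> s" "s \<le> t" "t \<le> b" "t - s < \<delta>" for s t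
    using \<delta>(2)[of "Suc 0" "\<lambda>_. s" "\<lambda>_. t"] that by (simp add: disjoint_family_on_def)
  have "dist (f y) (f x) < \<epsilon>" if y: "y \<in> {a..b}" "dist y x < \<delta>" for y
  proof (cases "x \<le> y")
    case True
    then show ?thesis using one[of x y] x y by (simp add: dist_norm)
  next
    case False
    then show ?thesis using one[of y x] x y by (simp add: dist_norm norm_minus_commute)
  qed
  then show "\<exists>d>0. \<forall>y\<in>{a..b}. dist y x < d \<longrightarrow> dist (f y) (f x) < \<epsilon>"
    using \<delta>(1) by blast
qed

lemma lipschitz_on_imp_absolutely_continuous_path:
  assumes L: "L-lipschitz_on {a..b} f"
  shows "absolutely_continuous_path a b f"
  unfolding absolutely_continuous_path_def
proof (intro allI impI exI[of _ "\<epsilon> / (L + 1)" for \<epsilon>] conjI)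
  have L0: "L \<ge> 0" using L lipschitz_on_nonneg by blast
  fix \<epsilon> :: real assume e: "\<epsilon> > 0"
  then show "0 < \<epsilon> / (L + 1)" using L0 by simp
  fix N :: nat and s t
  assume H: "\<forall>i<N. a \<le> s i \<and> s i \<le> t i \<and> t i \<le> b" and S: "(\<Sum>i<N. t i - s i) < \<epsilon> / (L + 1)"
  have "(\<Sum>i<N. norm (f (t i) - f (s i))) \<le> (\<Sum>i<N. L * (t i - s i))"
  proof (rule sum_mono)
    fix i assume "i \<in> {..<N}"
    then show "norm (f (t i) - f (s i)) \<le> L * (t i - s i)"
      using lipschitz_onD[OF L, of "t i" "s i"] H by (auto simp: dist_norm)
  qed
  also have "\<dots> = L * (\<Sum>i<N. t i - s i)" by (simp add: sum_distrib_left)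
  also have "\<dots> \<le> L * (\<epsilon> / (L + 1))" using S L0 by (intro mult_left_mono) auto
  also have "\<dots> < \<epsilon>" using e L0 by (simp add: field_simps)
  finally show "(\<Sum>i<N. norm (f (t i) - f (s i))) < \<epsilon>" .
qed

text \<open>A substitute for Gronwall's inequality on short intervals: at a point \<open>m\<close>
  where \<open>norm (d t)\<close> is largest, the mean value bound gives
  \<open>norm (d m) \<le> norm (d m) / 2\<close>.\<close>

lemma absolutely_continuous_path_zero_short:
  fixes d :: "real \<Rightarrow> 'a::real_normed_vector"
  assumes ac: "absolutely_continuous_path a b d" and "a \<le> b" "C \<ge> 0" "C * (b - a) \<le> 1 / 2"
    and N: "negligible N"
    and der: "\<And>t. t \<in> {a..b} - N \<Longrightarrow>
      \<exists>v. (d has_vector_derivative v) (at t within {a..b}) \<and> norm v \<le> C * norm (d t)"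
    and "d a = 0" and t: "t \<in> {a..b}"
  shows "d t = 0"
proof -
  have "continuous_on {a..b} (\<lambda>t. norm (d t))"
    by (intro continuous_on_norm absolutely_continuous_path_continuous_on ac)
  then obtain m where m: "m \<in> {a..b}" "\<And>t. t \<in> {a..b} \<Longrightarrow> norm (d t) \<le> norm (d m)"
    using continuous_attains_sup[of "{a..b}" "\<lambda>t. norm (d t)"] \<open>a \<le> b\<close> by auto
  have "norm (d m - d a) \<le> (C * norm (d m)) * (m - a)"
  proof (rule absolutely_continuous_path_mean_value_bound[OF _ _ _ N])
    show "absolutely_continuous_path a m d"
      using absolutely_continuous_path_subinterval[OF ac] m(1) by simp
    show "\<exists>v. (d has_vector_derivative v) (at t within {a..m}) \<and> norm v \<le> C * norm (d m)"
      if t: "t \<in> {a..m} - N" for t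
    proof -
      have "t \<in> {a..b} - N" using t m(1) by auto
      moreover have "C * norm (d t) \<le> C * norm (d m)"
        using m t \<open>C \<ge> 0\<close> by (intro mult_left_mono) auto
      moreover have "{a..m} \<subseteq> {a..b}" using m(1) by auto
      ultimately show ?thesis
        using der[of t] has_vector_derivative_within_subset by (meson order_trans)
    qed
  qed (use m \<open>C \<ge> 0\<close> in auto)
  also have "\<dots> \<le> norm (d m) * (1 / 2)"
  proof -
    have "C * (m - a) \<le> 1 / 2"
      using assms(4) m(1) \<open>C \<ge> 0\<close> mult_left_mono[of "m - a" "b - a" C] by auto
    then have "norm (d m) * (C * (m - a)) \<le> norm (d m) * (1 / 2)"
      by (intro mult_left_mono) auto
    then show ?thesis by (simp add: mult_ac)
  qed
  finally have "norm (d m) = 0" using \<open>d a = 0\<close> by simp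
  then show ?thesis using m(2)[OF t] by simp
qed

text \<open>The interval is exhausted by pieces short enough for the previous lemma. The induction
  is on the number of pieces, with the right endpoint generalised.\<close>

lemma absolutely_continuous_path_zero:
  fixes d :: "real \<Rightarrow> 'a::real_normed_vector"
  assumes "absolutely_continuous_path a b d" and "C \<ge> 0" and N: "negligible N"
    and "\<And>t. t \<in> {a..b} - N \<Longrightarrow>
      \<exists>v. (d has_vector_derivative v) (at t within {a..b}) \<and> norm v \<le> C * norm (d t)"
    and a: "d a = 0" and "t \<in> {a..b}"
  shows "d t = 0"
proof -
  \<comment> \<open>The summand 1 keeps \<open>\<tau>\<close> positive when
    \<open>C = 0\<close>.\<close>
  define \<tau> where "\<tau> = 1 / (2 * C + 1)"
  have \<tau>: "\<tau> > 0" "C * \<tau> \<le> 1 / 2" using \<open>C \<ge> 0\<close> by (auto simp: \<tau>_def field_simps)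
  have "d t = 0" if "absolutely_continuous_path a b d" "b - a \<le> real n * \<tau>" "t \<in> {a..b}"
    "\<And>t. t \<in> {a..b} - N \<Longrightarrow>
      \<exists>v. (d has_vector_derivative v) (at t within {a..b}) \<and> norm v \<le> C * norm (d t)" for n b t
    using that
  proof (induction n arbitrary: b t)
    case 0
    then have "t = a" by auto
    then show ?case using a by simp
  next
    case (Suc n)
    \<comment> \<open>The last piece is cut off; the maximum with \<open>a\<close> covers an
      interval shorter than \<open>\<tau>\<close>.\<close>
    define b' where "b' = max a (b - \<tau>)"
    have b': "a \<le> b'" "b' \<le> b" "b' - a \<le> real n * \<tau>" "b - b' \<le> \<tau>"
      using Suc.prems(2,3) \<tau>(1) by (auto simp: b'_def algebra_simps)
    have sub: "\<exists>v. (d has_vector_derivative v) (at t within {l..r}) \<and> norm v \<le> C * norm (d t)"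
      if "t \<in> {l..r} - N" "{l..r} \<subseteq> {a..b}" for t l r
      using Suc.prems(4)[of t] that has_vector_derivative_within_subset by blast
    have z: "d t = 0" if "t \<in> {a..b'}" for t
    proof (rule Suc.IH[of b'])
      show "absolutely_continuous_path a b' d"
        using absolutely_continuous_path_subinterval[OF Suc.prems(1)] b' by simp
    qed (use b' that sub in auto)
    show ?case
    proof (cases "t \<le> b'")
      case True
      then show ?thesis using z[of t] Suc.prems(3) by simp
    next
      case False
      have "C * (b - b') \<le> C * \<tau>" using b' \<open>C \<ge> 0\<close> by (intro mult_left_mono) auto
      then have "C * (b - b') \<le> 1 / 2" using \<tau>(2) by simp
      show ?thesis
      proof (rule absolutely_continuous_path_zero_short[OF _ b'(2) \<open>C \<ge> 0\<close> \<open>C * (b - b') \<le> 1 / 2\<close> N])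
        show "absolutely_continuous_path b' b d"
          using absolutely_continuous_path_subinterval[OF Suc.prems(1)] b' by simp
        show "d b' = 0" using z b' by simp
      qed (use False Suc.prems(3) b' sub in auto)
    qed
  qed
  moreover obtain n where "(b - a) / \<tau> \<le> real n" using real_arch_simple by blast
  then have "b - a \<le> real n * \<tau>" using \<tau>(1) by (simp add: field_simps)
  ultimately show ?thesis using assms by blast
qed

section \<open>Uniqueness of trajectories for bounded controls\<close>

lemma AE_lebesgue_on_imp_negligible:
  assumes "AE t in lebesgue_on S. P t" "S \<in> sets lebesgue"
  shows "\<exists>N. negligible N \<and> (\<forall>t\<in>S - N. P t)"
proof -
  have "AE t in lebesgue. t \<in> S \<longrightarrow> P t"
    using assms by (simp add: AE_restrict_space_iff)
  then obtain N where "N \<in> null_sets lebesgue" "{t. \<not> (t \<in> S \<longrightarrow> P t)} \<subseteq> N"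
    by (auto simp: eventually_ae_filter)
  then show ?thesis
    by (intro exI[of _ N]) (auto simp: negligible_iff_null_sets)
qed

lemma lipschitz_family_bound:
  fixes F :: "'k::finite \<Rightarrow> 'a::real_normed_vector \<Rightarrow> 'b::real_normed_vector"
  assumes "\<forall>i. \<exists>L. L-lipschitz_on UNIV (F i)"
  obtains L where "L > 0" "\<And>i x y. norm (F i x - F i y) \<le> L * norm (x - y)"
proof -
  obtain l where l: "\<And>i. (l i)-lipschitz_on UNIV (F i)" using assms by metis
  have l0: "l i \<ge> 0" for i using l lipschitz_on_nonneg by blast
  have "norm (F i x - F i y) \<le> (1 + (\<Sum>i\<in>UNIV. l i)) * norm (x - y)" for i x y
  proof -
    have "norm (F i x - F i y) \<le> l i * norm (x - y)"
      using lipschitz_onD[OF l[of i], of x y] by (simp add: dist_norm)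
    also have "\<dots> \<le> (1 + (\<Sum>i\<in>UNIV. l i)) * norm (x - y)"
      using l0 member_le_sum[of i UNIV l] by (intro mult_right_mono) auto
    finally show ?thesis .
  qed
  moreover have "1 + (\<Sum>i\<in>UNIV. l i) > 0" using l0 by (simp add: add_pos_nonneg sum_nonneg)
  ultimately show ?thesis using that by blast
qed

text \<open>\<open>flow\<close> is a definite description, so it can be evaluated only once the
  endpoint is known to be unique. For a bounded control the difference of two trajectories satisfies
  a linear differential inequality with a constant coefficient and starts at zero.\<close>

lemma trajectory_unique:
  fixes F :: "'k::finite \<Rightarrow> real^'n \<Rightarrow> real^'n"
  assumes F: "\<forall>i. \<exists>L. L-lipschitz_on UNIV (F i)"
    and u: "bounded (range u)"
    and x: "trajectory F u x0 x" and y: "trajectory F u x0 y" and t: "t \<in> {0..1}"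
  shows "x t = y t"
proof -
  obtain L where L: "L > 0" "\<And>i x y. norm (F i x - F i y) \<le> L * norm (x - y)"
    using lipschitz_family_bound[OF F] by metis
  obtain M where M: "M > 0" "\<And>t. norm (u t) \<le> M"
    using u bounded_pos by (metis rangeI)
  let ?f = "\<lambda>x t. \<Sum>i\<in>UNIV. (u t $ i) *\<^sub>R F i (x t)"
  define C where "C = real CARD('k) * (M * L)"
  have "C \<ge> 0" using L(1) M(1) by (simp add: C_def)
  obtain N1 where N1: "negligible N1"
    "\<And>t. t \<in> {0..1} - N1 \<Longrightarrow> (x has_vector_derivative ?f x t) (at t within {0..1})"
    using AE_lebesgue_on_imp_negligible[OF conjunct2[OF conjunct2[OF x[unfolded trajectory_def]]]] by auto
  obtain N2 where N2: "negligible N2"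
    "\<And>t. t \<in> {0..1} - N2 \<Longrightarrow> (y has_vector_derivative ?f y t) (at t within {0..1})"
    using AE_lebesgue_on_imp_negligible[OF conjunct2[OF conjunct2[OF y[unfolded trajectory_def]]]] by auto
  have "x t - y t = 0"
  proof (rule absolutely_continuous_path_zero[where d="\<lambda>t. x t - y t", OF _ \<open>C \<ge> 0\<close> negligible_Un[OF N1(1) N2(1)] _ _ t])
    show "absolutely_continuous_path 0 1 (\<lambda>t. x t - y t)"
      using x y unfolding trajectory_def by (intro absolutely_continuous_path_diff) auto
    show "x 0 - y 0 = 0" using x y unfolding trajectory_def by simp
    show "\<exists>v. ((\<lambda>t. x t - y t) has_vector_derivative v) (at t within {0..1}) \<and> norm v \<le> C * norm (x t - y t)"
      if t: "t \<in> {0..1} - (N1 \<union> N2)" for t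
    proof (intro exI conjI)
      show "((\<lambda>t. x t - y t) has_vector_derivative ?f x t - ?f y t) (at t within {0..1})"
        using t by (intro has_vector_derivative_diff N1 N2) auto
      have "norm (?f x t - ?f y t) = norm (\<Sum>i\<in>UNIV. (u t $ i) *\<^sub>R (F i (x t) - F i (y t)))"
        by (simp add: sum_subtractf scaleR_diff_right)
      also have "\<dots> \<le> (\<Sum>i\<in>(UNIV::'k set). M * (L * norm (x t - y t)))"
      proof (rule sum_norm_le)
        fix i
        have "\<bar>u t $ i\<bar> \<le> M" using component_le_norm_cart[of "u t" i] M(2)[of t] by linarith
        then show "norm ((u t $ i) *\<^sub>R (F i (x t) - F i (y t))) \<le> M * (L * norm (x t - y t))"
          using L M(1) by (simp add: mult_mono)
      qed
      also have "\<dots> = C * norm (x t - y t)" by (simp add: C_def)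
      finally show "norm (?f x t - ?f y t) \<le> C * norm (x t - y t)" .
    qed
  qed
  then show ?thesis by simp
qed

subsection \<open>Integral curves and reachable maps\<close>

lemma norm_diff_le_vector_derivative_bound:
  fixes x :: "real \<Rightarrow> 'a::real_normed_vector"
  assumes "\<And>t. t \<in> {0..1} \<Longrightarrow> (x has_vector_derivative x' t) (at t within {0..1})"
    and B: "\<And>t. t \<in> {0..1} \<Longrightarrow> norm (x' t) \<le> B"
    and "s \<in> {0..1}" "t \<in> {0..1}"
  shows "norm (x s - x t) \<le> B * \<bar>s - t\<bar>"
proof -
  have "norm (x s - x t) \<le> B * norm (s - t)"
  proof (rule differentiable_bound[where S="{0..1}" and f'="\<lambda>t h. h *\<^sub>R x' t"])
    show "onorm (\<lambda>h. h *\<^sub>R x' t) \<le> B" if "t \<in> {0..1}" for t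
    proof (rule onorm_le)
      show "norm (h *\<^sub>R x' t) \<le> B * norm h" for h
        using mult_left_mono[OF B[OF that], of "\<bar>h\<bar>"] by (simp add: mult.commute)
    qed
  qed (use assms in \<open>auto simp: has_vector_derivative_def\<close>)
  then show ?thesis by simp
qed

definition integral_curve :: "('a::real_normed_vector \<Rightarrow> 'a) \<Rightarrow> (real \<Rightarrow> 'a) \<Rightarrow> bool" where
  "integral_curve f x \<longleftrightarrow> (\<forall>t\<in>{0..1}. (x has_vector_derivative f (x t)) (at t within {0..1}))"

lemma integral_curve_exists:
  fixes f :: "'a::banach \<Rightarrow> 'a"
  assumes l: "\<And>x y. norm (f x - f y) \<le> l * norm (x - y)" and "l \<le> 1 / 2" "l \<ge> 0"
  obtains x where "x 0 = x0" "integral_curve f x"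
proof -
  have fc: "continuous_on UNIV f"
    by (rule lipschitz_on_continuous_on[where L=l])
      (use l \<open>l \<ge> 0\<close> in \<open>auto simp: lipschitz_on_def dist_norm\<close>)
  \<comment> \<open>Clamping time to the unit interval lets the operator act on bounded continuous
    functions on the whole line.\<close>
  define c where "c t = max 0 (min 1 t)" for t :: real
  have c: "c t \<in> {0..1}" for t by (auto simp: c_def)
  define G where "G g t = x0 + integral {0..c t} (\<lambda>s. f (apply_bcontfun g s))" for g t
  have cont: "continuous_on S (\<lambda>s. f (apply_bcontfun g s))" for S g
    by (rule continuous_on_compose2[OF fc]) auto
  have G: "G g \<in> bcontfun" for g
  proof -
    have c0: "continuous_on {0..1} (\<lambda>t. integral {0..t} (\<lambda>s. f (apply_bcontfun g s)))"
      by (intro indefinite_integral_continuous_1 integrable_continuous_real cont)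
    have "continuous_on UNIV (\<lambda>t. integral {0..c t} (\<lambda>s. f (apply_bcontfun g s)))"
      by (rule continuous_on_compose2[OF c0, where f=c]) (use c in \<open>auto simp: c_def intro!: continuous_intros\<close>)
    then have "continuous_on UNIV (G g)" unfolding G_def by (intro continuous_intros)
    moreover have "bounded (range (G g))"
    proof (rule bounded_subset)
      show "bounded ((\<lambda>t. x0 + integral {0..t} (\<lambda>s. f (apply_bcontfun g s))) ` {0..1})"
        by (intro compact_imp_bounded compact_continuous_image continuous_intros c0) auto
    qed (use c in \<open>auto simp: G_def\<close>)
    ultimately show ?thesis by (simp add: bcontfun_def)
  qed
  define \<Phi> where "\<Phi> g = Bcontfun (G g)" for g
  have \<Phi>: "apply_bcontfun (\<Phi> g) = G g" for g
    using G by (simp add: \<Phi>_def Bcontfun_inverse)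
  have "dist (\<Phi> g) (\<Phi> h) \<le> 1 / 2 * dist g h" for g h
  proof (rule dist_bound)
    fix t
    have "norm (integral {0..c t} (\<lambda>s. f (apply_bcontfun g s) - f (apply_bcontfun h s)))
        \<le> (1 / 2 * dist g h) * (c t - 0)"
    proof (rule integral_bound)
      fix s
      have "norm (f (apply_bcontfun g s) - f (apply_bcontfun h s)) \<le> l * dist (apply_bcontfun g s) (apply_bcontfun h s)"
        using l by (simp add: dist_norm)
      also have "\<dots> \<le> 1 / 2 * dist g h"
        using \<open>l \<le> 1 / 2\<close> \<open>l \<ge> 0\<close> by (intro mult_mono dist_bounded) auto
      finally show "norm (f (apply_bcontfun g s) - f (apply_bcontfun h s)) \<le> 1 / 2 * dist g h" .
    qed (use c in \<open>auto intro!: continuous_intros cont\<close>)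
    also have "\<dots> \<le> (1 / 2 * dist g h) * 1"
      using c[of t] by (intro mult_left_mono) auto
    finally have "norm (integral {0..c t} (\<lambda>s. f (apply_bcontfun g s)) - integral {0..c t} (\<lambda>s. f (apply_bcontfun h s)))
        \<le> 1 / 2 * dist g h"
      using integral_diff[OF integrable_continuous_real[OF cont] integrable_continuous_real[OF cont]] by simp
    then show "dist (apply_bcontfun (\<Phi> g) t) (apply_bcontfun (\<Phi> h) t) \<le> 1 / 2 * dist g h"
      by (simp add: \<Phi> G_def dist_norm)
  qed
  then obtain g where g: "\<Phi> g = g"
    using banach_fix_type[of "1 / 2" \<Phi>] by auto
  let ?x = "apply_bcontfun g"
  have x: "?x t = x0 + integral {0..c t} (\<lambda>s. f (?x s))" for t
    using fun_cong[OF \<Phi>[of g], of t] unfolding g G_def .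
  have "integral_curve f ?x"
    unfolding integral_curve_def
  proof
    fix t :: real assume t: "t \<in> {0..1}"
    have d: "((\<lambda>u. x0 + integral {0..u} (\<lambda>s. f (?x s))) has_vector_derivative 0 + f (?x t)) (at t within {0..1})"
      by (intro has_vector_derivative_add has_vector_derivative_const integral_has_vector_derivative cont t)
    have e: "x0 + integral {0..u} (\<lambda>s. f (?x s)) = ?x u" if u: "u \<in> {0..1}" for u
    proof -
      have "c u = u" using u by (simp add: c_def)
      then show ?thesis using x[of u] by (simp only:)
    qed
    show "(?x has_vector_derivative f (?x t)) (at t within {0..1})"
      by (rule has_vector_derivative_transform_within[OF d[unfolded add_0] zero_less_one t]) (rule e)
  qed
  moreover have "?x 0 = x0" by (subst x) (simp add: c_def)
  ultimately show ?thesis using that by blast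
qed

lemma integral_curve_lipschitz:
  assumes "integral_curve f x" "continuous_on UNIV f"
  obtains L where "L-lipschitz_on {0..1} x"
proof -
  have "continuous_on {0..1} x"
    using assms(1) unfolding integral_curve_def continuous_on_eq_continuous_within
    using has_vector_derivative_continuous by blast
  then have "continuous_on {0..1} (\<lambda>t. f (x t))"
    by (intro continuous_on_compose2[OF assms(2)]) auto
  then obtain B where B: "B > 0" "\<And>t. t \<in> {0..1} \<Longrightarrow> norm (f (x t)) \<le> B"
    using compact_imp_bounded[OF compact_continuous_image] bounded_pos
    by (metis (no_types, lifting) compact_Icc imageI)
  have "B-lipschitz_on {0..1} x"
    using norm_diff_le_vector_derivative_bound[of x "\<lambda>t. f (x t)" B] assms(1) B
    unfolding integral_curve_def by (auto simp: lipschitz_on_def dist_norm)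
  then show ?thesis using that by blast
qed

text \<open>Concatenation adds one switching time and rescales the old ones. A finite exceptional
  set survives this directly, and the Lipschitz bound supplies absolute continuity.\<close>

definition piecewise_trajectory ::
    "('k::finite \<Rightarrow> real^'n \<Rightarrow> real^'n) \<Rightarrow> (real \<Rightarrow> real^'k) \<Rightarrow> (real \<Rightarrow> real^'n) \<Rightarrow> bool" where
  "piecewise_trajectory F u x \<longleftrightarrow> (\<exists>L. L-lipschitz_on {0..1} x) \<and> (\<exists>S. finite S \<and>
     (\<forall>t\<in>{0..1} - S. (x has_vector_derivative (\<Sum>i\<in>UNIV. (u t $ i) *\<^sub>R F i (x t))) (at t within {0..1})))"

lemma piecewise_trajectory_imp_trajectory:
  assumes "piecewise_trajectory F u x"
  shows "trajectory F u (x 0) x"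
proof -
  obtain L S where L: "L-lipschitz_on {0..1} x" and S: "finite S"
    "\<forall>t\<in>{0..1} - S. (x has_vector_derivative (\<Sum>i\<in>UNIV. (u t $ i) *\<^sub>R F i (x t))) (at t within {0..1})"
    using assms unfolding piecewise_trajectory_def by blast
  have "S \<in> null_sets lebesgue"
    using S(1) negligible_iff_null_sets negligible_finite by blast
  then have "AE t in lebesgue. t \<notin> S" by (rule AE_not_in)
  then have "AE t in lebesgue_on {0..1}. t \<notin> S"
    by (auto simp: AE_restrict_space_iff)
  then have "AE t in lebesgue_on {0..1}.
      (x has_vector_derivative (\<Sum>i\<in>UNIV. (u t $ i) *\<^sub>R F i (x t))) (at t within {0..1})"
    using AE_space[of "lebesgue_on {0..1::real}"]
    by eventually_elim (use S(2) in \<open>auto simp: space_restrict_space\<close>)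
  then show ?thesis
    using lipschitz_on_imp_absolutely_continuous_path[OF L] by (simp add: trajectory_def)
qed

text \<open>The control is chosen before the starting point, so \<open>g\<close> is realised as a
  whole map. Boundedness of the control yields both uniqueness of trajectories and square
  integrability.\<close>

definition reachable :: "('k::finite \<Rightarrow> real^'n \<Rightarrow> real^'n) \<Rightarrow> (real^'n \<Rightarrow> real^'n) \<Rightarrow> bool" where
  "reachable F g \<longleftrightarrow> (\<exists>u. u \<in> borel_measurable borel \<and> bounded (range u) \<and>
     (\<forall>x0. \<exists>x. piecewise_trajectory F u x \<and> x 0 = x0 \<and> x 1 = g x0))"

lemma reachable_imp_flow:
  assumes F: "\<forall>i. \<exists>L. L-lipschitz_on UNIV (F i)" and "reachable F g"
  obtains u where "u \<in> controls" "flow F u = g"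
proof -
  obtain u where u: "u \<in> borel_measurable borel" "bounded (range u)"
    "\<And>x0. \<exists>x. piecewise_trajectory F u x \<and> x 0 = x0 \<and> x 1 = g x0"
    using assms(2) unfolding reachable_def by blast
  have "flow F u x0 = g x0" for x0
  proof -
    obtain x where x: "piecewise_trajectory F u x" "x 0 = x0" "x 1 = g x0" using u(3) by blast
    then have tr: "trajectory F u x0 x"
      using piecewise_trajectory_imp_trajectory by blast
    show ?thesis
      unfolding flow_def
    proof (rule the_equality)
      show "\<exists>x. trajectory F u x0 x \<and> g x0 = x 1" using tr x by auto
      show "y = g x0" if "\<exists>x. trajectory F u x0 x \<and> y = x 1" for y
        using that trajectory_unique[OF F u(2) tr, of _ 1] x(3) by auto
    qed
  qed
  moreover have "u \<in> controls"
  proof -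
    obtain M where M: "\<And>t. norm (u t) \<le> M"
      using u(2) unfolding bounded_iff by auto
    have meas: "u \<in> borel_measurable (lebesgue_on {0..1})"
      using u(1) by (intro measurable_restrict_space1) (simp add: measurable_completion)
    have "integrable (lebesgue_on {0..1}) (\<lambda>t. (norm (u t))\<^sup>2)"
    proof (rule Bochner_Integration.integrable_bound[where f="\<lambda>t. M\<^sup>2"])
      show "integrable (lebesgue_on {0..1}) (\<lambda>t::real. M\<^sup>2)"
        by (intro finite_measure.integrable_const finite_measure_lebesgue_on) auto
      show "(\<lambda>t. (norm (u t))\<^sup>2) \<in> borel_measurable (lebesgue_on {0..1})"
        using meas by simp
    qed (use M in \<open>auto intro!: AE_I2 power_mono\<close>)
    then show ?thesis using meas by (simp add: controls_def)
  qed
  ultimately show ?thesis using that by blast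
qed

text \<open>The two controls are run one after the other at double speed, first the one for the
  inner map \<open>f\<close>.\<close>

lemma reachable_comp:
  assumes "reachable F g" "reachable F f"
  shows "reachable F (\<lambda>x. g (f x))"
proof -
  obtain u where u: "u \<in> borel_measurable borel" "bounded (range u)"
    "\<And>x0. \<exists>x. piecewise_trajectory F u x \<and> x 0 = x0 \<and> x 1 = f x0"
    using assms(2) unfolding reachable_def by blast
  obtain v where v: "v \<in> borel_measurable borel" "bounded (range v)"
    "\<And>x0. \<exists>x. piecewise_trajectory F v x \<and> x 0 = x0 \<and> x 1 = g x0"
    using assms(1) unfolding reachable_def by blast
  define w where "w t = (if t \<le> 1 / 2 then 2 *\<^sub>R u (2 * t) else 2 *\<^sub>R v (2 * t - 1))" for t
  have "w \<in> borel_measurable borel"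
    unfolding w_def using u(1) v(1) by measurable
  moreover have "bounded (range w)"
  proof -
    obtain M M' where "\<And>t. norm (u t) \<le> M" "\<And>t. norm (v t) \<le> M'"
      using u(2) v(2) unfolding bounded_iff by auto
    then show ?thesis
      by (auto simp: bounded_iff w_def intro!: exI[of _ "2 * max M M'"] le_max_iff_disj[THEN iffD2])
  qed
  moreover have "\<exists>x. piecewise_trajectory F w x \<and> x 0 = x0 \<and> x 1 = g (f x0)" for x0
  proof -
    obtain x where x: "piecewise_trajectory F u x" "x 0 = x0" "x 1 = f x0" using u(3) by blast
    obtain y where y: "piecewise_trajectory F v y" "y 0 = f x0" "y 1 = g (f x0)" using v(3) by blast
    define z where "z t = (if t \<le> 1 / 2 then x (2 * t) else y (2 * t - 1))" for t
    obtain L S where L: "L-lipschitz_on {0..1} x" and S: "finite S"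
      "\<And>t. t \<in> {0..1} - S \<Longrightarrow> (x has_vector_derivative (\<Sum>i\<in>UNIV. (u t $ i) *\<^sub>R F i (x t))) (at t within {0..1})"
      using x(1) unfolding piecewise_trajectory_def by blast
    obtain L' S' where L': "L'-lipschitz_on {0..1} y" and S': "finite S'"
      "\<And>t. t \<in> {0..1} - S' \<Longrightarrow> (y has_vector_derivative (\<Sum>i\<in>UNIV. (v t $ i) *\<^sub>R F i (y t))) (at t within {0..1})"
      using y(1) unfolding piecewise_trajectory_def by blast
    have i1: "(\<lambda>t::real. 2 * t) ` {0..1/2} = {0..1}"
      by (auto simp: image_iff intro!: bexI[of _ "x / 2" for x])
    have i2: "(\<lambda>t::real. 2 * t - 1) ` {1/2..1} = {0..1}"
      by (auto simp: image_iff field_simps intro!: bexI[of _ "(x + 1) / 2" for x])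
    have lip: "(max (2 * L) (2 * L'))-lipschitz_on {0..1} z"
      unfolding z_def
    proof (rule lipschitz_on_concat_max)
      show "(2 * L)-lipschitz_on {0..1/2} (\<lambda>t. x (2 * t))"
      proof (rule lipschitz_onI)
        fix s t :: real assume "s \<in> {0..1/2}" "t \<in> {0..1/2}"
        moreover have "\<bar>2 * s - 2 * t\<bar> = 2 * \<bar>s - t\<bar>"
          using abs_mult[of 2 "s - t"] by simp
        ultimately show "dist (x (2 * s)) (x (2 * t)) \<le> 2 * L * dist s t"
          using lipschitz_onD[OF L, of "2 * s" "2 * t"] by (simp add: dist_real_def mult_ac)
      qed (use L lipschitz_on_nonneg in auto)
      show "(2 * L')-lipschitz_on {1/2..1} (\<lambda>t. y (2 * t - 1))"
      proof (rule lipschitz_onI)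
        fix s t :: real assume "s \<in> {1/2..1}" "t \<in> {1/2..1}"
        moreover have "\<bar>2 * s - 2 * t\<bar> = 2 * \<bar>s - t\<bar>"
          using abs_mult[of 2 "s - t"] by simp
        ultimately show "dist (y (2 * s - 1)) (y (2 * t - 1)) \<le> 2 * L' * dist s t"
          using lipschitz_onD[OF L', of "2 * s - 1" "2 * t - 1"]
          by (simp add: dist_real_def mult_ac)
      qed (use L' lipschitz_on_nonneg in auto)
    qed (use x y in auto)
    \<comment> \<open>The rescaled switching times of both pieces, together with the new one at
      1/2.\<close>
    have fin: "finite ((\<lambda>t. t / 2) ` S \<union> (\<lambda>t. (t + 1) / 2) ` S' \<union> {1/2})"
      using S(1) S'(1) by simp
    have der: "(z has_vector_derivative (\<Sum>i\<in>UNIV. (w t $ i) *\<^sub>R F i (z t))) (at t within {0..1})"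
      if t: "t \<in> {0..1} - ((\<lambda>t. t / 2) ` S \<union> (\<lambda>t. (t + 1) / 2) ` S' \<union> {1/2})" for t
    proof (cases "t < 1 / 2")
      case True
      have "2 * t \<notin> S"
      proof
        assume "2 * t \<in> S"
        then have "t \<in> (\<lambda>t. t / 2) ` S" by (intro image_eqI[of _ _ "2 * t"]) auto
        then show False using t by blast
      qed
      then have "(x has_vector_derivative (\<Sum>i\<in>UNIV. (u (2 * t) $ i) *\<^sub>R F i (x (2 * t)))) (at (2 * t) within (\<lambda>t. 2 * t) ` {0..1/2})"
        using S(2)[of "2 * t"] True t unfolding i1 by auto
      moreover have "((\<lambda>t. 2 * t) has_vector_derivative 2) (at t within {0..1/2})"
        by (auto intro!: derivative_eq_intros)
      ultimately have "(x \<circ> (\<lambda>t. 2 * t) has_vector_derivative 2 *\<^sub>R (\<Sum>i\<in>UNIV. (u (2 * t) $ i) *\<^sub>R F i (x (2 * t)))) (at t within {0..1/2})"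
        by (intro vector_diff_chain_within)
      \<comment> \<open>Away from 1/2 only one piece is visible near \<open>t\<close>, so
        derivatives within a half interval and within the whole one agree.\<close>
      moreover have "at t within {0..1/2} = at t within {0..1}"
        by (rule at_within_nhd[where S="{..<1/2}"]) (use True in auto)
      ultimately have "((\<lambda>t. x (2 * t)) has_vector_derivative (\<Sum>i\<in>UNIV. (w t $ i) *\<^sub>R F i (z t))) (at t within {0..1})"
        using True by (simp add: w_def z_def o_def scaleR_sum_right)
      then show ?thesis
        by (rule has_vector_derivative_transform_within[where d="1/2 - t"])
          (use True t in \<open>auto simp: z_def dist_real_def\<close>)
    next
      case False
      then have t2: "t > 1 / 2" using t by auto
      have "2 * t - 1 \<notin> S'"
      proof
        assume "2 * t - 1 \<in> S'"
        then have "t \<in> (\<lambda>t. (t + 1) / 2) ` S'" by (intro image_eqI[of _ _ "2 * t - 1"]) auto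
        then show False using t by blast
      qed
      then have "(y has_vector_derivative (\<Sum>i\<in>UNIV. (v (2 * t - 1) $ i) *\<^sub>R F i (y (2 * t - 1)))) (at (2 * t - 1) within (\<lambda>t. 2 * t - 1) ` {1/2..1})"
        using S'(2)[of "2 * t - 1"] t2 t unfolding i2 by auto
      moreover have "((\<lambda>t. 2 * t - 1) has_vector_derivative 2) (at t within {1/2..1})"
        by (auto intro!: derivative_eq_intros)
      ultimately have "(y \<circ> (\<lambda>t. 2 * t - 1) has_vector_derivative 2 *\<^sub>R (\<Sum>i\<in>UNIV. (v (2 * t - 1) $ i) *\<^sub>R F i (y (2 * t - 1)))) (at t within {1/2..1})"
        by (intro vector_diff_chain_within)
      moreover have "at t within {1/2..1} = at t within {0..1}"
        by (rule at_within_nhd[where S="{1/2<..}"]) (use t2 in auto)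
      ultimately have "((\<lambda>t. y (2 * t - 1)) has_vector_derivative (\<Sum>i\<in>UNIV. (w t $ i) *\<^sub>R F i (z t))) (at t within {0..1})"
        using t2 by (simp add: w_def z_def o_def scaleR_sum_right)
      then show ?thesis
        by (rule has_vector_derivative_transform_within[where d="t - 1/2"])
          (use t2 t in \<open>auto simp: z_def dist_real_def\<close>)
    qed
    have "piecewise_trajectory F w z"
      unfolding piecewise_trajectory_def
      by (intro conjI exI ballI, rule lip, rule fin, erule der)
    moreover have "z 0 = x0" "z 1 = g (f x0)" using x y by (auto simp: z_def)
    ultimately show ?thesis by blast
  qed
  ultimately show ?thesis unfolding reachable_def by blast
qed

section \<open>Quantitative estimates for integral curves over unit time\<close>

text \<open>At a maximum point of \<open>norm (d t)\<close> the feedback term contributes at most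
  half of that maximum and is absorbed on the left, which doubles the rest. The hypothesis
  \<open>\<bar>\<tau>\<bar> * L \<le> 1 / 2\<close> in the estimates below is what makes the
  feedback coefficient at most 1/2.\<close>

lemma norm_le_by_half_feedback:
  fixes d :: "real \<Rightarrow> 'a::real_normed_vector"
  assumes der: "\<And>t. t \<in> {0..1} \<Longrightarrow> (d has_vector_derivative d' t) (at t within {0..1})"
    and bound: "\<And>t. t \<in> {0..1} \<Longrightarrow> norm (d' t) \<le> A + norm (d t) / 2"
    and t: "t \<in> {0..1}"
  shows "norm (d t) \<le> 2 * (norm (d 0) + A)"
proof -
  have "continuous_on {0..1} d"
    unfolding continuous_on_eq_continuous_within
    using der has_vector_derivative_continuous by blast
  then have "continuous_on {0..1} (\<lambda>t. norm (d t))" by (rule continuous_on_norm)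
  then obtain m where m: "m \<in> {0..1}" "\<And>t. t \<in> {0..1} \<Longrightarrow> norm (d t) \<le> norm (d m)"
    using continuous_attains_sup[of "{0..1}" "\<lambda>t. norm (d t)"] by auto
  have "norm (d m - d 0) \<le> (A + norm (d m) / 2) * \<bar>m - 0\<bar>"
  proof (rule norm_diff_le_vector_derivative_bound[OF der])
    fix t :: real assume "t \<in> {0..1}"
    then show "norm (d' t) \<le> A + norm (d m) / 2" using bound[of t] m(2)[of t] by simp
  qed (use m in auto)
  also have "\<dots> \<le> (A + norm (d m) / 2) * 1"
    using m(1) order_trans[OF norm_ge_zero bound[OF m(1)]] by (intro mult_left_mono) auto
  finally have "norm (d m) \<le> 2 * (norm (d 0) + A)"
    using norm_triangle_ineq2[of "d m" "d 0"] by simp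
  then show ?thesis using m(2)[OF t] by simp
qed

lemma integral_curve_displacement:
  assumes \<gamma>: "integral_curve (\<lambda>y. \<tau> *\<^sub>R f y) \<gamma>"
    and L: "\<And>x y. norm (f x - f y) \<le> L * norm (x - y)" and \<tau>: "\<bar>\<tau>\<bar> * L \<le> 1 / 2"
    and t: "t \<in> {0..1}"
  shows "norm (\<gamma> t - \<gamma> 0) \<le> 2 * \<bar>\<tau>\<bar> * norm (f (\<gamma> 0))"
proof -
  have "norm (\<gamma> t - \<gamma> 0) \<le> 2 * (norm (\<gamma> 0 - \<gamma> 0) + \<bar>\<tau>\<bar> * norm (f (\<gamma> 0)))"
  proof (rule norm_le_by_half_feedback[OF _ _ t])
    fix t :: real assume t: "t \<in> {0..1}"
    show "((\<lambda>t. \<gamma> t - \<gamma> 0) has_vector_derivative \<tau> *\<^sub>R f (\<gamma> t) - 0) (at t within {0..1})"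
      using \<gamma> t unfolding integral_curve_def
      by (intro has_vector_derivative_diff has_vector_derivative_const) auto
    have "norm (f (\<gamma> t)) \<le> norm (f (\<gamma> 0)) + L * norm (\<gamma> t - \<gamma> 0)"
      using L[of "\<gamma> t" "\<gamma> 0"] norm_triangle_ineq2[of "f (\<gamma> t)" "f (\<gamma> 0)"] by linarith
    then have "\<bar>\<tau>\<bar> * norm (f (\<gamma> t)) \<le> \<bar>\<tau>\<bar> * (norm (f (\<gamma> 0)) + L * norm (\<gamma> t - \<gamma> 0))"
      by (intro mult_left_mono) auto
    moreover have "(\<bar>\<tau>\<bar> * L) * norm (\<gamma> t - \<gamma> 0) \<le> 1 / 2 * norm (\<gamma> t - \<gamma> 0)"
      by (intro mult_right_mono \<tau>) auto
    ultimately show "norm (\<tau> *\<^sub>R f (\<gamma> t) - 0) \<le> \<bar>\<tau>\<bar> * norm (f (\<gamma> 0)) + norm (\<gamma> t - \<gamma> 0) / 2"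
      by (simp add: algebra_simps)
  qed
  then show ?thesis by simp
qed

lemma integral_curve_separation:
  assumes \<gamma>: "integral_curve (\<lambda>y. \<tau> *\<^sub>R f y) \<gamma>" and \<delta>: "integral_curve (\<lambda>y. \<tau> *\<^sub>R f y) \<delta>"
    and L: "\<And>x y. norm (f x - f y) \<le> L * norm (x - y)" and \<tau>: "\<bar>\<tau>\<bar> * L \<le> 1 / 2"
    and t: "t \<in> {0..1}"
  shows "norm (\<gamma> t - \<delta> t) \<le> 2 * norm (\<gamma> 0 - \<delta> 0)"
proof -
  have "norm (\<gamma> t - \<delta> t) \<le> 2 * (norm (\<gamma> 0 - \<delta> 0) + 0)"
  proof (rule norm_le_by_half_feedback[OF _ _ t])
    fix t :: real assume t: "t \<in> {0..1}"
    show "((\<lambda>t. \<gamma> t - \<delta> t) has_vector_derivative \<tau> *\<^sub>R f (\<gamma> t) - \<tau> *\<^sub>R f (\<delta> t)) (at t within {0..1})"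
      using \<gamma> \<delta> t unfolding integral_curve_def by (intro has_vector_derivative_diff) auto
    have "norm (\<tau> *\<^sub>R f (\<gamma> t) - \<tau> *\<^sub>R f (\<delta> t)) = \<bar>\<tau>\<bar> * norm (f (\<gamma> t) - f (\<delta> t))"
      by (simp flip: scaleR_diff_right)
    also have "\<dots> \<le> \<bar>\<tau>\<bar> * (L * norm (\<gamma> t - \<delta> t))"
      by (intro mult_left_mono L) auto
    also have "\<dots> = (\<bar>\<tau>\<bar> * L) * norm (\<gamma> t - \<delta> t)" by simp
    also have "\<dots> \<le> 1 / 2 * norm (\<gamma> t - \<delta> t)"
      by (intro mult_right_mono \<tau>) auto
    finally show "norm (\<tau> *\<^sub>R f (\<gamma> t) - \<tau> *\<^sub>R f (\<delta> t)) \<le> 0 + norm (\<gamma> t - \<delta> t) / 2" by simp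
  qed
  then show ?thesis by simp
qed

text \<open>After uniform motion with the initial velocity is subtracted, the speed is at most
  \<open>\<bar>\<tau>\<bar> * L\<close> times the displacement. The displacement is itself of order
  \<open>\<tau>\<close>, which gives the quadratic error.\<close>

lemma integral_curve_expansion:
  assumes \<gamma>: "integral_curve (\<lambda>y. \<tau> *\<^sub>R f y) \<gamma>"
    and L: "\<And>x y. norm (f x - f y) \<le> L * norm (x - y)" and \<tau>: "\<bar>\<tau>\<bar> * L \<le> 1 / 2" and "L \<ge> 0"
  shows "norm (\<gamma> 1 - \<gamma> 0 - \<tau> *\<^sub>R f (\<gamma> 0)) \<le> 2 * L * \<tau>\<^sup>2 * norm (f (\<gamma> 0))"
proof -
  let ?d = "\<lambda>t. \<gamma> t - t *\<^sub>R (\<tau> *\<^sub>R f (\<gamma> 0))"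
  have *: "norm (?d 1 - ?d 0) \<le> (\<bar>\<tau>\<bar> * (L * (2 * \<bar>\<tau>\<bar> * norm (f (\<gamma> 0))))) * \<bar>1 - 0\<bar>"
  proof (rule norm_diff_le_vector_derivative_bound)
    fix t :: real assume t: "t \<in> {0..1}"
    have "((\<lambda>t. t *\<^sub>R (\<tau> *\<^sub>R f (\<gamma> 0))) has_vector_derivative \<tau> *\<^sub>R f (\<gamma> 0)) (at t within {0..1})"
      by (auto intro!: derivative_eq_intros)
    then show "(?d has_vector_derivative \<tau> *\<^sub>R f (\<gamma> t) - \<tau> *\<^sub>R f (\<gamma> 0)) (at t within {0..1})"
      using \<gamma> t unfolding integral_curve_def by (intro has_vector_derivative_diff) auto
    have "norm (\<tau> *\<^sub>R f (\<gamma> t) - \<tau> *\<^sub>R f (\<gamma> 0)) = \<bar>\<tau>\<bar> * norm (f (\<gamma> t) - f (\<gamma> 0))"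
      by (simp flip: scaleR_diff_right)
    also have "\<dots> \<le> \<bar>\<tau>\<bar> * (L * norm (\<gamma> t - \<gamma> 0))"
      by (intro mult_left_mono L) auto
    also have "\<dots> \<le> \<bar>\<tau>\<bar> * (L * (2 * \<bar>\<tau>\<bar> * norm (f (\<gamma> 0))))"
      by (intro mult_left_mono integral_curve_displacement[OF \<gamma> L \<tau> t] \<open>L \<ge> 0\<close>) auto
    finally show "norm (\<tau> *\<^sub>R f (\<gamma> t) - \<tau> *\<^sub>R f (\<gamma> 0)) \<le> \<bar>\<tau>\<bar> * (L * (2 * \<bar>\<tau>\<bar> * norm (f (\<gamma> 0))))" .
  qed auto
  have "?d 1 - ?d 0 = \<gamma> 1 - \<gamma> 0 - \<tau> *\<^sub>R f (\<gamma> 0)" by simp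
  moreover have "(\<bar>\<tau>\<bar> * (L * (2 * \<bar>\<tau>\<bar> * norm (f (\<gamma> 0))))) * \<bar>1 - 0\<bar> = 2 * L * \<tau>\<^sup>2 * norm (f (\<gamma> 0))"
    unfolding power2_abs[symmetric, of \<tau>] power2_eq_square by simp
  ultimately show ?thesis using * by (simp only:)
qed

text \<open>A linearised flow in difference form. The error is proportional to
  \<open>norm w\<close>, however small \<open>w\<close> is compared with \<open>\<tau>\<close>; this
  relative form is what the bracket estimate relies on. Half of the constant 4 comes from strict
  differentiability along curves separated by at most \<open>2 * norm w\<close>, half from the drift
  of their difference away from \<open>w\<close>.\<close>

lemma integral_curve_difference_expansion:
  assumes \<gamma>: "integral_curve (\<lambda>y. \<tau> *\<^sub>R f y) \<gamma>" and \<delta>: "integral_curve (\<lambda>y. \<tau> *\<^sub>R f y) \<delta>"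
    and L: "\<And>x y. norm (f x - f y) \<le> L * norm (x - y)" and \<tau>: "\<bar>\<tau>\<bar> * L \<le> 1 / 2"
    and "linear A" and A: "\<And>v. norm (A v) \<le> L * norm v" and \<theta>: "\<bar>\<tau>\<bar> * L * L \<le> \<theta>" and "L \<ge> 0"
    and strict: "\<And>t. t \<in> {0..1} \<Longrightarrow> norm (f (\<gamma> t) - f (\<delta> t) - A (\<gamma> t - \<delta> t)) \<le> \<theta> * norm (\<gamma> t - \<delta> t)"
  defines "w \<equiv> \<gamma> 0 - \<delta> 0"
  shows "norm (\<gamma> 1 - \<delta> 1 - w - \<tau> *\<^sub>R A w) \<le> 4 * \<theta> * \<bar>\<tau>\<bar> * norm w"
proof -
  let ?z = "\<lambda>t. \<gamma> t - \<delta> t"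
  have "\<theta> \<ge> 0" using \<theta> \<open>L \<ge> 0\<close> by (smt (verit) abs_ge_zero mult_nonneg_nonneg)
  have z: "norm (?z t) \<le> 2 * norm w" if "t \<in> {0..1}" for t
    using integral_curve_separation[OF \<gamma> \<delta> L \<tau> that] by (simp add: w_def)
  have dz: "(?z has_vector_derivative \<tau> *\<^sub>R f (\<gamma> t) - \<tau> *\<^sub>R f (\<delta> t)) (at t within {0..1})" if "t \<in> {0..1}" for t
    using \<gamma> \<delta> that unfolding integral_curve_def by (intro has_vector_derivative_diff) auto
  have zw: "norm (?z t - w) \<le> \<bar>\<tau>\<bar> * (L * (2 * norm w))" if t: "t \<in> {0..1}" for t
  proof -
    have "norm (?z t - ?z 0) \<le> (\<bar>\<tau>\<bar> * (L * (2 * norm w))) * \<bar>t - 0\<bar>"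
    proof (rule norm_diff_le_vector_derivative_bound[OF dz])
      fix t :: real assume t: "t \<in> {0..1}"
      have "norm (\<tau> *\<^sub>R f (\<gamma> t) - \<tau> *\<^sub>R f (\<delta> t)) = \<bar>\<tau>\<bar> * norm (f (\<gamma> t) - f (\<delta> t))"
        by (simp flip: scaleR_diff_right)
      also have "\<dots> \<le> \<bar>\<tau>\<bar> * (L * norm (?z t))"
        by (intro mult_left_mono L) auto
      also have "\<dots> \<le> \<bar>\<tau>\<bar> * (L * (2 * norm w))"
        using z[OF t] \<open>L \<ge> 0\<close> by (intro mult_left_mono) auto
      finally show "norm (\<tau> *\<^sub>R f (\<gamma> t) - \<tau> *\<^sub>R f (\<delta> t)) \<le> \<bar>\<tau>\<bar> * (L * (2 * norm w))" .
    qed (use t in auto)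
    also have "\<dots> \<le> (\<bar>\<tau>\<bar> * (L * (2 * norm w))) * 1"
      using t \<open>L \<ge> 0\<close> by (intro mult_left_mono) auto
    finally show ?thesis by (simp add: w_def)
  qed
  let ?d = "\<lambda>t. ?z t - t *\<^sub>R (\<tau> *\<^sub>R A w)"
  have *: "norm (?d 1 - ?d 0) \<le> (\<bar>\<tau>\<bar> * (4 * \<theta> * norm w)) * \<bar>1 - 0\<bar>"
  proof (rule norm_diff_le_vector_derivative_bound)
    fix t :: real assume t: "t \<in> {0..1}"
    have "((\<lambda>t. t *\<^sub>R (\<tau> *\<^sub>R A w)) has_vector_derivative \<tau> *\<^sub>R A w) (at t within {0..1})"
      by (auto intro!: derivative_eq_intros)
    then show "(?d has_vector_derivative \<tau> *\<^sub>R f (\<gamma> t) - \<tau> *\<^sub>R f (\<delta> t) - \<tau> *\<^sub>R A w) (at t within {0..1})"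
      by (intro has_vector_derivative_diff[OF dz[OF t]])
    have "f (\<gamma> t) - f (\<delta> t) - A w = (f (\<gamma> t) - f (\<delta> t) - A (?z t)) + A (?z t - w)"
      by (simp add: linear_diff[OF \<open>linear A\<close>])
    then have "norm (f (\<gamma> t) - f (\<delta> t) - A w) \<le> \<theta> * norm (?z t) + L * norm (?z t - w)"
      using norm_triangle_mono[OF strict[OF t] A[of "?z t - w"]] by (simp only:)
    also have "\<dots> \<le> \<theta> * (2 * norm w) + L * (\<bar>\<tau>\<bar> * (L * (2 * norm w)))"
      using z[OF t] zw[OF t] \<open>\<theta> \<ge> 0\<close> \<open>L \<ge> 0\<close> by (intro add_mono mult_left_mono) auto
    also have "L * (\<bar>\<tau>\<bar> * (L * (2 * norm w))) = (\<bar>\<tau>\<bar> * L * L) * (2 * norm w)" by simp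
    also have "\<dots> \<le> \<theta> * (2 * norm w)" by (intro mult_right_mono \<theta>) auto
    finally have "norm (f (\<gamma> t) - f (\<delta> t) - A w) \<le> 4 * \<theta> * norm w" by simp
    then have "\<bar>\<tau>\<bar> * norm (f (\<gamma> t) - f (\<delta> t) - A w) \<le> \<bar>\<tau>\<bar> * (4 * \<theta> * norm w)"
      by (intro mult_left_mono) auto
    then show "norm (\<tau> *\<^sub>R f (\<gamma> t) - \<tau> *\<^sub>R f (\<delta> t) - \<tau> *\<^sub>R A w) \<le> \<bar>\<tau>\<bar> * (4 * \<theta> * norm w)"
      by (simp flip: scaleR_diff_right)
  qed auto
  have "?d 1 - ?d 0 = \<gamma> 1 - \<delta> 1 - w - \<tau> *\<^sub>R A w" by (simp add: w_def)
  moreover have "(\<bar>\<tau>\<bar> * (4 * \<theta> * norm w)) * \<bar>1 - 0\<bar> = 4 * \<theta> * \<bar>\<tau>\<bar> * norm w" by simp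
  ultimately show ?thesis using * by (simp only:)
qed

section \<open>Flows of single fields as reachable maps\<close>

lemma integral_curve_imp_piecewise_trajectory:
  fixes F :: "'k::finite \<Rightarrow> real^'n \<Rightarrow> real^'n"
  assumes \<gamma>: "integral_curve (\<lambda>y. \<tau> *\<^sub>R F i y) \<gamma>" and "continuous_on UNIV (F i)"
  shows "piecewise_trajectory F (\<lambda>_. \<tau> *\<^sub>R axis i 1) \<gamma>"
proof -
  have "continuous_on UNIV (\<lambda>y. \<tau> *\<^sub>R F i y)" using assms(2) by (intro continuous_intros)
  then obtain K where K: "K-lipschitz_on {0..1} \<gamma>" using integral_curve_lipschitz[OF \<gamma>] by blast
  have "(\<Sum>j\<in>UNIV. ((\<tau> *\<^sub>R axis i 1 :: real^'k) $ j) *\<^sub>R F j y) = \<tau> *\<^sub>R F i y" for y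
  proof -
    have "(\<Sum>j\<in>UNIV. ((\<tau> *\<^sub>R axis i 1 :: real^'k) $ j) *\<^sub>R F j y)
        = (\<Sum>j\<in>UNIV. if j = i then \<tau> *\<^sub>R F i y else 0)"
      by (intro sum.cong) (auto simp: axis_def)
    then show ?thesis by simp
  qed
  then show ?thesis
    using K \<gamma> unfolding piecewise_trajectory_def integral_curve_def by (auto intro!: exI[of _ "{}"])
qed

text \<open>The constant control \<open>\<tau>\<close> in direction \<open>i\<close> does it. The
  sign of \<open>\<tau>\<close> is free, so inverse flows are reachable as well.\<close>

lemma reachable_exponential:
  fixes F :: "'k::finite \<Rightarrow> real^'n \<Rightarrow> real^'n"
  assumes L: "\<And>x y. norm (F i x - F i y) \<le> L * norm (x - y)" and \<tau>: "\<bar>\<tau>\<bar> * L \<le> 1 / 2" and "L \<ge> 0"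
  obtains E where "reachable F E"
    "\<And>x. \<exists>\<gamma>. \<gamma> 0 = x \<and> \<gamma> 1 = E x \<and> integral_curve (\<lambda>y. \<tau> *\<^sub>R F i y) \<gamma>"
proof -
  have cont: "continuous_on UNIV (F i)"
    by (rule lipschitz_on_continuous_on[where L=L])
      (use L \<open>L \<ge> 0\<close> in \<open>auto simp: lipschitz_on_def dist_norm\<close>)
  have "\<exists>\<gamma>. \<gamma> 0 = x \<and> integral_curve (\<lambda>y. \<tau> *\<^sub>R F i y) \<gamma>" for x
  proof -
    have "norm (\<tau> *\<^sub>R F i y - \<tau> *\<^sub>R F i z) \<le> (\<bar>\<tau>\<bar> * L) * norm (y - z)" for y z
      using mult_left_mono[OF L[of y z], of "\<bar>\<tau>\<bar>"] by (simp flip: scaleR_diff_right add: mult.assoc)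
    then show ?thesis
      using integral_curve_exists[of "\<lambda>y. \<tau> *\<^sub>R F i y" "\<bar>\<tau>\<bar> * L"] \<tau> \<open>L \<ge> 0\<close>
      by (metis abs_ge_zero mult_nonneg_nonneg)
  qed
  then obtain \<gamma> where \<gamma>: "\<And>x. \<gamma> x 0 = x" "\<And>x. integral_curve (\<lambda>y. \<tau> *\<^sub>R F i y) (\<gamma> x)"
    by metis
  have "reachable F (\<lambda>x. \<gamma> x 1)"
    unfolding reachable_def
    using \<gamma> integral_curve_imp_piecewise_trajectory[where F=F and i=i and \<tau>=\<tau>, OF \<gamma>(2) cont]
    by (intro exI[of _ "\<lambda>_. \<tau> *\<^sub>R axis i 1"]) auto
  then show ?thesis
    using that[of "\<lambda>x. \<gamma> x 1"] \<gamma> by blast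
qed

lemma integral_curve_reverse:
  assumes "integral_curve f \<gamma>"
  shows "integral_curve (\<lambda>y. - f y) (\<lambda>t. \<gamma> (1 - t))"
  unfolding integral_curve_def
proof
  fix t :: real assume t: "t \<in> {0..1}"
  have im: "(\<lambda>t::real. 1 - t) ` {0..1} = {0..1}"
    by (auto simp: image_iff intro!: bexI[of _ "1 - x" for x])
  have "(\<gamma> has_vector_derivative f (\<gamma> (1 - t))) (at (1 - t) within (\<lambda>t. 1 - t) ` {0..1})"
    using assms t unfolding im integral_curve_def by auto
  moreover have "((\<lambda>t. 1 - t) has_vector_derivative -1) (at t within {0..1})"
    by (auto intro!: derivative_eq_intros)
  ultimately have "(\<gamma> \<circ> (\<lambda>t. 1 - t) has_vector_derivative (-1) *\<^sub>R f (\<gamma> (1 - t))) (at t within {0..1})"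
    by (intro vector_diff_chain_within)
  then show "((\<lambda>t. \<gamma> (1 - t)) has_vector_derivative - f (\<gamma> (1 - t))) (at t within {0..1})"
    by (simp add: o_def)
qed

text \<open>Time reversal turns \<open>\<delta>\<close> into a trajectory of the same constant
  control as \<open>\<gamma>\<close>, with the same starting point; uniqueness identifies them. This
  stands in for the group law of the flow.\<close>

lemma integral_curve_there_and_back:
  fixes F :: "'k::finite \<Rightarrow> real^'n \<Rightarrow> real^'n"
  assumes F: "\<forall>i. \<exists>L. L-lipschitz_on UNIV (F i)"
    and \<gamma>: "integral_curve (\<lambda>y. \<tau> *\<^sub>R F i y) \<gamma>" and \<delta>: "integral_curve (\<lambda>y. (- \<tau>) *\<^sub>R F i y) \<delta>"
    and "\<gamma> 0 = \<delta> 1"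
  shows "\<gamma> 1 = \<delta> 0"
proof -
  have cont: "continuous_on UNIV (F i)"
    using F lipschitz_on_continuous_on by blast
  have r: "integral_curve (\<lambda>y. \<tau> *\<^sub>R F i y) (\<lambda>t. \<delta> (1 - t))"
    using integral_curve_reverse[OF \<delta>] by simp
  have "\<gamma> 1 = \<delta> (1 - 1)"
    using integral_curve_imp_piecewise_trajectory[where F=F and i=i and \<tau>=\<tau>, OF \<gamma> cont] integral_curve_imp_piecewise_trajectory[where F=F and i=i and \<tau>=\<tau>, OF r cont]
      \<open>\<gamma> 0 = \<delta> 1\<close>
    by (intro trajectory_unique[OF F, of "\<lambda>_. \<tau> *\<^sub>R axis i 1" "\<gamma> 0" \<gamma> "\<lambda>t. \<delta> (1 - t)" 1])
      (auto dest: piecewise_trajectory_imp_trajectory)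
  then show ?thesis by simp
qed

subsection \<open>Tangent fields\<close>

text \<open>The map \<open>r\<close> may depend on \<open>h\<close>, \<open>\<rho>\<close> and
  \<open>\<eta>\<close>, and nothing is asked of the size of its control. At \<open>h = 0\<close>
  the condition provides a reachable map that is the identity on the given ball.\<close>

definition tangent :: "('k::finite \<Rightarrow> real^'n \<Rightarrow> real^'n) \<Rightarrow> (real^'n \<Rightarrow> real^'n) \<Rightarrow> bool" where
  "tangent F X \<longleftrightarrow> (\<forall>\<rho> \<eta>. \<eta> > 0 \<longrightarrow> (\<exists>h0>0. \<forall>h. \<bar>h\<bar> \<le> h0 \<longrightarrow>
     (\<exists>r. reachable F r \<and> (\<forall>x\<in>cball 0 \<rho>. norm (r x - x - h *\<^sub>R X x) \<le> \<eta> * \<bar>h\<bar>))))"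

lemma tangentD:
  assumes "tangent F X" "\<eta> > 0"
  obtains h0 where "h0 > 0" "\<And>h. \<bar>h\<bar> \<le> h0 \<Longrightarrow>
     \<exists>r. reachable F r \<and> (\<forall>x\<in>cball 0 \<rho>. norm (r x - x - h *\<^sub>R X x) \<le> \<eta> * \<bar>h\<bar>)"
  using assms unfolding tangent_def by blast

lemma continuous_bounded_on_cball:
  fixes X :: "'a::euclidean_space \<Rightarrow> 'b::real_normed_vector"
  assumes "continuous_on UNIV X"
  obtains M where "M \<ge> 1" "\<And>x. x \<in> cball 0 \<rho> \<Longrightarrow> norm (X x) \<le> M"
proof -
  have "bounded (X ` cball 0 \<rho>)"
    using assms continuous_on_subset by (intro compact_imp_bounded compact_continuous_image) auto
  then obtain M where "\<And>x. x \<in> cball 0 \<rho> \<Longrightarrow> norm (X x) \<le> M"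
    unfolding bounded_iff by (metis imageI)
  then show ?thesis using that[of "max 1 M"] by (auto simp: le_max_iff_disj)
qed

lemma tangent_field:
  fixes F :: "'k::finite \<Rightarrow> real^'n \<Rightarrow> real^'n"
  assumes L: "\<And>x y. norm (F i x - F i y) \<le> L * norm (x - y)" and "L > 0"
  shows "tangent F (F i)"
  unfolding tangent_def
proof (intro allI impI)
  fix \<rho> \<eta> :: real assume "\<eta> > 0"
  have "continuous_on UNIV (F i)"
    by (rule lipschitz_on_continuous_on[where L=L])
      (use L \<open>L > 0\<close> in \<open>auto simp: lipschitz_on_def dist_norm\<close>)
  then obtain M where M: "M \<ge> 1" "\<And>x. x \<in> cball 0 \<rho> \<Longrightarrow> norm (F i x) \<le> M"
    using continuous_bounded_on_cball by blast
  define h0 where "h0 = min (1 / (2 * L)) (\<eta> / (2 * L * M))"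
  have "h0 > 0" using \<open>L > 0\<close> \<open>\<eta> > 0\<close> M by (simp add: h0_def)
  moreover have "\<exists>r. reachable F r \<and> (\<forall>x\<in>cball 0 \<rho>. norm (r x - x - h *\<^sub>R F i x) \<le> \<eta> * \<bar>h\<bar>)"
    if h: "\<bar>h\<bar> \<le> h0" for h
  proof -
    have hL: "\<bar>h\<bar> * L \<le> 1 / 2" and hM: "2 * L * M * \<bar>h\<bar> \<le> \<eta>"
      using h \<open>L > 0\<close> M by (auto simp: h0_def field_simps)
    obtain E where E: "reachable F E"
      "\<And>x. \<exists>\<gamma>. \<gamma> 0 = x \<and> \<gamma> 1 = E x \<and> integral_curve (\<lambda>y. h *\<^sub>R F i y) \<gamma>"
      using reachable_exponential[where F=F and i=i, OF L hL] \<open>L > 0\<close> by (metis less_imp_le)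
    have "norm (E x - x - h *\<^sub>R F i x) \<le> \<eta> * \<bar>h\<bar>" if x: "x \<in> cball 0 \<rho>" for x
    proof -
      obtain \<gamma> where \<gamma>: "\<gamma> 0 = x" "\<gamma> 1 = E x" "integral_curve (\<lambda>y. h *\<^sub>R F i y) \<gamma>" using E(2) by blast
      have "norm (E x - x - h *\<^sub>R F i x) \<le> 2 * L * h\<^sup>2 * norm (F i x)"
        using integral_curve_expansion[of h "F i" \<gamma> L] \<gamma> L hL \<open>L > 0\<close> by simp
      also have "\<dots> \<le> 2 * L * h\<^sup>2 * M" using M(2)[OF x] \<open>L > 0\<close> by (intro mult_left_mono) auto
      also have "\<dots> = (2 * L * M * \<bar>h\<bar>) * \<bar>h\<bar>"
        unfolding power2_abs[symmetric, of h] power2_eq_square by simp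
      also have "\<dots> \<le> \<eta> * \<bar>h\<bar>" by (intro mult_right_mono hM) auto
      finally show ?thesis .
    qed
    then show ?thesis using E(1) by blast
  qed
  ultimately show "\<exists>h0>0. \<forall>h. \<bar>h\<bar> \<le> h0 \<longrightarrow>
     (\<exists>r. reachable F r \<and> (\<forall>x\<in>cball 0 \<rho>. norm (r x - x - h *\<^sub>R F i x) \<le> \<eta> * \<bar>h\<bar>))" by blast
qed

lemma tangent_scaleR:
  assumes "tangent F X"
  shows "tangent F (\<lambda>x. c *\<^sub>R X x)"
  unfolding tangent_def
proof (intro allI impI)
  fix \<rho> \<eta> :: real assume "\<eta> > 0"
  \<comment> \<open>The added 1 avoids a division by zero for \<open>c = 0\<close>.\<close>
  define C where "C = \<bar>c\<bar> + 1"
  have C: "C > 0" "\<bar>c\<bar> \<le> C" by (auto simp: C_def)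
  obtain h0 where h0: "h0 > 0" "\<And>h. \<bar>h\<bar> \<le> h0 \<Longrightarrow>
     \<exists>r. reachable F r \<and> (\<forall>x\<in>cball 0 \<rho>. norm (r x - x - h *\<^sub>R X x) \<le> (\<eta> / C) * \<bar>h\<bar>)"
    using tangentD[OF assms, of "\<eta> / C" \<rho>] \<open>\<eta> > 0\<close> C by auto
  have "\<exists>r. reachable F r \<and> (\<forall>x\<in>cball 0 \<rho>. norm (r x - x - h *\<^sub>R c *\<^sub>R X x) \<le> \<eta> * \<bar>h\<bar>)"
    if h: "\<bar>h\<bar> \<le> h0 / C" for h
  proof -
    have "\<bar>h * c\<bar> \<le> C * \<bar>h\<bar>" using C by (simp add: abs_mult mult.commute mult_right_mono)
    moreover from this have "\<bar>h * c\<bar> \<le> h0" using h C(1) by (simp add: field_simps)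
    ultimately obtain r where r: "reachable F r"
      "\<And>x. x \<in> cball 0 \<rho> \<Longrightarrow> norm (r x - x - (h * c) *\<^sub>R X x) \<le> (\<eta> / C) * \<bar>h * c\<bar>"
      using h0(2) by blast
    have "(\<eta> / C) * \<bar>h * c\<bar> \<le> (\<eta> / C) * (C * \<bar>h\<bar>)"
      using \<open>\<bar>h * c\<bar> \<le> C * \<bar>h\<bar>\<close> \<open>\<eta> > 0\<close> C by (intro mult_left_mono) auto
    also have "\<dots> = \<eta> * \<bar>h\<bar>" using C by simp
    finally have "norm (r x - x - h *\<^sub>R c *\<^sub>R X x) \<le> \<eta> * \<bar>h\<bar>" if "x \<in> cball 0 \<rho>" for x
      using order_trans[OF r(2)[OF that]] by simp
    then show ?thesis using r(1) by blast
  qed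
  moreover have "h0 / C > 0" using h0 C by simp
  ultimately show "\<exists>h0>0. \<forall>h. \<bar>h\<bar> \<le> h0 \<longrightarrow>
     (\<exists>r. reachable F r \<and> (\<forall>x\<in>cball 0 \<rho>. norm (r x - x - h *\<^sub>R c *\<^sub>R X x) \<le> \<eta> * \<bar>h\<bar>))" by blast
qed

lemma tangent_add:
  assumes X: "tangent F X" "continuous_on UNIV X" and Y: "tangent F Y" "continuous_on UNIV Y"
  shows "tangent F (\<lambda>x. X x + Y x)"
  unfolding tangent_def
proof (intro allI impI)
  fix \<rho> \<eta> :: real assume "\<eta> > 0"
  then have e: "\<eta> / 3 > 0" by simp
  obtain M where M: "M \<ge> 1" "\<And>x. x \<in> cball 0 \<rho> \<Longrightarrow> norm (X x) \<le> M"
    using continuous_bounded_on_cball[OF X(2)] by blast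
  have "uniformly_continuous_on (cball 0 (\<rho> + 1)) Y"
    using Y(2) continuous_on_subset by (intro compact_uniformly_continuous) auto
  then obtain \<delta> where \<delta>: "\<delta> > 0"
    "\<And>x y. x \<in> cball 0 (\<rho> + 1) \<Longrightarrow> y \<in> cball 0 (\<rho> + 1) \<Longrightarrow> dist y x < \<delta> \<Longrightarrow> dist (Y y) (Y x) < \<eta> / 3"
    using e unfolding uniformly_continuous_on_def by metis
  obtain hx where hx: "hx > 0" "\<And>h. \<bar>h\<bar> \<le> hx \<Longrightarrow>
     \<exists>r. reachable F r \<and> (\<forall>x\<in>cball 0 \<rho>. norm (r x - x - h *\<^sub>R X x) \<le> (\<eta> / 3) * \<bar>h\<bar>)"
    using tangentD[OF X(1) e, of \<rho>] by auto
  obtain hy where hy: "hy > 0" "\<And>h. \<bar>h\<bar> \<le> hy \<Longrightarrow>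
     \<exists>r. reachable F r \<and> (\<forall>x\<in>cball 0 (\<rho> + 1). norm (r x - x - h *\<^sub>R Y x) \<le> (\<eta> / 3) * \<bar>h\<bar>)"
    using tangentD[OF Y(1) e, of "\<rho> + 1"] by auto
  \<comment> \<open>\<open>m\<close> bounds the displacement of \<open>r\<close>: at most 1, to stay
    in the enlarged ball, and below \<open>\<delta>\<close>, for the uniform continuity of
    \<open>Y\<close>.\<close>
  define m where "m = min 1 (\<delta> / 2)"
  define h0 where "h0 = min (min hx hy) (m / (M + \<eta> / 3))"
  have m: "m > 0" "m \<le> 1" "m < \<delta>" using \<delta>(1) by (auto simp: m_def)
  have pos: "M + \<eta> / 3 > 0" using M(1) e by simp
  have "h0 > 0" using hx hy m pos by (simp add: h0_def)
  moreover have "\<exists>r. reachable F r \<and> (\<forall>x\<in>cball 0 \<rho>. norm (r x - x - h *\<^sub>R (X x + Y x)) \<le> \<eta> * \<bar>h\<bar>)"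
    if h: "\<bar>h\<bar> \<le> h0" for h
  proof -
    have h': "\<bar>h\<bar> \<le> hx" "\<bar>h\<bar> \<le> hy" "\<bar>h\<bar> * (M + \<eta> / 3) \<le> m"
      using h pos by (auto simp: h0_def pos_le_divide_eq)
    obtain r where r: "reachable F r"
      "\<And>x. x \<in> cball 0 \<rho> \<Longrightarrow> norm (r x - x - h *\<^sub>R X x) \<le> (\<eta> / 3) * \<bar>h\<bar>"
      using hx(2)[OF h'(1)] by blast
    obtain s where s: "reachable F s"
      "\<And>x. x \<in> cball 0 (\<rho> + 1) \<Longrightarrow> norm (s x - x - h *\<^sub>R Y x) \<le> (\<eta> / 3) * \<bar>h\<bar>"
      using hy(2)[OF h'(2)] by blast
    have "norm (s (r x) - x - h *\<^sub>R (X x + Y x)) \<le> \<eta> * \<bar>h\<bar>" if x: "x \<in> cball 0 \<rho>" for x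
    proof -
      have "norm (r x - x) \<le> norm (r x - x - h *\<^sub>R X x) + norm (h *\<^sub>R X x)"
        by (metis diff_add_cancel norm_triangle_ineq)
      also have "\<dots> \<le> (\<eta> / 3) * \<bar>h\<bar> + \<bar>h\<bar> * M"
        using r(2)[OF x] M(2)[OF x] by (intro add_mono) (auto intro: mult_left_mono)
      also have "\<dots> \<le> m" using h'(3) by (simp add: algebra_simps)
      finally have rx: "norm (r x - x) \<le> m" .
      have "norm (r x) \<le> norm x + norm (r x - x)" by (metis norm_triangle_sub)
      then have in1: "r x \<in> cball 0 (\<rho> + 1)" using x rx m by auto
      have "dist (Y (r x)) (Y x) < \<eta> / 3"
        using x rx m in1 by (intro \<delta>(2)) (auto simp: dist_norm)
      then have "\<bar>h\<bar> * norm (Y (r x) - Y x) \<le> \<bar>h\<bar> * (\<eta> / 3)"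
        by (intro mult_left_mono) (auto simp: dist_norm)
      then have "norm (h *\<^sub>R (Y (r x) - Y x)) \<le> \<eta> / 3 * \<bar>h\<bar>" by (simp add: mult.commute)
      then have "norm ((s (r x) - r x - h *\<^sub>R Y (r x)) + (r x - x - h *\<^sub>R X x) + h *\<^sub>R (Y (r x) - Y x))
          \<le> \<eta> / 3 * \<bar>h\<bar> + \<eta> / 3 * \<bar>h\<bar> + \<eta> / 3 * \<bar>h\<bar>"
        by (intro norm_triangle_mono s(2)[OF in1] r(2)[OF x])
      moreover have "(s (r x) - r x - h *\<^sub>R Y (r x)) + (r x - x - h *\<^sub>R X x) + h *\<^sub>R (Y (r x) - Y x)
          = s (r x) - x - h *\<^sub>R (X x + Y x)" by (simp add: algebra_simps)
      moreover have "\<eta> / 3 * \<bar>h\<bar> + \<eta> / 3 * \<bar>h\<bar> + \<eta> / 3 * \<bar>h\<bar> = \<eta> * \<bar>h\<bar>" by simp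
      ultimately show ?thesis by (simp only:)
    qed
    then show ?thesis using reachable_comp[OF s(1) r(1)] by blast
  qed
  ultimately show "\<exists>h0>0. \<forall>h. \<bar>h\<bar> \<le> h0 \<longrightarrow>
     (\<exists>r. reachable F r \<and> (\<forall>x\<in>cball 0 \<rho>. norm (r x - x - h *\<^sub>R (X x + Y x)) \<le> \<eta> * \<bar>h\<bar>))" by blast
qed

lemma tangent_limit:
  assumes "\<And>\<rho> \<eta>. \<eta> > 0 \<Longrightarrow> \<exists>Y. tangent F Y \<and> (\<forall>x\<in>cball 0 \<rho>. norm (Y x - X x) \<le> \<eta>)"
  shows "tangent F X"
  unfolding tangent_def
proof (intro allI impI)
  fix \<rho> \<eta> :: real assume "\<eta> > 0"
  then have e: "\<eta> / 2 > 0" by simp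
  obtain Y where Y: "tangent F Y" "\<And>x. x \<in> cball 0 \<rho> \<Longrightarrow> norm (Y x - X x) \<le> \<eta> / 2"
    using assms[OF e] by blast
  obtain h0 where h0: "h0 > 0" "\<And>h. \<bar>h\<bar> \<le> h0 \<Longrightarrow>
     \<exists>r. reachable F r \<and> (\<forall>x\<in>cball 0 \<rho>. norm (r x - x - h *\<^sub>R Y x) \<le> (\<eta> / 2) * \<bar>h\<bar>)"
    using tangentD[OF Y(1) e, of \<rho>] by auto
  have "norm (r x - x - h *\<^sub>R X x) \<le> \<eta> * \<bar>h\<bar>"
    if x: "x \<in> cball 0 \<rho>" and r: "norm (r x - x - h *\<^sub>R Y x) \<le> (\<eta> / 2) * \<bar>h\<bar>" for r h x
  proof -
    have "norm (h *\<^sub>R (Y x - X x)) \<le> (\<eta> / 2) * \<bar>h\<bar>"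
      using mult_left_mono[OF Y(2)[OF x], of "\<bar>h\<bar>"] by (simp add: mult.commute)
    then have "norm ((r x - x - h *\<^sub>R Y x) + h *\<^sub>R (Y x - X x)) \<le> (\<eta> / 2) * \<bar>h\<bar> + (\<eta> / 2) * \<bar>h\<bar>"
      by (intro norm_triangle_mono r)
    moreover have "(r x - x - h *\<^sub>R Y x) + h *\<^sub>R (Y x - X x) = r x - x - h *\<^sub>R X x"
      by (simp add: scaleR_diff_right)
    moreover have "(\<eta> / 2) * \<bar>h\<bar> + (\<eta> / 2) * \<bar>h\<bar> = \<eta> * \<bar>h\<bar>" by simp
    ultimately show ?thesis by (simp only:)
  qed
  then show "\<exists>h0>0. \<forall>h. \<bar>h\<bar> \<le> h0 \<longrightarrow>
     (\<exists>r. reachable F r \<and> (\<forall>x\<in>cball 0 \<rho>. norm (r x - x - h *\<^sub>R X x) \<le> \<eta> * \<bar>h\<bar>))"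
    using h0 by meson
qed

lemma tangent_sum:
  assumes zero: "tangent F (\<lambda>x. 0)" and "finite B"
    and "\<And>X. X \<in> B \<Longrightarrow> tangent F X" "\<And>X. X \<in> B \<Longrightarrow> continuous_on UNIV X"
  shows "tangent F (\<lambda>x. \<Sum>X\<in>B. a X *\<^sub>R X x)"
  using \<open>finite B\<close> assms(3,4)
proof (induction B rule: finite_induct)
  case empty
  then show ?case using zero by simp
next
  case (insert X B)
  have "tangent F (\<lambda>x. a X *\<^sub>R X x + (\<Sum>X\<in>B. a X *\<^sub>R X x))"
    using insert by (intro tangent_add tangent_scaleR insert.IH continuous_intros) auto
  then show ?case using insert by simp
qed

lemma C1_derivative_bounded_on_cball:
  fixes X :: "'a::euclidean_space \<Rightarrow> 'b::real_normed_vector"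
  assumes X: "Ck_on (Suc 0) UNIV X"
  obtains M where "M \<ge> 1"
    "\<And>x v. x \<in> cball 0 \<rho> \<Longrightarrow> norm (frechet_derivative X (at x) v) \<le> M * norm v"
proof -
  have "\<exists>m\<ge>1. \<forall>x\<in>cball 0 \<rho>. norm (frechet_derivative X (at x) b) \<le> m" for b
  proof -
    have "continuous_on UNIV (\<lambda>x. frechet_derivative X (at x) b)"
      by (rule Ck_on_continuous[OF Ck_on_Suc_D(2)[OF X]])
    from continuous_bounded_on_cball[OF this] show ?thesis by metis
  qed
  then obtain m where m: "\<And>b. m b \<ge> 1"
    "\<And>b x. x \<in> cball 0 \<rho> \<Longrightarrow> norm (frechet_derivative X (at x) b) \<le> m b" by metis
  have "norm (frechet_derivative X (at x) v) \<le> (1 + (\<Sum>b\<in>Basis. m b)) * norm v" if x: "x \<in> cball 0 \<rho>" for x v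
  proof -
    have lin: "linear (frechet_derivative X (at x))"
      using Ck_on_Suc_D(1)[OF X] has_derivative_linear by blast
    have "norm (frechet_derivative X (at x) v) = norm (\<Sum>b\<in>Basis. (v \<bullet> b) *\<^sub>R frechet_derivative X (at x) b)"
      by (subst (1) euclidean_representation[symmetric, of v])
        (simp add: linear_sum[OF lin] linear_cmul[OF lin])
    also have "\<dots> \<le> (\<Sum>b\<in>Basis. norm v * m b)"
      using m(2)[OF x] by (intro sum_norm_le) (auto intro!: mult_mono Basis_le_norm)
    also have "\<dots> \<le> (1 + (\<Sum>b\<in>Basis. m b)) * norm v"
      by (simp add: sum_distrib_left[symmetric] algebra_simps)
    finally show ?thesis .
  qed
  moreover have "(1::real) \<le> 1 + (\<Sum>b\<in>Basis. m b)"
    using m(1) by (simp add: sum_nonneg order_trans[OF zero_le_one])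
  ultimately show ?thesis using that by blast
qed

text \<open>With \<open>E\<close> the flow of \<open>F i\<close> for time \<open>t\<close> and
  \<open>E'\<close> its inverse, the map \<open>E \<circ> s \<circ> E'\<close> follows the
  push-forward of \<open>X\<close>, which is \<open>X\<close> minus \<open>t\<close> times the
  bracket up to higher order in \<open>t\<close>. Following it for time \<open>k\<close> and then
  \<open>X\<close> for time \<open>- k\<close> cancels \<open>X\<close> and leaves
  \<open>- (k * t)\<close> times the bracket. Since \<open>t\<close> is fixed before
  \<open>k\<close>, every error must be bounded by a small multiple of
  \<open>t * \<bar>k\<bar>\<close>.\<close>

lemma tangent_lie_bracket:
  fixes F :: "'k::finite \<Rightarrow> real^'n \<Rightarrow> real^'n"
  assumes F: "\<forall>i. \<exists>L. L-lipschitz_on UNIV (F i)"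
    and F1: "Ck_on (Suc 0) UNIV (F i)" and X1: "Ck_on (Suc 0) UNIV X" and X: "tangent F X"
  shows "tangent F (lie_bracket (F i) X)"
  unfolding tangent_def
proof (intro allI impI)
  fix \<rho> \<eta> :: real assume "\<eta> > 0"
  \<comment> \<open>All points met below stay within distance 3 of the starting point, so constants
    taken on this ball serve throughout.\<close>
  define R where "R = \<rho> + 3"
  define f where "f = F i"
  obtain L0 where L0: "L0 > 0" "\<And>i x y. norm (F i x - F i y) \<le> L0 * norm (x - y)"
    using lipschitz_family_bound[OF F] by metis
  obtain Mf where Mf: "Mf \<ge> 1" "\<And>x. x \<in> cball 0 R \<Longrightarrow> norm (f x) \<le> Mf"
    using continuous_bounded_on_cball[OF Ck_on_continuous[OF F1]] f_def by metis
  obtain MX where MX: "MX \<ge> 1" "\<And>x. x \<in> cball 0 R \<Longrightarrow> norm (X x) \<le> MX"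
    using continuous_bounded_on_cball[OF Ck_on_continuous[OF X1]] by metis
  obtain Df where Df: "Df \<ge> 1" "\<And>x v. x \<in> cball 0 R \<Longrightarrow> norm (frechet_derivative f (at x) v) \<le> Df * norm v"
    using C1_derivative_bounded_on_cball[OF F1] f_def by metis
  obtain DX where DX: "DX \<ge> 1" "\<And>x v. x \<in> cball 0 R \<Longrightarrow> norm (frechet_derivative X (at x) v) \<le> DX * norm v"
    using C1_derivative_bounded_on_cball[OF X1] by metis
  define M where "M = L0 + Mf + MX + Df + DX"
  have M1: "M \<ge> 1" and Mge: "L0 \<le> M" "Mf \<le> M" "MX \<le> M" "Df \<le> M" "DX \<le> M"
    using L0 Mf MX Df DX by (auto simp: M_def)
  have bf: "norm (f x) \<le> M" and bX: "norm (X x) \<le> M" if "x \<in> cball 0 R" for x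
    using Mf(2)[OF that] MX(2)[OF that] Mge by linarith+
  have bDf: "norm (frechet_derivative f (at x) v) \<le> M * norm v"
    and bDX: "norm (frechet_derivative X (at x) v) \<le> M * norm v" if "x \<in> cball 0 R" for x v
    using Df(2)[OF that, of v] DX(2)[OF that, of v] Mge mult_right_mono[OF _ norm_ge_zero[of v]] order_trans by meson+
  have lip: "norm (f x - f y) \<le> M * norm (x - y)" for x y
    using L0(2)[of i x y] mult_right_mono[OF Mge(1) norm_ge_zero[of "x - y"]] unfolding f_def by linarith
  \<comment> \<open>Six errors are added at the end; in units of
    \<open>\<theta> * t * \<bar>k\<bar>\<close> they are 1, 1, \<open>8 * M\<close>, 1,
    \<open>3 * M\<close> and 2.\<close>
  define \<theta> where "\<theta> = min 1 (\<eta> / (5 + 11 * M))"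
  have "\<theta> \<le> \<eta> / (5 + 11 * M)" by (simp add: \<theta>_def)
  then have "\<theta> * (5 + 11 * M) \<le> \<eta>"
    using M1 by (simp add: pos_le_divide_eq)
  moreover have "\<theta> > 0" "\<theta> \<le> 1"
    using \<open>\<eta> > 0\<close> M1 by (simp_all add: \<theta>_def)
  ultimately have \<theta>: "\<theta> > 0" "\<theta> \<le> 1" "\<theta> * (5 + 11 * M) \<le> \<eta>" by simp_all
  obtain \<delta>f where \<delta>f: "\<delta>f > 0"
    "\<And>a b c. a \<in> cball 0 R \<Longrightarrow> b \<in> cball 0 R \<Longrightarrow> c \<in> cball 0 R \<Longrightarrow> dist a c < \<delta>f \<Longrightarrow> dist b c < \<delta>f \<Longrightarrow>
       norm (f a - f b - frechet_derivative f (at c) (a - b)) \<le> \<theta> * norm (a - b)"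
    using C1_uniformly_strictly_differentiable[OF F1 \<theta>(1), of R] unfolding f_def by auto
  obtain \<delta>X where \<delta>X: "\<delta>X > 0"
    "\<And>a b c. a \<in> cball 0 R \<Longrightarrow> b \<in> cball 0 R \<Longrightarrow> c \<in> cball 0 R \<Longrightarrow> dist a c < \<delta>X \<Longrightarrow> dist b c < \<delta>X \<Longrightarrow>
       norm (X a - X b - frechet_derivative X (at c) (a - b)) \<le> \<theta> * norm (a - b)"
    using C1_uniformly_strictly_differentiable[OF X1 \<theta>(1), of R] by auto
  define \<delta> where "\<delta> = min \<delta>f \<delta>X"
  have \<delta>: "\<delta> > 0" "\<delta> \<le> \<delta>f" "\<delta> \<le> \<delta>X" using \<delta>f \<delta>X by (auto simp: \<delta>_def)
  \<comment> \<open>The first entry keeps the curves of \<open>F i\<close> within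
    \<open>\<delta> / 4\<close> of the starting point. The cube in the second serves
    \<open>e6\<close>, where an error \<open>4 * (t * M * M) * \<bar>k\<bar>\<close> in
    \<open>w\<close> is multiplied by \<open>t * M\<close>.\<close>
  define t where "t = min (\<delta> / (16 * M)) (\<theta> / (4 * M ^ 3))"
  have "M > 0" using M1 by simp
  have t0: "t > 0" using \<delta> \<theta> M1 by (simp add: t_def)
  have t\<delta>: "16 * (t * M) \<le> \<delta>"
    using \<open>M > 0\<close> by (auto simp: t_def min_def field_simps)
  have "4 * (t * M ^ 3) \<le> \<theta>"
  proof -
    have "t \<le> \<theta> / (4 * M ^ 3)" by (simp add: t_def)
    then show ?thesis using \<open>M > 0\<close> by (simp add: pos_le_divide_eq mult_ac)
  qed
  then have tM3: "4 * (t * M * M * M) \<le> \<theta>" by (simp add: power3_eq_cube mult.assoc)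
  have drop: "4 * z \<le> \<theta>" if "4 * (z * M) \<le> \<theta>" "z \<ge> 0" for z
    using mult_left_mono[OF M1 that(2)] that(1) by simp
  have tM2: "4 * (t * M * M) \<le> \<theta>" by (rule drop[OF tM3]) (use t0 M1 in auto)
  have tM: "4 * (t * M) \<le> \<theta>" by (rule drop[OF tM2]) (use t0 M1 in auto)
  have t1: "4 * t \<le> \<theta>" by (rule drop[OF tM]) (use t0 in auto)
  have tpos: "0 \<le> t * M" "0 \<le> t * M * M" "0 \<le> t * M * M * M" using t0 M1 by auto
  have th: "\<bar>t\<bar> * M \<le> 1 / 2" "\<bar>- t\<bar> * M \<le> 1 / 2" using tM \<theta> t0 by auto
  obtain E where E: "reachable F E" "\<And>x. \<exists>\<gamma>. \<gamma> 0 = x \<and> \<gamma> 1 = E x \<and> integral_curve (\<lambda>y. t *\<^sub>R f y) \<gamma>"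
    using reachable_exponential[where F=F and i=i, OF lip[unfolded f_def] th(1)] M1 unfolding f_def by auto
  obtain E' where E': "reachable F E'" "\<And>x. \<exists>\<gamma>. \<gamma> 0 = x \<and> \<gamma> 1 = E' x \<and> integral_curve (\<lambda>y. (- t) *\<^sub>R f y) \<gamma>"
    using reachable_exponential[where F=F and i=i, OF lip[unfolded f_def] th(2)] M1 unfolding f_def by auto
  \<comment> \<open>The tolerance contains the factor \<open>t\<close> because the net motion is
    smaller than \<open>\<bar>k\<bar>\<close> by that factor.\<close>
  obtain h1 where h1: "h1 > 0" "\<And>h. \<bar>h\<bar> \<le> h1 \<Longrightarrow>
     \<exists>r. reachable F r \<and> (\<forall>x\<in>cball 0 R. norm (r x - x - h *\<^sub>R X x) \<le> (\<theta> * t) * \<bar>h\<bar>)"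
    using tangentD[OF X, of "\<theta> * t" R] \<theta> t0 by auto
  \<comment> \<open>Chosen after \<open>t\<close>: the last entry makes the second-order effect of
    \<open>X\<close> along itself negligible against \<open>\<theta> * t\<close>.\<close>
  define k0 where "k0 = min (min h1 (\<delta> / (16 * M))) (min (1 / (4 * M)) (\<theta> * t / (8 * M * M)))"
  have k0: "k0 > 0" "k0 \<le> h1" "16 * M * k0 \<le> \<delta>" "4 * M * k0 \<le> 1" "8 * M * M * k0 \<le> \<theta> * t"
  proof -
    show "k0 > 0" "k0 \<le> h1" using h1 \<delta> \<theta> t0 M1 by (auto simp: k0_def)
    have "k0 \<le> \<delta> / (16 * M)" "k0 \<le> 1 / (4 * M)" "k0 \<le> \<theta> * t / (8 * M * M)"
      by (auto simp: k0_def)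
    then show "16 * M * k0 \<le> \<delta>" "4 * M * k0 \<le> 1" "8 * M * M * k0 \<le> \<theta> * t"
      using \<open>M > 0\<close> by (simp_all add: pos_le_divide_eq mult_ac)
  qed
  have "\<exists>r. reachable F r \<and> (\<forall>x\<in>cball 0 \<rho>. norm (r x - x - h *\<^sub>R lie_bracket (F i) X x) \<le> \<eta> * \<bar>h\<bar>)"
    if h: "\<bar>h\<bar> \<le> t * k0" for h
  proof -
    \<comment> \<open>The minus sign comes from the push-forward, which contains the bracket
      negatively.\<close>
    define k where "k = - h / t"
    have hk: "h = - (k * t)" "\<bar>h\<bar> = t * \<bar>k\<bar>" using t0 by (auto simp: k_def abs_mult)
    have k: "\<bar>k\<bar> \<le> k0" using h t0 unfolding hk(2) by simp
    then have kh: "\<bar>k\<bar> \<le> h1" "\<bar>- k\<bar> \<le> h1" using k0(2) by auto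
    have kmono: "b * \<bar>k\<bar> \<le> d" if "b * k0 \<le> d" "b \<ge> 0" for b d
      using mult_left_mono[OF k that(2)] that(1) by (rule order_trans)
    have k\<delta>: "16 * M * \<bar>k\<bar> \<le> \<delta>" by (rule kmono[OF k0(3)]) (use M1 in auto)
    have kM: "4 * M * \<bar>k\<bar> \<le> 1" by (rule kmono[OF k0(4)]) (use M1 in auto)
    have kt: "8 * M * M * \<bar>k\<bar> \<le> \<theta> * t" by (rule kmono[OF k0(5)]) (use M1 in auto)
    obtain s where s: "reachable F s" "\<And>x. x \<in> cball 0 R \<Longrightarrow> norm (s x - x - k *\<^sub>R X x) \<le> (\<theta> * t) * \<bar>k\<bar>"
      using h1(2)[OF kh(1)] by blast
    obtain s' where s': "reachable F s'" "\<And>x. x \<in> cball 0 R \<Longrightarrow> norm (s' x - x - (- k) *\<^sub>R X x) \<le> (\<theta> * t) * \<bar>k\<bar>"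
      using h1(2)[OF kh(2)] by auto
    have "norm (s' (E (s (E' x))) - x - h *\<^sub>R lie_bracket (F i) X x) \<le> \<eta> * \<bar>h\<bar>"
      if x: "x \<in> cball 0 \<rho>" for x
    proof -
      let ?A = "frechet_derivative f (at x)" and ?B = "frechet_derivative X (at x)"
      have linA: "linear ?A" and linB: "linear ?B"
        using Ck_on_Suc_D(1)[OF F1] Ck_on_Suc_D(1)[OF X1] has_derivative_linear unfolding f_def by blast+
      have nearR: "z \<in> cball 0 R" if "norm (z - x) \<le> 3" for z
        using x that norm_triangle_sub[of z x] by (simp add: R_def)
      have xR: "x \<in> cball 0 R" using nearR[of x] by simp
      define p where "p = E' x"
      define q where "q = s p"
      define y where "y = E q"
      define w where "w = q - p"
      obtain \<gamma>' where \<gamma>': "\<gamma>' 0 = x" "\<gamma>' 1 = p" "integral_curve (\<lambda>y. (- t) *\<^sub>R f y) \<gamma>'"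
        using E'(2) unfolding p_def by blast
      obtain c where c: "c 0 = p" "c 1 = E p" "integral_curve (\<lambda>y. t *\<^sub>R f y) c"
        using E(2) by blast
      obtain \<gamma> where \<gamma>: "\<gamma> 0 = q" "\<gamma> 1 = y" "integral_curve (\<lambda>y. t *\<^sub>R f y) \<gamma>"
        using E(2) unfolding y_def by blast
      \<comment> \<open>Following \<open>F i\<close> forward from \<open>p\<close> leads back to
        \<open>x\<close>. Thus \<open>c\<close> is the reference curve with which the curve from the
        displaced point \<open>q\<close> is compared.\<close>
      have "c 1 = \<gamma>' 0"
        by (rule integral_curve_there_and_back[OF F c(3)[unfolded f_def] \<gamma>'(3)[unfolded f_def]]) (simp add: c \<gamma>')
      then have c1: "c 1 = x" using \<gamma>' by simp
      have tbf: "2 * \<bar>t\<bar> * norm (f z) \<le> 2 * (t * M)" if "z \<in> cball 0 R" for z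
        using mult_left_mono[OF bf[OF that], of "2 * t"] t0 by simp
      have px: "norm (p - x) \<le> 2 * (t * M)"
        using integral_curve_displacement[OF \<gamma>'(3) lip th(2), of 1] \<gamma>' tbf[OF xR] by simp
      have pR: "p \<in> cball 0 R" using px tM \<theta> tpos by (intro nearR) linarith
      have pexp: "norm (p - x + t *\<^sub>R f x) \<le> \<theta> * t"
      proof -
        have "norm (p - x + t *\<^sub>R f x) \<le> 2 * M * t\<^sup>2 * norm (f x)"
          using integral_curve_expansion[OF \<gamma>'(3) lip th(2)] \<gamma>' M1 by simp
        also have "\<dots> \<le> 2 * M * t\<^sup>2 * M" using bf[OF xR] M1 by (intro mult_left_mono) auto
        also have "\<dots> = 2 * (t * M * M) * t" by (simp add: power2_eq_square)
        also have "\<dots> \<le> \<theta> * t" using tM2 tpos t0 by (intro mult_right_mono) linarith+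
        finally show ?thesis .
      qed
      have e1: "norm (w - k *\<^sub>R X p) \<le> \<theta> * t * \<bar>k\<bar>"
        using s(2)[OF pR] by (simp add: w_def q_def)
      have wk: "norm w \<le> 2 * M * \<bar>k\<bar>"
      proof -
        have "norm w \<le> norm (w - k *\<^sub>R X p) + norm (k *\<^sub>R X p)"
          by (metis diff_add_cancel norm_triangle_ineq)
        also have "\<dots> \<le> \<theta> * t * \<bar>k\<bar> + \<bar>k\<bar> * M"
          using e1 bX[OF pR] by (intro add_mono) (auto intro: mult_left_mono)
        also have "\<theta> * t * \<bar>k\<bar> \<le> M * \<bar>k\<bar>"
        proof -
          have "\<theta> * t \<le> 1 * 1" using \<theta> t1 t0 by (intro mult_mono) auto
          then show ?thesis using M1 by (intro mult_right_mono) auto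
        qed
        finally show ?thesis by simp
      qed
      have cx: "norm (c v - x) \<le> 4 * (t * M)" if v: "v \<in> {0..1}" for v
      proof -
        have "norm (c v - p) \<le> 2 * (t * M)"
          using integral_curve_displacement[OF c(3) lip th(1) v] c(1) tbf[OF pR] by simp
        then have "norm ((c v - p) + (p - x)) \<le> 2 * (t * M) + 2 * (t * M)"
          by (intro norm_triangle_mono px)
        then show ?thesis by (simp add: mult.commute)
      qed
      have gc: "norm (\<gamma> v - c v) \<le> 4 * M * \<bar>k\<bar>" if v: "v \<in> {0..1}" for v
        using integral_curve_separation[OF \<gamma>(3) c(3) lip th(1) v] wk by (simp add: \<gamma> c w_def)
      have gx: "norm (\<gamma> v - x) \<le> 4 * M * \<bar>k\<bar> + 4 * (t * M)" if v: "v \<in> {0..1}" for v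
      proof -
        have "norm ((\<gamma> v - c v) + (c v - x)) \<le> 4 * M * \<bar>k\<bar> + 4 * (t * M)"
          by (intro norm_triangle_mono gc cx v)
        then show ?thesis by simp
      qed
      \<comment> \<open>Here the derivative of \<open>F i\<close> enters: transporting
        \<open>w\<close> from \<open>p\<close> to \<open>x\<close> multiplies it by the identity
        plus \<open>t\<close> times \<open>?A\<close>.\<close>
      have e2: "norm (y - x - w - t *\<^sub>R ?A w) \<le> 8 * M * (\<theta> * t * \<bar>k\<bar>)"
      proof -
        have "norm (\<gamma> 1 - c 1 - (\<gamma> 0 - c 0) - t *\<^sub>R ?A (\<gamma> 0 - c 0)) \<le> 4 * \<theta> * \<bar>t\<bar> * norm (\<gamma> 0 - c 0)"
        proof (rule integral_curve_difference_expansion[OF \<gamma>(3) c(3) lip th(1) linA bDf[OF xR]])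
          show "\<bar>t\<bar> * M * M \<le> \<theta>" using tM2 tpos t0 by simp
          show "norm (f (\<gamma> v) - f (c v) - ?A (\<gamma> v - c v)) \<le> \<theta> * norm (\<gamma> v - c v)" if v: "v \<in> {0..1}" for v
            using gx[OF v] cx[OF v] kM k\<delta> t\<delta> tM \<theta> \<delta>
            by (intro \<delta>f(2) nearR) (auto simp: dist_norm)
        qed (use M1 in auto)
        also have "\<dots> \<le> 4 * \<theta> * \<bar>t\<bar> * (2 * M * \<bar>k\<bar>)"
          using wk \<theta>(1) by (intro mult_left_mono) (auto simp: \<gamma> c w_def)
        finally show ?thesis using t0 by (simp add: \<gamma> c1 c w_def mult_ac)
      qed
      have yx: "norm (y - x) \<le> 4 * M * \<bar>k\<bar>"
        using gc[of 1] by (simp add: \<gamma> c1)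
      have yR: "y \<in> cball 0 R" using yx kM by (intro nearR) auto
      have e3: "norm (s' y - y + k *\<^sub>R X y) \<le> \<theta> * t * \<bar>k\<bar>"
        using s'(2)[OF yR] by simp
      have Xdiff: "norm (X z - X x) \<le> 2 * M * norm (z - x)" and
        Xexp: "norm (X z - X x - ?B (z - x)) \<le> \<theta> * norm (z - x)"
        if "z \<in> cball 0 R" "norm (z - x) < \<delta>" for z
      proof -
        show *: "norm (X z - X x - ?B (z - x)) \<le> \<theta> * norm (z - x)"
          using that \<delta> xR by (intro \<delta>X(2)) (auto simp: dist_norm)
        have "norm ((X z - X x - ?B (z - x)) + ?B (z - x)) \<le> \<theta> * norm (z - x) + M * norm (z - x)"
          by (intro norm_triangle_mono * bDX xR)
        moreover have "\<theta> * norm (z - x) \<le> M * norm (z - x)"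
          using \<theta> M1 by (intro mult_right_mono) auto
        ultimately show "norm (X z - X x) \<le> 2 * M * norm (z - x)" by simp
      qed
      have "norm (y - x) < \<delta>" using yx k\<delta> \<delta>(1) by linarith
      have e4: "norm (k *\<^sub>R (X y - X x)) \<le> \<theta> * t * \<bar>k\<bar>"
      proof -
        have "norm (X y - X x) \<le> 2 * M * norm (y - x)" by (rule Xdiff) fact+
        also have "\<dots> \<le> 2 * M * (4 * M * \<bar>k\<bar>)" using yx M1 by (intro mult_left_mono) auto
        also have "\<dots> \<le> \<theta> * t" using kt by simp
        finally have "\<bar>k\<bar> * norm (X y - X x) \<le> \<bar>k\<bar> * (\<theta> * t)" by (intro mult_left_mono) auto
        then show ?thesis by (simp add: mult_ac)
      qed
      have "norm (p - x) < \<delta>" using px t\<delta> \<delta>(1) tpos by linarith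
      \<comment> \<open>Here the derivative of \<open>X\<close> enters, because \<open>X\<close>
        acts at \<open>p\<close>, which is \<open>x - t *\<^sub>R f x\<close> to first
        order.\<close>
      have e5: "norm (k *\<^sub>R (X p - X x + t *\<^sub>R ?B (f x))) \<le> 3 * M * (\<theta> * t * \<bar>k\<bar>)"
      proof -
        have "norm (X p - X x - ?B (p - x)) \<le> \<theta> * norm (p - x)" by (rule Xexp) fact+
        also have "\<dots> \<le> \<theta> * (2 * (t * M))" using px \<theta> by (intro mult_left_mono) auto
        finally have a: "norm (X p - X x - ?B (p - x)) \<le> \<theta> * (2 * (t * M))" .
        have "norm (?B (p - x + t *\<^sub>R f x)) \<le> M * norm (p - x + t *\<^sub>R f x)" by (rule bDX[OF xR])
        also have "\<dots> \<le> M * (\<theta> * t)" using pexp M1 by (intro mult_left_mono) auto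
        finally have "norm ((X p - X x - ?B (p - x)) + ?B (p - x + t *\<^sub>R f x)) \<le> \<theta> * (2 * (t * M)) + M * (\<theta> * t)"
          by (intro norm_triangle_mono a)
        moreover have "(X p - X x - ?B (p - x)) + ?B (p - x + t *\<^sub>R f x) = X p - X x + t *\<^sub>R ?B (f x)"
          by (simp add: linear_add[OF linB] linear_cmul[OF linB])
        ultimately have "norm (X p - X x + t *\<^sub>R ?B (f x)) \<le> 3 * M * (\<theta> * t)" by (simp add: algebra_simps)
        then have "\<bar>k\<bar> * norm (X p - X x + t *\<^sub>R ?B (f x)) \<le> \<bar>k\<bar> * (3 * M * (\<theta> * t))"
          by (intro mult_left_mono) auto
        then show ?thesis by (simp add: mult_ac)
      qed
      have e6: "norm (t *\<^sub>R ?A (w - k *\<^sub>R X x)) \<le> 2 * (\<theta> * t * \<bar>k\<bar>)"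
      proof -
        have "norm (X p - X x) \<le> 2 * M * norm (p - x)" by (rule Xdiff) fact+
        also have "\<dots> \<le> 2 * M * (2 * (t * M))" using px M1 by (intro mult_left_mono) auto
        finally have "\<bar>k\<bar> * norm (X p - X x) \<le> \<bar>k\<bar> * (2 * M * (2 * (t * M)))" by (intro mult_left_mono) auto
        then have "norm (k *\<^sub>R (X p - X x)) \<le> 4 * (t * M * M) * \<bar>k\<bar>" by (simp add: mult_ac)
        then have "norm ((w - k *\<^sub>R X p) + k *\<^sub>R (X p - X x)) \<le> \<theta> * t * \<bar>k\<bar> + 4 * (t * M * M) * \<bar>k\<bar>"
          by (intro norm_triangle_mono e1)
        moreover have "(w - k *\<^sub>R X p) + k *\<^sub>R (X p - X x) = w - k *\<^sub>R X x" by (simp add: scaleR_diff_right)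
        ultimately have "norm (w - k *\<^sub>R X x) \<le> \<theta> * t * \<bar>k\<bar> + 4 * (t * M * M) * \<bar>k\<bar>" by (simp only:)
        then have "t * (M * norm (w - k *\<^sub>R X x)) \<le> t * (M * (\<theta> * t * \<bar>k\<bar> + 4 * (t * M * M) * \<bar>k\<bar>))"
          using t0 M1 by (intro mult_left_mono) auto
        also have "\<dots> = (t * M) * (\<theta> * t * \<bar>k\<bar>) + 4 * (t * M * M * M) * (t * \<bar>k\<bar>)"
          by (simp add: algebra_simps)
        also have "\<dots> \<le> 1 * (\<theta> * t * \<bar>k\<bar>) + \<theta> * (t * \<bar>k\<bar>)"
          using tM tM3 tpos \<theta> t0
          by (intro add_mono mult_right_mono mult_nonneg_nonneg) (linarith | simp)+
        finally have "t * (M * norm (w - k *\<^sub>R X x)) \<le> 2 * (\<theta> * t * \<bar>k\<bar>)" by simp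
        moreover have "norm (t *\<^sub>R ?A (w - k *\<^sub>R X x)) \<le> t * (M * norm (w - k *\<^sub>R X x))"
          using bDf[OF xR, of "w - k *\<^sub>R X x"] t0 by simp
        ultimately show ?thesis by linarith
      qed
      \<comment> \<open>An exact telescoping identity: the first-order terms in \<open>k\<close>
        cancel, and the six summands are those estimated above.\<close>
      have "s' y - x - h *\<^sub>R lie_bracket (F i) X x =
          (s' y - y + k *\<^sub>R X y) + (- (k *\<^sub>R (X y - X x))) + (y - x - w - t *\<^sub>R ?A w) + (w - k *\<^sub>R X p)
          + k *\<^sub>R (X p - X x + t *\<^sub>R ?B (f x)) + t *\<^sub>R ?A (w - k *\<^sub>R X x)"
        by (simp add: lie_bracket_def hk(1) f_def[symmetric] linear_diff[OF linA] linear_cmul[OF linA] algebra_simps)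
      also have "norm \<dots> \<le> \<theta> * t * \<bar>k\<bar> + \<theta> * t * \<bar>k\<bar> + 8 * M * (\<theta> * t * \<bar>k\<bar>) + \<theta> * t * \<bar>k\<bar>
          + 3 * M * (\<theta> * t * \<bar>k\<bar>) + 2 * (\<theta> * t * \<bar>k\<bar>)"
        using e4 by (intro norm_triangle_mono e1 e2 e3 e5 e6) simp
      also have "\<dots> = (\<theta> * (5 + 11 * M)) * \<bar>h\<bar>" unfolding hk(2) by (simp add: algebra_simps)
      also have "\<dots> \<le> \<eta> * \<bar>h\<bar>" by (intro mult_right_mono \<theta>) auto
      finally show ?thesis by (simp add: y_def q_def p_def)
    qed
    moreover have "reachable F (\<lambda>x. s' (E (s (E' x))))"
      using reachable_comp[OF s'(1) reachable_comp[OF E(1) reachable_comp[OF s(1) E'(1)]]] .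
    ultimately show ?thesis by blast
  qed
  moreover have "t * k0 > 0" using t0 k0 by simp
  ultimately show "\<exists>h0>0. \<forall>h. \<bar>h\<bar> \<le> h0 \<longrightarrow>
     (\<exists>r. reachable F r \<and> (\<forall>x\<in>cball 0 \<rho>. norm (r x - x - h *\<^sub>R lie_bracket (F i) X x) \<le> \<eta> * \<bar>h\<bar>))" by blast
qed

section \<open>From the control fields to the Lie algebra and to all continuous fields\<close>

lemma tangent_iterated_brackets:
  fixes F :: "'k::finite \<Rightarrow> real^'n \<Rightarrow> real^'n"
  assumes F: "\<forall>i. \<exists>L. L-lipschitz_on UNIV (F i)" and smooth: "\<forall>i. smooth_on UNIV (F i)"
    and "X \<in> iterated_brackets F"
  shows "tangent F X"
  using assms(3)
proof induction
  case (base i)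
  then show ?case
    using lipschitz_family_bound[OF F] tangent_field[where F=F and i=i] by metis
next
  case (step X i)
  show ?case
  proof (rule tangent_lie_bracket[OF F _ _ step.IH])
    show "Ck_on (Suc 0) UNIV (F i)"
      using smooth by (intro smooth_on_imp_Ck_on) blast
    show "Ck_on (Suc 0) UNIV X"
      using smooth by (intro smooth_on_imp_Ck_on smooth_on_iterated_brackets[OF _ step.hyps]) blast
  qed
qed

lemma tangent_Lie:
  fixes F :: "'k::finite \<Rightarrow> real^'n \<Rightarrow> real^'n"
  assumes F: "\<forall>i. \<exists>L. L-lipschitz_on UNIV (F i)" and smooth: "\<forall>i. smooth_on UNIV (F i)"
    and "X \<in> Lie F"
  shows "tangent F X"
proof -
  obtain B a where B: "finite B" "B \<subseteq> iterated_brackets F" "X = (\<lambda>x. \<Sum>X\<in>B. a X *\<^sub>R X x)"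
    using assms(3) unfolding Lie_def by blast
  have "tangent F (\<lambda>x. 0)"
    using tangent_scaleR[OF tangent_iterated_brackets[OF F smooth iterated_brackets.base], of 0] by simp
  then show ?thesis
    unfolding B(3)
  proof (rule tangent_sum[OF _ B(1)])
    fix Y assume "Y \<in> B"
    then have Y: "Y \<in> iterated_brackets F" using B(2) by blast
    show "tangent F Y" by (rule tangent_iterated_brackets[OF F smooth Y])
    show "continuous_on UNIV Y"
      using smooth_on_imp_Ck_on[OF smooth_on_iterated_brackets[OF _ Y], of 0] smooth by auto
  qed
qed

lemma tangent_continuous:
  fixes F :: "'k::finite \<Rightarrow> real^'n \<Rightarrow> real^'n"
  assumes F: "\<forall>i. \<exists>L. L-lipschitz_on UNIV (F i)" and smooth: "\<forall>i. smooth_on UNIV (F i)"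
    and lie: "lie_strong_approximating F" and V: "continuous_on UNIV V"
  shows "tangent F V"
proof (rule tangent_limit)
  fix \<rho> \<eta> :: real assume "\<eta> > 0"
  then have e: "\<eta> / 2 > 0" by simp
  obtain g where g: "polynomial_function g" "\<And>x. x \<in> cball 0 \<rho> \<Longrightarrow> norm (V x - g x) < \<eta> / 2"
    using Stone_Weierstrass_polynomial_function[OF compact_cball continuous_on_subset[OF V] e, of 0 \<rho>] by auto
  \<comment> \<open>The order \<open>m\<close> is not known in advance; a polynomial field is
    admissible whatever it is.\<close>
  obtain m where m: "\<And>Y K. Ck_on m UNIV Y \<Longrightarrow> compact K \<Longrightarrow>
        \<exists>\<delta>>0. (INF X\<in>Lie_bounded \<delta> K F. SUP x\<in>K. ennreal (norm (X x - Y x))) = 0"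
    using lie unfolding lie_strong_approximating_def by blast
  obtain \<delta> where "(INF X\<in>Lie_bounded \<delta> (cball 0 \<rho>) F. SUP x\<in>cball 0 \<rho>. ennreal (norm (X x - g x))) = 0"
    using m[OF Ck_on_polynomial_function[OF g(1)] compact_cball] by blast
  then have "(INF X\<in>Lie_bounded \<delta> (cball 0 \<rho>) F. SUP x\<in>cball 0 \<rho>. ennreal (norm (X x - g x))) < ennreal (\<eta> / 2)"
    using e by simp
  then obtain X where X: "X \<in> Lie_bounded \<delta> (cball 0 \<rho>) F"
    "(SUP x\<in>cball 0 \<rho>. ennreal (norm (X x - g x))) < ennreal (\<eta> / 2)"
    unfolding INF_less_iff by blast
  have "norm (X x - V x) \<le> \<eta>" if x: "x \<in> cball 0 \<rho>" for x
  proof -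
    have "ennreal (norm (X x - g x)) \<le> (SUP x\<in>cball 0 \<rho>. ennreal (norm (X x - g x)))"
      using x by (rule SUP_upper)
    then have "ennreal (norm (X x - g x)) < ennreal (\<eta> / 2)" using X(2) by (rule le_less_trans)
    then have "norm (X x - g x) < \<eta> / 2" by (simp add: ennreal_less_iff)
    then have "norm ((X x - g x) - (V x - g x)) \<le> \<eta> / 2 + \<eta> / 2"
      using g(2)[OF x] norm_triangle_ineq4[of "X x - g x" "V x - g x"] by linarith
    then show ?thesis by simp
  qed
  moreover have "tangent F X"
    using X(1) tangent_Lie[OF F smooth] unfolding Lie_bounded_def by blast
  ultimately show "\<exists>Y. tangent F Y \<and> (\<forall>x\<in>cball 0 \<rho>. norm (Y x - V x) \<le> \<eta>)" by blast
qed

subsection \<open>Approximation of monotone maps by reachable maps\<close>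

text \<open>McShane's formula: the infimum over \<open>S\<close> of the cones
  \<open>f y + L * dist x y\<close> keeps the constant \<open>L\<close>.\<close>

lemma lipschitz_extension_real:
  fixes f :: "'a::metric_space \<Rightarrow> real"
  assumes f: "L-lipschitz_on S f"
  obtains g where "L-lipschitz_on UNIV g" "\<And>x. x \<in> S \<Longrightarrow> g x = f x"
proof (cases "S = {}")
  case True
  have "L-lipschitz_on UNIV (\<lambda>x::'a. 0::real)"
    using lipschitz_on_nonneg[OF f] by (simp add: lipschitz_on_def)
  then show ?thesis using that True by blast
next
  case False
  have "L \<ge> 0" using lipschitz_on_nonneg[OF f] .
  define g where "g x = (INF y\<in>S. f y + L * dist x y)" for x
  have lower: "f z - L * dist x z \<le> f y + L * dist x y" if "z \<in> S" "y \<in> S" for x y z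
  proof -
    have "f z - f y \<le> L * dist z y"
      using lipschitz_onD[OF f that] by (simp add: dist_real_def)
    also have "\<dots> \<le> L * (dist x z + dist x y)"
      using \<open>L \<ge> 0\<close> by (intro mult_left_mono) (metis dist_commute dist_triangle)
    finally show ?thesis by (simp add: algebra_simps)
  qed
  have bdd: "bdd_below ((\<lambda>y. f y + L * dist x y) ` S)" for x
  proof -
    obtain z where "z \<in> S" using False by blast
    then show ?thesis using lower by (intro bdd_belowI2[where m="f z - L * dist x z"])
  qed
  have "g x \<le> g x' + L * dist x x'" for x x'
  proof -
    have "g x - L * dist x x' \<le> f y + L * dist x' y" if y: "y \<in> S" for y
    proof -
      have "g x \<le> f y + L * dist x y" unfolding g_def by (rule cINF_lower[OF bdd y])
      also have "L * dist x y \<le> L * (dist x x' + dist x' y)"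
        using \<open>L \<ge> 0\<close> by (intro mult_left_mono dist_triangle)
      finally show ?thesis by (simp add: algebra_simps)
    qed
    then have "g x - L * dist x x' \<le> g x'" unfolding g_def[of x'] by (intro cINF_greatest False)
    then show ?thesis by simp
  qed
  then have "\<bar>g x - g x'\<bar> \<le> L * dist x x'" for x x'
    by (smt (verit) dist_commute)
  then have "L-lipschitz_on UNIV g"
    using \<open>L \<ge> 0\<close> by (simp add: lipschitz_on_def dist_real_def)
  moreover have "g x = f x" if x: "x \<in> S" for x
  proof (rule antisym)
    show "g x \<le> f x" unfolding g_def using cINF_lower[OF bdd[of x] x] by simp
    show "f x \<le> g x" unfolding g_def using lower[OF x, of _ x] by (intro cINF_greatest False) simp
  qed
  ultimately show ?thesis using that by blast
qed

text \<open>Each coordinate is extended separately. Bounding the norm by the sum of the coordinates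
  costs the factor \<open>CARD('n)\<close>, harmless because only the existence of some constant
  matters.\<close>

lemma lipschitz_extension:
  fixes f :: "'a::metric_space \<Rightarrow> real^'n"
  assumes f: "L-lipschitz_on S f"
  obtains g where "(real CARD('n) * L)-lipschitz_on UNIV g" "\<And>x. x \<in> S \<Longrightarrow> g x = f x"
proof -
  have L: "L \<ge> 0" using lipschitz_on_nonneg[OF f] .
  have "\<exists>g. L-lipschitz_on UNIV g \<and> (\<forall>x\<in>S. g x = f x $ i)" for i
  proof -
    have "L-lipschitz_on S (\<lambda>x. f x $ i)"
    proof (rule lipschitz_onI[OF _ L])
      fix x y assume "x \<in> S" "y \<in> S"
      then show "dist (f x $ i) (f y $ i) \<le> L * dist x y"
        using order_trans[OF dist_vec_nth_le lipschitz_onD[OF f]] by blast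
    qed
    then obtain g where "L-lipschitz_on UNIV g" "\<And>x. x \<in> S \<Longrightarrow> g x = f x $ i"
      by (rule lipschitz_extension_real) blast
    then show ?thesis by blast
  qed
  then obtain g where g: "\<And>i. L-lipschitz_on UNIV (g i)" "\<And>i x. x \<in> S \<Longrightarrow> g i x = f x $ i" by metis
  have "(real CARD('n) * L)-lipschitz_on UNIV (\<lambda>x. \<chi> i. g i x)"
  proof (rule lipschitz_onI)
    fix x y
    have "dist (\<chi> i. g i x) (\<chi> i. g i y) \<le> (\<Sum>i\<in>UNIV. \<bar>((\<chi> i. g i x) - (\<chi> i. g i y)) $ i\<bar>)"
      unfolding dist_norm by (rule norm_le_l1_cart)
    also have "\<dots> \<le> (\<Sum>i\<in>(UNIV::'n set). L * dist x y)"
      using lipschitz_onD[OF g(1)] by (intro sum_mono) (simp add: dist_real_def)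
    finally show "dist (\<chi> i. g i x) (\<chi> i. g i y) \<le> real CARD('n) * L * dist x y" by simp
  qed (use L in simp)
  moreover have "(\<chi> i. g i x) = f x" if "x \<in> S" for x using g(2)[OF that] by (simp add: vec_eq_iff)
  ultimately show ?thesis using that by blast
qed

text \<open>Euler's method along the displacement interpolation \<open>x + t(G x - x)\<close>: strong monotonicity makes
  the velocity \<open>G x - x\<close> a Lipschitz function of the current position.\<close>

lemma reachable_approximates_strongly_monotone:
  fixes F :: "'k::finite \<Rightarrow> real^'n \<Rightarrow> real^'n" and G :: "real^'n \<Rightarrow> real^'n"
  assumes tangent: "\<And>V. continuous_on UNIV V \<Longrightarrow> tangent F V"
    and S: "bounded S" "bounded (G ` S)" and G: "K-lipschitz_on S G"
    and mono: "\<And>x y. x \<in> S \<Longrightarrow> y \<in> S \<Longrightarrow> (G x - G y) \<bullet> (x - y) \<ge> \<delta> * (norm (x - y))\<^sup>2"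
    and "\<delta> > 0" "\<epsilon> > 0"
  obtains r where "reachable F r" "\<And>x. x \<in> S \<Longrightarrow> norm (r x - G x) \<le> \<epsilon>"
proof -
  define w where "w x = G x - x" for x
  define P where "P t x = x + t *\<^sub>R w x" for t x
  \<comment> \<open>At time \<open>t\<close> the map \<open>P t\<close> is strongly monotone with
    constant at least \<open>(1 - t) + t * \<delta>\<close>, hence at least \<open>m\<close> for all
    times in the unit interval.\<close>
  define m where "m = min 1 \<delta>"
  have m: "m > 0" "m \<le> 1" "m \<le> \<delta>" using \<open>\<delta> > 0\<close> by (auto simp: m_def)
  have K: "K \<ge> 0" using lipschitz_on_nonneg[OF G] .
  have "bounded (S \<union> G ` S)" using S by simp
  then obtain B where "B > 0" "\<forall>x\<in>S \<union> G ` S. norm x \<le> B" unfolding bounded_pos by blast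
  then have B: "B \<ge> 0" "\<And>x. x \<in> S \<Longrightarrow> norm x \<le> B" "\<And>x. x \<in> S \<Longrightarrow> norm (G x) \<le> B"
    by auto
  define D where "D = 2 * B"
  have wD: "norm (w x) \<le> D" if "x \<in> S" for x
    using norm_triangle_ineq4[of "G x" x] B(2,3)[OF that] by (simp add: w_def D_def)
  have PB: "norm (P t x) \<le> B" if "x \<in> S" "0 \<le> t" "t \<le> 1" for t x
  proof -
    have "P t x = (1 - t) *\<^sub>R x + t *\<^sub>R G x" by (simp add: P_def w_def algebra_simps)
    then have "norm (P t x) \<le> (1 - t) * norm x + t * norm (G x)"
      using norm_triangle_ineq[of "(1 - t) *\<^sub>R x" "t *\<^sub>R G x"] that by simp
    also have "\<dots> \<le> (1 - t) * B + t * B" using that B by (intro add_mono mult_left_mono) auto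
    finally show ?thesis by (simp add: algebra_simps)
  qed
  have expand: "m * norm (x - y) \<le> norm (P t x - P t y)" if xy: "x \<in> S" "y \<in> S" and t: "0 \<le> t" "t \<le> 1" for x y t
  proof -
    have "P t x - P t y = (1 - t) *\<^sub>R (x - y) + t *\<^sub>R (G x - G y)" by (simp add: P_def w_def algebra_simps)
    then have "(P t x - P t y) \<bullet> (x - y) = (1 - t) * (norm (x - y))\<^sup>2 + t * ((G x - G y) \<bullet> (x - y))"
      by (simp add: inner_add_left power2_norm_eq_inner)
    also have "\<dots> \<ge> (1 - t) * (m * (norm (x - y))\<^sup>2) + t * (m * (norm (x - y))\<^sup>2)"
    proof (intro add_mono mult_left_mono)
      show "m * (norm (x - y))\<^sup>2 \<le> (norm (x - y))\<^sup>2" using m mult_right_mono[of m 1 "(norm (x - y))\<^sup>2"] by simp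
      show "m * (norm (x - y))\<^sup>2 \<le> (G x - G y) \<bullet> (x - y)"
        using mono[OF xy] mult_right_mono[OF m(3), of "(norm (x - y))\<^sup>2"] by simp
    qed (use t in auto)
    finally have "m * (norm (x - y))\<^sup>2 \<le> (P t x - P t y) \<bullet> (x - y)" by (simp add: algebra_simps)
    also have "\<dots> \<le> norm (P t x - P t y) * norm (x - y)" by (rule norm_cauchy_schwarz)
    finally have "(m * norm (x - y)) * norm (x - y) \<le> norm (P t x - P t y) * norm (x - y)"
      by (simp add: power2_eq_square mult_ac)
    then show ?thesis
      by (cases "x = y") (auto simp: mult_le_cancel_right)
  qed
  \<comment> \<open>\<open>K + 1\<close> is a Lipschitz constant of \<open>w\<close>, the division
    by \<open>m\<close> accounts for inverting \<open>P t\<close>, and the cardinality comes from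
    the extension to the whole space.\<close>
  define L where "L = real CARD('n) * ((K + 1) / m)"
  have L: "L \<ge> 0" using K m by (simp add: L_def)
  have "\<exists>V. L-lipschitz_on UNIV V \<and> (\<forall>x\<in>S. V (P t x) = w x)" if t: "0 \<le> t" "t \<le> 1" for t
  proof -
    have inj: "inj_on (P t) S"
    proof (rule inj_onI)
      fix x y assume "x \<in> S" "y \<in> S" "P t x = P t y"
      then have "m * norm (x - y) \<le> 0" using expand[of x y t] t by simp
      then show "x = y" using m by (simp add: mult_le_0_iff)
    qed
    define W where "W z = w (inv_into S (P t) z)" for z
    have W: "W (P t x) = w x" if "x \<in> S" for x
      using inv_into_f_f[OF inj that] by (simp add: W_def)
    have "((K + 1) / m)-lipschitz_on (P t ` S) W"
    proof (rule lipschitz_onI)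
      fix a b assume "a \<in> P t ` S" "b \<in> P t ` S"
      then obtain x y where xy: "x \<in> S" "y \<in> S" and ab: "a = P t x" "b = P t y" by blast
      have "dist (W a) (W b) = norm ((G x - G y) - (x - y))"
        by (simp add: ab W xy dist_norm) (simp add: w_def algebra_simps)
      also have "\<dots> \<le> norm (G x - G y) + norm (x - y)" by (rule norm_triangle_ineq4)
      also have "\<dots> \<le> (K + 1) * norm (x - y)"
        using lipschitz_onD[OF G xy] by (simp add: dist_norm algebra_simps)
      also have "\<dots> \<le> (K + 1) * (dist a b / m)"
        using expand[OF xy t] m K by (intro mult_left_mono) (auto simp: ab dist_norm field_simps)
      finally show "dist (W a) (W b) \<le> (K + 1) / m * dist a b" by simp
    qed (use K m in auto)
    then obtain V where "L-lipschitz_on UNIV V" "\<And>z. z \<in> P t ` S \<Longrightarrow> V z = W z"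
      unfolding L_def by (rule lipschitz_extension) blast
    then show ?thesis using W by (intro exI[of _ V]) auto
  qed
  then obtain V where V: "\<And>t. 0 \<le> t \<Longrightarrow> t \<le> 1 \<Longrightarrow> L-lipschitz_on UNIV (V t)"
    "\<And>t x. 0 \<le> t \<Longrightarrow> t \<le> 1 \<Longrightarrow> x \<in> S \<Longrightarrow> V t (P t x) = w x"
    by metis
  define e where "e = min 1 \<epsilon>"
  have e: "e > 0" "e \<le> 1" "e \<le> \<epsilon>" using \<open>\<epsilon> > 0\<close> by (auto simp: e_def)
  define \<eta> where "\<eta> = e / (2 * exp L)"
  have \<eta>: "\<eta> > 0" "exp L * \<eta> = e / 2" using e by (auto simp: \<eta>_def)
  \<comment> \<open>Freezing the velocity for a time \<open>1 / N\<close> costs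
    \<open>L * D / N\<close> per unit time. \<open>N\<close> and \<open>\<eta>\<close> are such that
    both error sources stay below \<open>e / 2\<close> after amplification by
    \<open>exp L\<close>.\<close>
  obtain N :: nat where N: "2 * exp L * L * D / e < real N" using reals_Archimedean2 by blast
  have "D \<ge> 0" using B by (simp add: D_def)
  then have "0 \<le> 2 * exp L * L * D / e" using L e by simp
  then have N0: "N > 0" using N by (metis less_le_trans of_nat_0_less_iff order_le_less_trans)
  define a where "a = L * D / real N + \<eta>"
  have a: "a > 0" "exp L * a \<le> e"
  proof -
    show "a > 0" using L \<open>D \<ge> 0\<close> \<eta> by (simp add: a_def add_nonneg_pos)
    have "2 * exp L * L * D < real N * e" using N e by (simp add: pos_divide_less_eq)
    then have "exp L * (L * D / real N) \<le> e / 2" using N0 by (simp add: field_simps)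
    moreover have "exp L * a = exp L * (L * D / real N) + exp L * \<eta>"
      by (simp only: a_def distrib_left)
    ultimately show "exp L * a \<le> e" using \<eta>(2) by linarith
  qed
  have "\<exists>h0>0. \<forall>h. \<bar>h\<bar> \<le> h0 \<longrightarrow> (\<exists>r. reachable F r \<and>
      (\<forall>x\<in>cball 0 (B + 1). norm (r x - x - h *\<^sub>R V (real i / real N) x) \<le> \<eta> * \<bar>h\<bar>))" if "i < N" for i
  proof -
    have "continuous_on UNIV (V (real i / real N))"
      using V(1)[of "real i / real N"] that N0 by (intro lipschitz_on_continuous_on) auto
    from tangentD[OF tangent[OF this] \<eta>(1), of "B + 1"] show ?thesis by metis
  qed
  then obtain hh where hh: "\<And>i. i < N \<Longrightarrow> hh i > 0" "\<And>i h. i < N \<Longrightarrow> \<bar>h\<bar> \<le> hh i \<Longrightarrow> \<exists>r. reachable F r \<and>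
      (\<forall>x\<in>cball 0 (B + 1). norm (r x - x - h *\<^sub>R V (real i / real N) x) \<le> \<eta> * \<bar>h\<bar>)"
    by metis
  \<comment> \<open>The positive minimum exists because only \<open>N\<close> frozen fields occur.
    The number \<open>M\<close> of steps per frozen field is chosen only now.\<close>
  define h1 where "h1 = Min (hh ` {..<N})"
  have "h1 > 0"
    unfolding h1_def using hh(1) N0 by (subst Min_gr_iff) (auto simp: lessThan_empty_iff)
  then have h1: "h1 > 0" "\<And>i. i < N \<Longrightarrow> h1 \<le> hh i" by (auto simp: h1_def)
  obtain M :: nat where M: "1 / h1 < real M" using reals_Archimedean2 by blast
  have M0: "M > 0" using M h1 by (metis divide_pos_pos less_trans of_nat_0_less_iff zero_less_one)
  define h where "h = 1 / (real N * real M)"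
  have h0: "h > 0" using N0 M0 by (simp add: h_def)
  have "h \<le> h1"
  proof -
    have "1 \<le> real M * h1" using M h1 by (simp add: field_simps)
    also have "\<dots> \<le> real N * (real M * h1)" using N0 M0 h1 mult_right_mono[of 1 "real N" "real M * h1"] by simp
    finally show ?thesis using N0 M0 by (simp add: h_def field_simps)
  qed
  have hNM: "h * (real N * real M) = 1" using N0 M0 by (simp add: h_def)
  \<comment> \<open>Discrete Gronwall bound: one step multiplies the error by at most
    \<open>1 + h * L\<close> and adds \<open>h * a\<close>.\<close>
  have small: "(1 + h * L) ^ j * (real j * h * a) \<le> e" if "j \<le> N * M" for j
  proof -
    have "real j * h \<le> real (N * M) * h"
      using that h0 by (intro mult_right_mono of_nat_mono) auto
    then have jh: "real j * h \<le> 1" using hNM by (simp add: mult_ac)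
    have "(1 + h * L) ^ j \<le> exp (h * L) ^ j"
      using h0 L by (intro power_mono exp_ge_add_one_self) auto
    also have "\<dots> = exp ((real j * h) * L)" by (simp add: exp_of_nat_mult[symmetric] mult_ac)
    also have "\<dots> \<le> exp L" using jh L mult_right_mono[OF jh L] by simp
    finally have "(1 + h * L) ^ j * (real j * h * a) \<le> exp L * (1 * a)"
      using jh h0 a L by (intro mult_mono) auto
    also have "exp L * (1 * a) \<le> e" using a by simp
    finally show ?thesis .
  qed
  have "\<exists>r. reachable F r \<and> (\<forall>x\<in>S. norm (r x - P (real j * h) x) \<le> (1 + h * L) ^ j * (real j * h * a))"
    if "j \<le> N * M" for j
    using that
  proof (induction j)
    case 0
    \<comment> \<open>Tangency of the zero field at time 0 provides a reachable map equal to the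
      identity on the ball.\<close>
    have "continuous_on UNIV (\<lambda>x::real^'n. 0 :: real^'n)" by simp
    then obtain k0 where "k0 > 0" "\<And>k. \<bar>k\<bar> \<le> k0 \<Longrightarrow>
       \<exists>r. reachable F r \<and> (\<forall>x\<in>cball 0 B. norm (r x - x - k *\<^sub>R 0) \<le> 1 * \<bar>k\<bar>)"
      using tangentD[OF tangent, of "\<lambda>x. 0" 1 B] by (metis zero_less_one)
    from this(2)[of 0] this(1) obtain r where "reachable F r" "\<forall>x\<in>cball 0 B. r x = x" by auto
    then show ?case using B by (intro exI[of _ r]) (auto simp: P_def)
  next
    case (Suc j)
    then obtain r where r: "reachable F r"
      "\<And>x. x \<in> S \<Longrightarrow> norm (r x - P (real j * h) x) \<le> (1 + h * L) ^ j * (real j * h * a)" by auto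
    have j: "j < N * M" using Suc.prems by simp
    \<comment> \<open>Step \<open>j\<close> uses the field frozen at the last coarse grid time not
      after \<open>j * h\<close>.\<close>
    define i where "i = j div M"
    have i: "i < N" using j by (simp add: i_def less_mult_imp_div_less)
    have ji: "0 \<le> real j * h - real i / real N" "real j * h - real i / real N \<le> 1 / real N"
    proof -
      have "real j = real i * real M + real (j mod M)"
        unfolding i_def by (metis div_mult_mod_eq of_nat_add of_nat_mult)
      then have "real j * h - real i / real N = real (j mod M) * h"
        using N0 M0 by (simp add: h_def field_simps)
      moreover have "real (j mod M) * h \<le> real M * h" using M0 h0 by (intro mult_right_mono) auto
      moreover have "real M * h = 1 / real N" using N0 M0 by (simp add: h_def)
      ultimately show "0 \<le> real j * h - real i / real N" "real j * h - real i / real N \<le> 1 / real N"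
        using h0 by auto
    qed
    obtain s where s: "reachable F s"
      "\<And>x. x \<in> cball 0 (B + 1) \<Longrightarrow> norm (s x - x - h *\<^sub>R V (real i / real N) x) \<le> \<eta> * \<bar>h\<bar>"
      using hh(2)[OF i, of h] h1(2)[OF i] \<open>h \<le> h1\<close> h0 by auto
    have iN: "0 \<le> real i / real N" "real i / real N \<le> 1" using i N0 by auto
    have jh: "0 \<le> real j * h" "real j * h \<le> 1"
    proof -
      show "0 \<le> real j * h" using h0 by simp
      have "real j * h \<le> real (N * M) * h" using j h0 by (intro mult_right_mono of_nat_mono) auto
      then show "real j * h \<le> 1" using hNM by (simp add: mult_ac)
    qed
    have "norm (s (r x) - P (real (Suc j) * h) x) \<le> (1 + h * L) ^ Suc j * (real (Suc j) * h * a)"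
      if x: "x \<in> S" for x
    proof -
      define E where "E = (1 + h * L) ^ j * (real j * h * a)"
      define y where "y = r x"
      have yE: "norm (y - P (real j * h) x) \<le> E" using r(2)[OF x] by (simp add: E_def y_def)
      have "E \<le> 1" using small[of j] j e by (simp add: E_def)
      have "norm y \<le> norm (P (real j * h) x) + norm (y - P (real j * h) x)" by (rule norm_triangle_sub)
      then have yB: "y \<in> cball 0 (B + 1)" using PB[OF x jh] yE \<open>E \<le> 1\<close> by simp
      have "P (real j * h) x - P (real i / real N) x = (real j * h - real i / real N) *\<^sub>R w x"
        by (simp add: P_def algebra_simps)
      then have "norm (P (real j * h) x - P (real i / real N) x) = (real j * h - real i / real N) * norm (w x)"
        using ji by simp
      also have "\<dots> \<le> (1 / real N) * D" using ji wD[OF x] by (intro mult_mono) auto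
      finally have pp: "norm (P (real j * h) x - P (real i / real N) x) \<le> (1 / real N) * D" .
      have "norm (V (real i / real N) y - w x) \<le> L * norm (y - P (real i / real N) x)"
        using lipschitz_onD[OF V(1)[OF iN], of y "P (real i / real N) x"] V(2)[OF iN x] by (simp add: dist_norm)
      also have "\<dots> \<le> L * (E + (1 / real N) * D)"
        using norm_triangle_mono[OF yE pp] L by (intro mult_left_mono) auto
      finally have "h * norm (V (real i / real N) y - w x) \<le> h * (L * (E + (1 / real N) * D))"
        using h0 by (intro mult_left_mono) auto
      then have 3: "norm (h *\<^sub>R (V (real i / real N) y - w x)) \<le> h * (L * (E + (1 / real N) * D))"
        using h0 by simp
      have "norm ((s y - y - h *\<^sub>R V (real i / real N) y) + (y - P (real j * h) x) + h *\<^sub>R (V (real i / real N) y - w x))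
        \<le> \<eta> * \<bar>h\<bar> + E + h * (L * (E + (1 / real N) * D))"
        by (intro norm_triangle_mono s(2)[OF yB] yE 3)
      also have "(s y - y - h *\<^sub>R V (real i / real N) y) + (y - P (real j * h) x) + h *\<^sub>R (V (real i / real N) y - w x)
        = s y - P (real (Suc j) * h) x" by (simp add: P_def algebra_simps)
      also have "\<eta> * \<bar>h\<bar> + E + h * (L * (E + (1 / real N) * D)) = (1 + h * L) * E + h * a"
        using h0 by (simp add: a_def algebra_simps)
      \<comment> \<open>Weakening the new error by a factor at least 1 keeps the bound in closed
        form.\<close>
      also have "\<dots> \<le> (1 + h * L) * E + (1 + h * L) ^ Suc j * (h * a)"
      proof -
        have "1 \<le> (1 + h * L) ^ Suc j" using h0 L by (intro one_le_power) simp
        then have "1 * (h * a) \<le> (1 + h * L) ^ Suc j * (h * a)" using h0 a by (intro mult_right_mono) auto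
        then show ?thesis by simp
      qed
      also have "\<dots> = (1 + h * L) ^ Suc j * (real (Suc j) * h * a)" by (simp add: E_def algebra_simps)
      finally show ?thesis by (simp add: y_def)
    qed
    then show ?case using reachable_comp[OF s(1) r(1)] by blast
  qed
  then obtain r where r: "reachable F r"
    "\<And>x. x \<in> S \<Longrightarrow> norm (r x - P (real (N * M) * h) x) \<le> (1 + h * L) ^ (N * M) * (real (N * M) * h * a)"
    by blast
  have "norm (r x - G x) \<le> \<epsilon>" if "x \<in> S" for x
  proof -
    have "P (real (N * M) * h) x = G x" using hNM by (simp add: P_def w_def mult_ac)
    then show ?thesis using r(2)[OF that] small[of "N * M"] e by simp
  qed
  then show ?thesis using that r(1) by blast
qed

section \<open>Mollification of monotone maps\<close>

lemma integrable_lborel_compact_support: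
  fixes f :: "'a::euclidean_space \<Rightarrow> 'b::{banach, second_countable_topology}"
  assumes "f \<in> borel_measurable borel" "\<And>v. norm (f v) \<le> C * indicator (cball 0 R) v"
  shows "integrable lborel f"
proof (rule Bochner_Integration.integrable_bound[where f="\<lambda>v. C * indicator (cball 0 R) v"])
  show "integrable lborel (\<lambda>v::'a. C * indicator (cball 0 R) v)"
    using emeasure_bounded_finite[OF bounded_cball[of "0::'a" R]]
    by (intro integrable_mult_right integrable_real_indicator) auto
  have "norm (f v) \<le> norm (C * indicator (cball 0 R) v)" for v
    using assms(2)[of v] by simp
  then show "AE v in lborel. norm (f v) \<le> norm (C * indicator (cball 0 R) v)" by simp
qed (use assms in simp)

lemma lborel_integral_translate:
  fixes f :: "'a::euclidean_space \<Rightarrow> 'b::{banach, second_countable_topology}"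
  assumes "f \<in> borel_measurable borel"
  shows "(\<integral>v. f (c + v) \<partial>lborel) = (\<integral>v. f v \<partial>lborel)"
proof -
  have "(\<integral>v. f v \<partial>lborel) = (\<integral>v. f v \<partial>distr lborel borel ((+) c))"
    by (simp add: lborel_distr_plus)
  also have "\<dots> = (\<integral>v. f (c + v) \<partial>lborel)"
    using assms by (intro integral_distr) auto
  finally show ?thesis ..
qed

text \<open>The average of \<open>T\<close> over small balls is Lipschitz and inherits monotonicity. Contracting towards an
  interior point first keeps these balls inside the convex domain.\<close>

lemma monotone_lipschitz_approximation:
  fixes T :: "'a::euclidean_space \<Rightarrow> 'a"
  assumes \<Omega>: "open \<Omega>" "bounded \<Omega>" "convex \<Omega>" "\<Omega> \<noteq> {}"
    and T: "continuous_on (closure \<Omega>) T"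
    and mono: "\<And>x y. x \<in> \<Omega> \<Longrightarrow> y \<in> \<Omega> \<Longrightarrow> (T x - T y) \<bullet> (x - y) \<ge> 0"
    and "\<epsilon> > 0"
  obtains G K where "K-lipschitz_on \<Omega> G" "\<And>x. x \<in> \<Omega> \<Longrightarrow> norm (G x - T x) \<le> \<epsilon>"
    "\<And>x y. x \<in> \<Omega> \<Longrightarrow> y \<in> \<Omega> \<Longrightarrow> (G x - G y) \<bullet> (x - y) \<ge> 0"
proof -
  have cl: "compact (closure \<Omega>)" using \<Omega>(2) by (simp add: compact_closure)
  have "bounded (T ` closure \<Omega>)" using compact_continuous_image[OF T cl] compact_imp_bounded by blast
  then obtain B where B: "B > 0" "\<And>x. x \<in> \<Omega> \<Longrightarrow> norm (T x) \<le> B"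
    unfolding bounded_pos using closure_subset by blast
  obtain \<delta> where \<delta>: "\<delta> > 0" "\<And>x y. x \<in> closure \<Omega> \<Longrightarrow> y \<in> closure \<Omega> \<Longrightarrow> dist y x < \<delta> \<Longrightarrow> dist (T y) (T x) < \<epsilon>"
    using compact_uniformly_continuous[OF T cl] \<open>\<epsilon> > 0\<close> unfolding uniformly_continuous_on_def by metis
  obtain x0 where x0: "x0 \<in> \<Omega>" using \<Omega> by blast
  obtain \<rho> where \<rho>: "\<rho> > 0" "ball x0 \<rho> \<subseteq> \<Omega>" using \<Omega>(1) x0 open_contains_ball by blast
  obtain R where R: "R > 0" "\<And>x. x \<in> \<Omega> \<Longrightarrow> norm x \<le> R"
    using \<Omega>(2) unfolding bounded_pos by blast
  \<comment> \<open>The weight of the contraction towards \<open>x0\<close>. Points move by at most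
    \<open>\<sigma> * (2 * R)\<close>, which must stay below the modulus of continuity
    \<open>\<delta>\<close>.\<close>
  define \<sigma> where "\<sigma> = min (1 / 2) (\<delta> / (4 * R))"
  have \<sigma>: "\<sigma> > 0" "\<sigma> \<le> 1 / 2" "\<sigma> * (2 * R) < \<delta>"
  proof -
    show "\<sigma> > 0" "\<sigma> \<le> 1 / 2" using \<delta> R by (auto simp: \<sigma>_def)
    have "\<sigma> \<le> \<delta> / (4 * R)" by (simp add: \<sigma>_def)
    then have "\<sigma> * (4 * R) \<le> \<delta>" using R by (simp add: pos_le_divide_eq)
    then show "\<sigma> * (2 * R) < \<delta>" using \<delta>(1) by linarith
  qed
  define r where "r = \<sigma> * \<rho>"
  have r: "r > 0" using \<sigma> \<rho> by (simp add: r_def)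
  define c where "c x = (1 - \<sigma>) *\<^sub>R x + \<sigma> *\<^sub>R x0" for x
  \<comment> \<open>An unnormalised tent of height 1 and Lipschitz constant \<open>1 / r\<close>;
    its mass is \<open>I\<close> below.\<close>
  define k where "k v = max 0 (1 - norm v / r)" for v :: 'a
  define T' where "T' v = indicator \<Omega> v *\<^sub>R T v" for v
  have k_pos: "k v \<ge> 0" and k_le: "k v \<le> indicator (cball 0 r) v" for v
    using r by (auto simp: k_def indicator_def field_simps)
  have kr: "norm v < r" if "k v \<noteq> 0" for v
    using that r by (auto simp: k_def max_def field_simps split: if_splits)
  have k_lip: "\<bar>k v - k w\<bar> \<le> norm (v - w) / r" for v w
  proof -
    have "\<bar>k v - k w\<bar> \<le> \<bar>norm v / r - norm w / r\<bar>" unfolding k_def by linarith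
    also have "\<dots> = \<bar>norm v - norm w\<bar> / r" using r by (simp add: diff_divide_distrib[symmetric])
    also have "\<dots> \<le> norm (v - w) / r" using r by (intro divide_right_mono norm_triangle_ineq3) auto
    finally show ?thesis .
  qed
  have k_meas [measurable]: "k \<in> borel_measurable borel"
    unfolding k_def by (intro borel_measurable_continuous_onI continuous_intros) (use r in auto)
  have T'_meas [measurable]: "T' \<in> borel_measurable borel"
    unfolding T'_def using \<Omega>(1) closure_subset
    by (intro borel_measurable_continuous_on_indicator continuous_on_subset[OF T]) auto
  have T'_le: "norm (T' v) \<le> B * indicator (cball 0 R) v" for v
    using B R by (auto simp: T'_def indicator_def)
  then have T'_B: "norm (T' v) \<le> B" for v
    using B(1) by (metis indicator_simps less_imp_le mult.right_neutral mult_zero_right order_trans)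
  have cin: "c x + v \<in> \<Omega>" "norm (c x + v - x) < \<delta>" if x: "x \<in> \<Omega>" and v: "norm v < r" for x v
  proof -
    have "norm (v /\<^sub>R \<sigma>) < \<rho>" using v \<sigma> by (simp add: r_def field_simps)
    then have p: "x0 + v /\<^sub>R \<sigma> \<in> \<Omega>" using \<rho>(2) by (auto simp: dist_norm subset_iff)
    \<comment> \<open>Convexity applies because a perturbation of size below
      \<open>r = \<sigma> * \<rho>\<close> can be charged to \<open>x0\<close>, where it becomes
      smaller than \<open>\<rho>\<close>.\<close>
    have eq: "c x + v = (1 - \<sigma>) *\<^sub>R x + \<sigma> *\<^sub>R (x0 + v /\<^sub>R \<sigma>)"
      using \<sigma> by (simp add: c_def scaleR_add_right)
    show "c x + v \<in> \<Omega>" unfolding eq using \<Omega>(3) x p \<sigma> by (intro convexD) auto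
    have "c x + v - x = \<sigma> *\<^sub>R ((x0 + v /\<^sub>R \<sigma>) - x)" unfolding eq by (simp add: algebra_simps)
    then have "norm (c x + v - x) = \<sigma> * norm ((x0 + v /\<^sub>R \<sigma>) - x)" using \<sigma> by simp
    also have "\<dots> \<le> \<sigma> * (R + R)"
      using norm_triangle_ineq4[of "x0 + v /\<^sub>R \<sigma>" x] R(2)[OF p] R(2)[OF x] \<sigma> by (intro mult_left_mono) linarith+
    finally show "norm (c x + v - x) < \<delta>" using \<sigma>(3) by simp
  qed
  define I where "I = (\<integral>v. k v \<partial>lborel)"
  have k_int: "integrable lborel k"
    by (rule integrable_lborel_compact_support[where C=1 and R=r]) (use k_pos k_le in auto)
  have "I > 0"
  \<comment> \<open>The tent is at least 1/2 on the ball of half the radius.\<close>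
  proof -
    have "0 < 1 / 2 * measure lborel (cball (0::'a) (r / 2))" using r content_cball_pos by simp
    also have "\<dots> = (\<integral>v. 1 / 2 * indicator (cball (0::'a) (r / 2)) v \<partial>lborel)" by simp
    also have "\<dots> \<le> I"
      unfolding I_def
    proof (rule integral_mono)
      show "integrable lborel (\<lambda>v::'a. 1 / 2 * indicator (cball 0 (r / 2)) v :: real)"
        by (rule integrable_lborel_compact_support[where C=1 and R="r / 2"]) (auto simp: indicator_def)
      show "1 / 2 * indicator (cball 0 (r / 2)) v \<le> k v" for v
        using r by (auto simp: k_def indicator_def field_simps)
    qed (rule k_int)
    finally show ?thesis .
  qed
  define G where "G x = (\<integral>v. k v *\<^sub>R T' (c x + v) \<partial>lborel) /\<^sub>R I" for x
  have kT_int: "integrable lborel (\<lambda>v. k v *\<^sub>R T' (c x + v))" for x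
  proof (rule integrable_lborel_compact_support[where C=B and R=r])
    show "norm (k v *\<^sub>R T' (c x + v)) \<le> B * indicator (cball 0 r) v" for v
      using mult_mono[OF k_le T'_B, of v "c x + v"] k_pos[of v] by (simp add: mult.commute)
  qed measurable
  have in_\<Omega>: "k v *\<^sub>R T' (c x + v) = k v *\<^sub>R T (c x + v)" if "x \<in> \<Omega>" for x v
    using cin(1)[OF that kr[of v]] by (cases "k v = 0") (auto simp: T'_def)
  have "norm (G x - T x) \<le> \<epsilon>" if x: "x \<in> \<Omega>" for x
  proof -
    have i1: "integrable lborel (\<lambda>v. k v *\<^sub>R T x)" using k_int by (rule integrable_scaleR_left)
    have "G x - T x = ((\<integral>v. k v *\<^sub>R T' (c x + v) \<partial>lborel) - I *\<^sub>R T x) /\<^sub>R I"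
      using \<open>I > 0\<close> by (simp add: G_def scaleR_diff_right)
    also have "I *\<^sub>R T x = (\<integral>v. k v *\<^sub>R T x \<partial>lborel)" using k_int by (simp add: I_def)
    also have "(\<integral>v. k v *\<^sub>R T' (c x + v) \<partial>lborel) - (\<integral>v. k v *\<^sub>R T x \<partial>lborel)
        = (\<integral>v. k v *\<^sub>R T' (c x + v) - k v *\<^sub>R T x \<partial>lborel)"
      by (rule Bochner_Integration.integral_diff[symmetric, OF kT_int i1])
    finally have "norm (G x - T x) = norm (\<integral>v. k v *\<^sub>R T' (c x + v) - k v *\<^sub>R T x \<partial>lborel) / I"
      using \<open>I > 0\<close> by (simp add: divide_inverse_commute)
    also have "norm (\<integral>v. k v *\<^sub>R T' (c x + v) - k v *\<^sub>R T x \<partial>lborel) \<le> (\<integral>v. \<epsilon> * k v \<partial>lborel)"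
    proof (rule Bochner_Integration.integral_norm_bound_integral)
      show "integrable lborel (\<lambda>v. k v *\<^sub>R T' (c x + v) - k v *\<^sub>R T x)"
        by (intro Bochner_Integration.integrable_diff kT_int i1)
      show "integrable lborel (\<lambda>v. \<epsilon> * k v)" using k_int by simp
      show "norm (k v *\<^sub>R T' (c x + v) - k v *\<^sub>R T x) \<le> \<epsilon> * k v" for v
      proof (cases "k v = 0")
        case False
        have "dist (T (c x + v)) (T x) < \<epsilon>"
          using cin[OF x kr[OF False]] x closure_subset by (intro \<delta>(2)) (auto simp: dist_norm)
        then have "k v * norm (T (c x + v) - T x) \<le> k v * \<epsilon>"
          using k_pos by (intro mult_left_mono) (auto simp: dist_norm)
        then show ?thesis
          using k_pos[of v] by (simp add: in_\<Omega>[OF x] scaleR_diff_right[symmetric] mult.commute)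
      qed simp
    qed
    also have "(\<integral>v. \<epsilon> * k v \<partial>lborel) / I = \<epsilon>" using \<open>I > 0\<close> by (simp add: I_def)
    finally show ?thesis using \<open>I > 0\<close> by (simp add: divide_right_mono)
  qed
  moreover have "(G x - G y) \<bullet> (x - y) \<ge> 0" if x: "x \<in> \<Omega>" and y: "y \<in> \<Omega>" for x y
  proof -
    have diff: "(\<integral>v. k v *\<^sub>R T' (c x + v) \<partial>lborel) - (\<integral>v. k v *\<^sub>R T' (c y + v) \<partial>lborel)
      = (\<integral>v. k v *\<^sub>R T' (c x + v) - k v *\<^sub>R T' (c y + v) \<partial>lborel)"
      by (rule Bochner_Integration.integral_diff[symmetric, OF kT_int kT_int])
    have "G x - G y = (\<integral>v. k v *\<^sub>R T' (c x + v) - k v *\<^sub>R T' (c y + v) \<partial>lborel) /\<^sub>R I"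
      unfolding G_def diff[symmetric] scaleR_diff_right ..
    then have "(G x - G y) \<bullet> (x - y)
      = ((\<integral>v. k v *\<^sub>R T' (c x + v) - k v *\<^sub>R T' (c y + v) \<partial>lborel) \<bullet> (x - y)) / I"
      by (simp only: inner_scaleR_left divide_inverse_commute)
    also have "\<dots> = (\<integral>v. (k v *\<^sub>R T' (c x + v) - k v *\<^sub>R T' (c y + v)) \<bullet> (x - y) \<partial>lborel) / I"
      by (subst integral_inner_left) (auto intro: Bochner_Integration.integrable_diff kT_int)
    also have "\<dots> \<ge> 0"
    proof (intro divide_nonneg_pos Bochner_Integration.integral_nonneg \<open>I > 0\<close>)
      fix v
      show "0 \<le> (k v *\<^sub>R T' (c x + v) - k v *\<^sub>R T' (c y + v)) \<bullet> (x - y)"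
      proof (cases "k v = 0")
        case False
        \<comment> \<open>For a common shift \<open>v\<close> the difference of the two points is a
          positive multiple of \<open>x - y\<close>, so the integrand inherits the sign given by the
          monotonicity of \<open>T\<close>.\<close>
        have "(c x + v) - (c y + v) = (1 - \<sigma>) *\<^sub>R (x - y)" by (simp add: c_def scaleR_diff_right)
        then have "0 \<le> (1 - \<sigma>) * ((T (c x + v) - T (c y + v)) \<bullet> (x - y))"
          using mono[OF cin(1)[OF x kr[OF False]] cin(1)[OF y kr[OF False]]] by simp
        then have "0 \<le> (T (c x + v) - T (c y + v)) \<bullet> (x - y)"
          using \<sigma> by (simp add: zero_le_mult_iff)
        then show ?thesis
          using k_pos[of v] by (simp add: in_\<Omega>[OF x] in_\<Omega>[OF y] scaleR_diff_right[symmetric])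
      qed simp
    qed
    finally show ?thesis .
  qed
  moreover have "(B * measure lborel (cball (0::'a) R) / (r * I))-lipschitz_on \<Omega> G"
  proof (rule lipschitz_onI)
    fix x y
    \<comment> \<open>Translation moves the dependence on \<open>x\<close> from the merely
      continuous \<open>T\<close> to the Lipschitz kernel.\<close>
    have tr: "(\<integral>v. k v *\<^sub>R T' (c x + v) \<partial>lborel) = (\<integral>v. k (v - c x) *\<^sub>R T' v \<partial>lborel)" for x
      using lborel_integral_translate[of "\<lambda>v. k (v - c x) *\<^sub>R T' v" "c x"] by simp
    have int: "integrable lborel (\<lambda>v. k (v - c x) *\<^sub>R T' v)" for x
    proof (rule integrable_lborel_compact_support[where C=B and R=R])
      have "k v \<le> 1" for v using r by (simp add: k_def)
      then show "norm (k (v - c x) *\<^sub>R T' v) \<le> B * indicator (cball 0 R) v" for v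
        using mult_mono[OF _ T'_le, of "k (v - c x)" 1 v] k_pos[of "v - c x"] by simp
    qed measurable
    have diff: "(\<integral>v. k (v - c x) *\<^sub>R T' v \<partial>lborel) - (\<integral>v. k (v - c y) *\<^sub>R T' v \<partial>lborel)
      = (\<integral>v. k (v - c x) *\<^sub>R T' v - k (v - c y) *\<^sub>R T' v \<partial>lborel)"
      by (rule Bochner_Integration.integral_diff[symmetric, OF int int])
    have "G x - G y = (\<integral>v. k (v - c x) *\<^sub>R T' v - k (v - c y) *\<^sub>R T' v \<partial>lborel) /\<^sub>R I"
      unfolding G_def tr diff[symmetric] scaleR_diff_right ..
    then have "dist (G x) (G y) = norm (\<integral>v. k (v - c x) *\<^sub>R T' v - k (v - c y) *\<^sub>R T' v \<partial>lborel) / I"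
      using \<open>I > 0\<close> by (simp add: dist_norm divide_inverse_commute)
    also have "norm (\<integral>v. k (v - c x) *\<^sub>R T' v - k (v - c y) *\<^sub>R T' v \<partial>lborel)
      \<le> (\<integral>v. (norm (x - y) / r * B) * indicator (cball (0::'a) R) v \<partial>lborel)"
    proof (rule Bochner_Integration.integral_norm_bound_integral)
      show "integrable lborel (\<lambda>v. k (v - c x) *\<^sub>R T' v - k (v - c y) *\<^sub>R T' v)"
        by (intro Bochner_Integration.integrable_diff int)
      show "integrable lborel (\<lambda>v::'a. (norm (x - y) / r * B) * indicator (cball 0 R) v)"
        by (rule integrable_lborel_compact_support[where C="norm (x - y) / r * B" and R=R])
          (use B r in \<open>auto simp: indicator_def\<close>)
      fix v
      have "norm ((v - c x) - (v - c y)) \<le> norm (x - y)"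
      proof -
        have "(v - c x) - (v - c y) = (1 - \<sigma>) *\<^sub>R (y - x)" by (simp add: c_def scaleR_diff_right)
        then show ?thesis using \<sigma> mult_right_mono[of "1 - \<sigma>" 1 "norm (x - y)"] by (simp add: norm_minus_commute)
      qed
      then have "\<bar>k (v - c x) - k (v - c y)\<bar> \<le> norm (x - y) / r"
        using k_lip[of "v - c x" "v - c y"] r divide_right_mono[of _ "norm (x - y)" r] by fastforce
      then have "\<bar>k (v - c x) - k (v - c y)\<bar> * norm (T' v) \<le> norm (x - y) / r * (B * indicator (cball 0 R) v)"
        using r by (intro mult_mono T'_le) auto
      then show "norm (k (v - c x) *\<^sub>R T' v - k (v - c y) *\<^sub>R T' v) \<le> (norm (x - y) / r * B) * indicator (cball 0 R) v"
        by (simp add: scaleR_diff_left[symmetric] mult.assoc)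
    qed
    finally show "dist (G x) (G y) \<le> B * measure lborel (cball (0::'a) R) / (r * I) * dist x y"
      using \<open>I > 0\<close> r by (simp add: dist_norm divide_simps mult_ac)
  qed (use B r \<open>I > 0\<close> in auto)
  ultimately show ?thesis using that by blast
qed

subsection \<open>Monotonicity of the optimal transport map\<close>

text \<open>Rearranging \<open>\<mu> \<otimes> \<mu>\<close> along the symmetric set of pairs on which \<open>T\<close> decreases yields a competing
  coupling, which is cheaper unless this set is null.\<close>

lemma optimal_transport_map_AE_monotone:
  fixes \<mu> \<nu> :: "(real^'n) measure"
  assumes \<mu>: "prob_space \<mu>" "sets \<mu> = sets borel"
    and opt: "optimal_transport_map \<mu> \<nu> T"
    and bdd: "AE x in \<mu>. norm x \<le> B \<and> norm (T x) \<le> B"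
  shows "AE z in \<mu> \<Otimes>\<^sub>M \<mu>. (T (fst z) - T (snd z)) \<bullet> (fst z - snd z) \<ge> 0"
proof -
  interpret prob_space \<mu> by fact
  interpret P: pair_prob_space \<mu> \<mu> ..
  let ?P = "\<mu> \<Otimes>\<^sub>M \<mu>"
  have [measurable_cong]: "sets \<mu> = sets borel" by fact
  have [measurable]: "T \<in> borel_measurable borel" using opt by (simp add: optimal_transport_map_def)
  have space_\<mu>: "space \<mu> = UNIV" using sets_eq_imp_space_eq[OF \<mu>(2)] by simp
  then have space_P: "space ?P = UNIV" by (simp add: space_pair_measure)
  define sw where "sw z \<longleftrightarrow> (T (fst z) - T (snd z)) \<bullet> (fst z - snd z) < 0" for z :: "(real^'n) \<times> (real^'n)"
  \<comment> \<open>In a pair with \<open>sw\<close>, the two points exchange their targets. The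
    competitor sends \<open>fst z\<close> to \<open>T (\<tau> z)\<close>.\<close>
  define \<tau> where "\<tau> z = (if sw z then snd z else fst z)" for z
  have [measurable]: "Measurable.pred ?P sw" unfolding sw_def by measurable
  have \<tau>_meas [measurable]: "\<tau> \<in> ?P \<rightarrow>\<^sub>M borel" unfolding \<tau>_def by measurable
  let ?s = "\<lambda>(x, y). (y, x) :: (real^'n) \<times> (real^'n)"
  have swap: "distr ?P ?P ?s = ?P" using P.distr_pair_swap by simp
  have sw_swap: "sw (?s z) = sw z" for z
    by (cases z) (simp add: sw_def inner_diff_left inner_diff_right algebra_simps)
  have fst_\<mu>: "distr ?P borel fst = \<mu>"
  proof -
    have "distr ?P borel fst = distr ?P \<mu> fst" by (rule distr_cong) (auto simp: \<mu>)
    then show ?thesis using distr_pair_fst[of \<mu>] by simp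
  qed
  \<comment> \<open>The set \<open>sw\<close> is symmetric and the product measure is invariant
    under the swap, so on \<open>sw\<close> the second coordinate has the same law as the first.
    This gives the competitor its second marginal.\<close>
  have \<tau>_\<mu>: "distr ?P borel \<tau> = \<mu>"
  proof (rule measure_eqI)
    fix A assume "A \<in> sets (distr ?P borel \<tau>)"
    then have A [measurable]: "A \<in> sets borel" by simp
    have "{z \<in> space ?P. sw z \<and> snd z \<in> A} \<in> sets ?P" "{z \<in> space ?P. sw z \<and> fst z \<in> A} \<in> sets ?P"
      "{z \<in> space ?P. \<not> sw z \<and> fst z \<in> A} \<in> sets ?P"
      by measurable
    then have ev: "{z. sw z \<and> snd z \<in> A} \<in> sets ?P" "{z. sw z \<and> fst z \<in> A} \<in> sets ?P"
      "{z. \<not> sw z \<and> fst z \<in> A} \<in> sets ?P"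
      by (simp_all add: space_P)
    have "emeasure (distr ?P borel \<tau>) A = emeasure ?P {z. \<tau> z \<in> A}"
      by (subst emeasure_distr) (auto simp: space_P vimage_def)
    also have "{z. \<tau> z \<in> A} = {z. sw z \<and> snd z \<in> A} \<union> {z. \<not> sw z \<and> fst z \<in> A}"
      by (auto simp: \<tau>_def)
    also have "emeasure ?P \<dots> = emeasure ?P {z. sw z \<and> snd z \<in> A} + emeasure ?P {z. \<not> sw z \<and> fst z \<in> A}"
      by (intro plus_emeasure[symmetric] ev) auto
    also have "emeasure ?P {z. sw z \<and> snd z \<in> A} = emeasure (distr ?P ?P ?s) {z. sw z \<and> snd z \<in> A}"
      by (simp only: swap)
    also have "\<dots> = emeasure ?P (?s -` {z. sw z \<and> snd z \<in> A} \<inter> space ?P)"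
      by (intro emeasure_distr ev) measurable
    also have "?s -` {z. sw z \<and> snd z \<in> A} \<inter> space ?P = {z. sw z \<and> fst z \<in> A}"
      using sw_swap by (auto simp: space_P)
    also have "emeasure ?P {z. sw z \<and> fst z \<in> A} + emeasure ?P {z. \<not> sw z \<and> fst z \<in> A}
        = emeasure ?P ({z. sw z \<and> fst z \<in> A} \<union> {z. \<not> sw z \<and> fst z \<in> A})"
      by (intro plus_emeasure ev) auto
    also have "{z. sw z \<and> fst z \<in> A} \<union> {z. \<not> sw z \<and> fst z \<in> A} = fst -` A \<inter> space ?P"
      by (auto simp: space_P)
    also have "emeasure ?P \<dots> = emeasure (distr ?P borel fst) A"
      by (rule emeasure_distr[symmetric]) auto
    finally show "emeasure (distr ?P borel \<tau>) A = emeasure \<mu> A" by (simp only: fst_\<mu>)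
  qed (simp add: \<mu>)
  let ?\<gamma> = "distr \<mu> borel (\<lambda>x. (x, T x))"
  let ?\<gamma>' = "distr ?P borel (\<lambda>z. (fst z, T (\<tau> z)))"
  have pairT: "(\<lambda>x. (x, T x)) \<in> \<mu> \<rightarrow>\<^sub>M borel" unfolding borel_prod[symmetric] by measurable
  have pair\<tau>: "(\<lambda>z. (fst z, T (\<tau> z))) \<in> ?P \<rightarrow>\<^sub>M borel" unfolding borel_prod[symmetric] by measurable
  have fst_b: "fst \<in> (borel :: ((real^'n) \<times> (real^'n)) measure) \<rightarrow>\<^sub>M borel"
    and snd_b: "snd \<in> (borel :: ((real^'n) \<times> (real^'n)) measure) \<rightarrow>\<^sub>M borel"
    unfolding borel_prod[symmetric] by measurable
  have "?\<gamma> \<in> couplings \<mu> \<nu>" and min: "\<And>\<gamma>. \<gamma> \<in> couplings \<mu> \<nu> \<Longrightarrow> \<not> transport_cost \<gamma> < transport_cost ?\<gamma>"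
    using opt unfolding optimal_transport_map_def is_arg_min_def by auto
  then have "\<nu> = distr ?\<gamma> borel snd" by (simp add: couplings_def)
  also have "\<dots> = distr \<mu> borel T"
    using distr_distr[OF snd_b pairT] by (simp add: o_def)
  finally have \<nu>: "\<nu> = distr \<mu> borel T" .
  have "?\<gamma>' \<in> couplings \<mu> \<nu>"
  proof -
    have "distr ?\<gamma>' borel fst = distr ?P borel fst"
      using distr_distr[OF fst_b pair\<tau>] by (simp add: o_def)
    moreover have "distr ?\<gamma>' borel snd = distr ?P borel (T \<circ> \<tau>)"
      using distr_distr[OF snd_b pair\<tau>] by (simp add: o_def)
    moreover have "distr ?P borel (T \<circ> \<tau>) = distr (distr ?P borel \<tau>) borel T"
      by (rule distr_distr[symmetric]) measurable
    ultimately show ?thesis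
      by (simp add: couplings_def fst_\<mu> \<tau>_\<mu> \<nu> P.prob_space_distr[OF pair\<tau>])
  qed
  then have le: "transport_cost ?\<gamma> \<le> transport_cost ?\<gamma>'" using min by (simp add: not_less)
  let ?f = "\<lambda>z. (norm (fst z - T (fst z)))\<^sup>2" and ?g = "\<lambda>z. (norm (fst z - T (\<tau> z)))\<^sup>2"
  have cost: "transport_cost ?\<gamma>' = (\<integral>\<^sup>+z. ennreal (?g z) \<partial>?P)"
    unfolding transport_cost_def
    by (subst nn_integral_distr[OF pair\<tau>]) (use fst_b snd_b in \<open>auto intro!: measurable_compose[OF _ measurable_ennreal]\<close>)
  have "transport_cost ?\<gamma> = (\<integral>\<^sup>+x. ennreal ((norm (x - T x))\<^sup>2) \<partial>\<mu>)"
    unfolding transport_cost_def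
    by (subst nn_integral_distr[OF pairT]) (use fst_b snd_b in \<open>auto intro!: measurable_compose[OF _ measurable_ennreal]\<close>)
  also have "\<dots> = (\<integral>\<^sup>+x. ennreal ((norm (x - T x))\<^sup>2) \<partial>distr ?P borel fst)" by (simp only: fst_\<mu>)
  also have "\<dots> = (\<integral>\<^sup>+z. ennreal (?f z) \<partial>?P)" by (rule nn_integral_distr) measurable
  finally have cost': "transport_cost ?\<gamma> = (\<integral>\<^sup>+z. ennreal (?f z) \<partial>?P)" .
  \<comment> \<open>Boundedness makes both costs finite, so they can be subtracted as real
    integrals.\<close>
  have bddP: "AE z in ?P. norm (fst z) \<le> B \<and> norm (T (fst z)) \<le> B \<and> norm (snd z) \<le> B \<and> norm (T (snd z)) \<le> B"
  proof -
    have "AE z in ?P. norm (fst z) \<le> B \<and> norm (T (fst z)) \<le> B"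
    proof -
      have "AE x in distr ?P borel fst. norm x \<le> B \<and> norm (T x) \<le> B"
        using bdd by (simp only: fst_\<mu>)
      then show ?thesis by (subst (asm) AE_distr_iff) measurable
    qed
    moreover have "AE z in distr ?P ?P ?s. norm (fst z) \<le> B \<and> norm (T (fst z)) \<le> B"
      using calculation by (simp only: swap)
    then have "AE z in ?P. norm (fst (?s z)) \<le> B \<and> norm (T (fst (?s z))) \<le> B"
      by (subst (asm) AE_distr_iff) measurable
    ultimately show ?thesis by eventually_elim (auto split: prod.splits)
  qed
  define Q where "Q = (2 * B)\<^sup>2"
  have sq: "(norm (a - b))\<^sup>2 \<le> Q" if "norm a \<le> B" "norm b \<le> B" for a b :: "real^'n"
    unfolding Q_def using norm_triangle_ineq4[of a b] that by (intro power_mono) auto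
  have int_f: "integrable ?P ?f"
  proof (rule P.integrable_const_bound)
    show "AE z in ?P. norm (?f z) \<le> Q"
      using bddP by eventually_elim (auto intro: sq)
  qed measurable
  have int_g: "integrable ?P ?g"
  proof (rule P.integrable_const_bound)
    show "AE z in ?P. norm (?g z) \<le> Q"
      using bddP by eventually_elim (auto intro: sq simp: \<tau>_def)
  qed measurable
  let ?d = "\<lambda>z. ?g z - ?f z"
  have "ennreal (\<integral>z. ?f z \<partial>?P) \<le> ennreal (\<integral>z. ?g z \<partial>?P)"
    using le unfolding cost cost' by (simp add: nn_integral_eq_integral[OF int_f] nn_integral_eq_integral[OF int_g])
  then have "(\<integral>z. ?f z \<partial>?P) \<le> (\<integral>z. ?g z \<partial>?P)"
    by (simp add: ennreal_le_iff)
  then have d0: "0 \<le> (\<integral>z. ?d z \<partial>?P)" using int_f int_g by simp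
  have int_d: "integrable ?P ?d" using int_f int_g by simp
  have s_meas: "?s \<in> ?P \<rightarrow>\<^sub>M ?P" by measurable
  have d_meas: "?d \<in> borel_measurable ?P" by measurable
  \<comment> \<open>By swap invariance the cost change and its swapped version have the same
    integral, nonnegative by optimality.\<close>
  have "(\<integral>z. ?d z \<partial>?P) = (\<integral>z. ?d z \<partial>distr ?P ?P ?s)" by (simp only: swap)
  also have "\<dots> = (\<integral>z. ?d (?s z) \<partial>?P)" by (rule integral_distr[OF s_meas d_meas])
  finally have d1: "0 \<le> (\<integral>z. ?d (?s z) \<partial>?P)" using d0 by simp
  have int_ds: "integrable ?P (\<lambda>z. ?d (?s z))"
    using int_d integrable_distr_eq[OF s_meas d_meas] by (simp add: swap)
  \<comment> \<open>Adding the cost changes of a pair and of its swap cancels the squares and leaves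
    twice the inner product on \<open>sw\<close>. Thus \<open>?h\<close> is nonnegative, while its
    integral is at most 0 by optimality; it vanishes almost everywhere, which makes
    \<open>sw\<close> null.\<close>
  let ?h = "\<lambda>z. - (?d z + ?d (?s z))"
  have h: "?h z = (if sw z then - (2 * ((T (fst z) - T (snd z)) \<bullet> (fst z - snd z))) else 0)" for z
  proof -
    obtain x y where [simp]: "z = (x, y)" by fastforce
    have "sw (y, x) = sw (x, y)" using sw_swap[of "(x, y)"] by simp
    moreover have "(norm (x - T y))\<^sup>2 - (norm (x - T x))\<^sup>2 + ((norm (y - T x))\<^sup>2 - (norm (y - T y))\<^sup>2)
        = 2 * ((T x - T y) \<bullet> (x - y))"
      by (simp add: power2_norm_eq_inner inner_diff_left inner_diff_right inner_commute algebra_simps)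
    ultimately show ?thesis by (auto simp: \<tau>_def)
  qed
  have int_h: "integrable ?P ?h"
    by (intro Bochner_Integration.integrable_minus Bochner_Integration.integrable_add int_d int_ds)
  have h_nonneg: "AE z in ?P. 0 \<le> ?h z" unfolding h by (auto simp: sw_def)
  have "(\<integral>z. ?h z \<partial>?P) = - ((\<integral>z. ?d z \<partial>?P) + (\<integral>z. ?d (?s z) \<partial>?P))"
    unfolding Bochner_Integration.integral_minus Bochner_Integration.integral_add[OF int_d int_ds] ..
  then have "(\<integral>z. ?h z \<partial>?P) = 0"
    using d0 d1 integral_nonneg_AE[OF h_nonneg] by linarith
  then have "AE z in ?P. ?h z = 0" using integral_nonneg_eq_0_iff_AE[OF int_h h_nonneg] by blast
  then show ?thesis unfolding h by eventually_elim (auto simp: sw_def split: if_splits)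
qed

text \<open>By continuity, the pairs violating monotonicity form an open set. If nonempty it
  contains a product of two nonempty open subsets of the domain, which has positive product measure,
  against the almost everywhere statement.\<close>

lemma optimal_transport_map_monotone_on:
  fixes \<mu> \<nu> :: "(real^'n) measure"
  assumes \<mu>: "prob_space \<mu>" "sets \<mu> = sets borel"
    and opt: "optimal_transport_map \<mu> \<nu> T"
    and bdd: "AE x in \<mu>. norm x \<le> B \<and> norm (T x) \<le> B"
    and \<Omega>: "open \<Omega>" "continuous_on \<Omega> T"
    and pos: "\<And>U. open U \<Longrightarrow> U \<subseteq> \<Omega> \<Longrightarrow> U \<noteq> {} \<Longrightarrow> emeasure \<mu> U \<noteq> 0"
    and xy: "x \<in> \<Omega>" "y \<in> \<Omega>"
  shows "(T x - T y) \<bullet> (x - y) \<ge> 0"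
proof (rule ccontr)
  interpret prob_space \<mu> by fact
  interpret P: pair_prob_space \<mu> \<mu> ..
  have space_\<mu>: "space \<mu> = UNIV" using sets_eq_imp_space_eq[OF \<mu>(2)] by simp
  let ?f = "\<lambda>z. (T (fst z) - T (snd z)) \<bullet> (fst z - snd z)"
  assume "\<not> 0 \<le> (T x - T y) \<bullet> (x - y)"
  have "continuous_on (\<Omega> \<times> \<Omega>) ?f"
    by (intro continuous_intros continuous_on_compose2[OF \<Omega>(2)]) auto
  then have "open ((\<Omega> \<times> \<Omega>) \<inter> ?f -` {..<0})"
    using \<Omega>(1) by (intro continuous_open_preimage open_Times) auto
  moreover have "(x, y) \<in> (\<Omega> \<times> \<Omega>) \<inter> ?f -` {..<0}"
    using xy \<open>\<not> 0 \<le> (T x - T y) \<bullet> (x - y)\<close> by simp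
  ultimately obtain U V where U: "open U" "open V" "(x, y) \<in> U \<times> V" "U \<times> V \<subseteq> (\<Omega> \<times> \<Omega>) \<inter> ?f -` {..<0}"
    by (rule open_prod_elim)
  have "AE z in \<mu> \<Otimes>\<^sub>M \<mu>. z \<notin> U \<times> V"
    using optimal_transport_map_AE_monotone[OF \<mu> opt bdd]
    by eventually_elim (use U(4) in auto)
  moreover have UV: "U \<in> sets \<mu>" "V \<in> sets \<mu>" using U by (auto simp: \<mu>(2))
  ultimately have "emeasure (\<mu> \<Otimes>\<^sub>M \<mu>) (U \<times> V) = 0"
    by (subst (asm) AE_iff_measurable[of "U \<times> V"]) (auto simp: space_pair_measure space_\<mu>)
  moreover have "emeasure (\<mu> \<Otimes>\<^sub>M \<mu>) (U \<times> V) = emeasure \<mu> U * emeasure \<mu> V"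
    using UV by (rule emeasure_pair_measure_Times)
  moreover have "U \<subseteq> \<Omega>" "V \<subseteq> \<Omega>" "U \<noteq> {}" "V \<noteq> {}"
    using U(3) subset_trans[OF U(4) Int_lower1] by (auto simp: times_subset_iff)
  then have "emeasure \<mu> U \<noteq> 0" "emeasure \<mu> V \<noteq> 0" using U(1,2) by (auto dest: pos)
  ultimately show False by simp
qed

subsection \<open>Convergence of the minimizers\<close>

lemma reachable_approximates_monotone:
  fixes F :: "'k::finite \<Rightarrow> real^'n \<Rightarrow> real^'n" and T :: "real^'n \<Rightarrow> real^'n"
  assumes tangent: "\<And>V. continuous_on UNIV V \<Longrightarrow> tangent F V"
    and \<Omega>: "open \<Omega>" "bounded \<Omega>" "convex \<Omega>" "\<Omega> \<noteq> {}"
    and T: "continuous_on (closure \<Omega>) T"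
    and mono: "\<And>x y. x \<in> \<Omega> \<Longrightarrow> y \<in> \<Omega> \<Longrightarrow> (T x - T y) \<bullet> (x - y) \<ge> 0"
    and "\<epsilon> > 0"
  obtains r where "reachable F r" "\<And>x. x \<in> \<Omega> \<Longrightarrow> norm (r x - T x) \<le> \<epsilon>"
proof -
  have e: "\<epsilon> / 3 > 0" using \<open>\<epsilon> > 0\<close> by simp
  have "\<exists>G K. K-lipschitz_on \<Omega> G \<and> (\<forall>x\<in>\<Omega>. norm (G x - T x) \<le> \<epsilon> / 3) \<and>
    (\<forall>x\<in>\<Omega>. \<forall>y\<in>\<Omega>. (G x - G y) \<bullet> (x - y) \<ge> 0)"
  proof (rule monotone_lipschitz_approximation[OF \<Omega> T _ e])
    show "(T x - T y) \<bullet> (x - y) \<ge> 0" if "x \<in> \<Omega>" "y \<in> \<Omega>" for x y by (rule mono[OF that])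
  qed blast
  then obtain G K where G: "K-lipschitz_on \<Omega> G" "\<And>x. x \<in> \<Omega> \<Longrightarrow> norm (G x - T x) \<le> \<epsilon> / 3"
    "\<And>x y. x \<in> \<Omega> \<Longrightarrow> y \<in> \<Omega> \<Longrightarrow> (G x - G y) \<bullet> (x - y) \<ge> 0"
    by blast
  obtain R where R: "R > 0" "\<And>x. x \<in> \<Omega> \<Longrightarrow> norm x \<le> R"
    using \<Omega>(2) unfolding bounded_pos by blast
  \<comment> \<open>The multiple of the identity added for strong monotonicity changes the map by at
    most \<open>\<epsilon> / 3\<close> on the domain.\<close>
  define s where "s = \<epsilon> / (3 * R)"
  have s: "s > 0" using R \<open>\<epsilon> > 0\<close> by (simp add: s_def)
  define H where "H x = G x + s *\<^sub>R x" for x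
  have lip: "(K + s)-lipschitz_on \<Omega> H"
    unfolding H_def
  proof (rule lipschitz_on_add[OF G(1)])
    show "s-lipschitz_on \<Omega> (\<lambda>x. s *\<^sub>R x)"
      using s by (simp add: lipschitz_on_def dist_norm scaleR_diff_right[symmetric])
  qed
  have bdd: "bounded (H ` \<Omega>)"
    by (rule bounded_uniformly_continuous_image[OF lipschitz_on_uniformly_continuous[OF lip] \<Omega>(2)])
  have strong: "(H x - H y) \<bullet> (x - y) \<ge> s * (norm (x - y))\<^sup>2" if "x \<in> \<Omega>" "y \<in> \<Omega>" for x y
  proof -
    have "H x - H y = (G x - G y) + s *\<^sub>R (x - y)" by (simp add: H_def scaleR_diff_right)
    then show ?thesis using G(3)[OF that] by (simp add: inner_add_left power2_norm_eq_inner)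
  qed
  have "\<exists>r. reachable F r \<and> (\<forall>x\<in>\<Omega>. norm (r x - H x) \<le> \<epsilon> / 3)"
  proof (rule reachable_approximates_strongly_monotone[OF _ \<Omega>(2) bdd lip _ s e])
    show "tangent F V" if "continuous_on UNIV V" for V by (rule tangent[OF that])
    show "(H x - H y) \<bullet> (x - y) \<ge> s * (norm (x - y))\<^sup>2" if "x \<in> \<Omega>" "y \<in> \<Omega>" for x y
      by (rule strong[OF that])
  qed blast
  then obtain r where r: "reachable F r" "\<And>x. x \<in> \<Omega> \<Longrightarrow> norm (r x - H x) \<le> \<epsilon> / 3" by blast
  have "norm (r x - T x) \<le> \<epsilon>" if x: "x \<in> \<Omega>" for x
  proof -
    have "s * norm x \<le> s * R" using s R(2)[OF x] by (intro mult_left_mono) auto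
    moreover have "s * R = \<epsilon> / 3" using R by (simp add: s_def)
    ultimately have "norm (s *\<^sub>R x) \<le> \<epsilon> / 3" using s by simp
    then have "norm ((r x - H x) + (G x - T x) + s *\<^sub>R x) \<le> \<epsilon> / 3 + \<epsilon> / 3 + \<epsilon> / 3"
      by (intro norm_triangle_mono r(2) G(2) x)
    moreover have "(r x - H x) + (G x - T x) + s *\<^sub>R x = r x - T x" by (simp add: H_def)
    moreover have "\<epsilon> / 3 + \<epsilon> / 3 + \<epsilon> / 3 = \<epsilon>" by simp
    ultimately show ?thesis by (simp only:)
  qed
  then show ?thesis using that r(1) by blast
qed

text \<open>The factor 1/2 in the penalty bounds the cost of \<open>u\<close> by
  \<open>\<epsilon> / 2\<close>, the other half being its terminal error. An empty set of minimizers
  gives the supremum 0 in \<open>ennreal\<close>.\<close>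

lemma kappa_le:
  assumes "u \<in> controls" "terminal_error F \<mu> T u \<le> ennreal (\<epsilon> / 2)" "\<epsilon> > 0"
    and "\<beta> > 0" "\<beta> * (control_norm u)\<^sup>2 \<le> \<epsilon>"
  shows "kappa F \<mu> T \<beta> \<le> ennreal \<epsilon>"
  unfolding kappa_def
proof (rule SUP_least)
  fix v assume "v \<in> {v. is_arg_min (functional F \<mu> T \<beta>) (\<lambda>v. v \<in> controls) v}"
  then have "functional F \<mu> T \<beta> v \<le> functional F \<mu> T \<beta> u"
    using assms(1) by (auto simp: is_arg_min_def not_less)
  have "terminal_error F \<mu> T v \<le> functional F \<mu> T \<beta> v" by (simp add: functional_def)
  also have "\<dots> \<le> functional F \<mu> T \<beta> u" by fact
  also have "\<dots> \<le> ennreal (\<epsilon> / 2) + ennreal (\<epsilon> / 2)"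
    unfolding functional_def using assms(2,5) by (intro add_mono ennreal_leI) auto
  also have "\<dots> = ennreal \<epsilon>" using assms(3) by (simp flip: ennreal_plus)
  finally show "terminal_error F \<mu> T v \<le> ennreal \<epsilon>" .
qed

theorem mainTheorem5:
  fixes \<Omega>1 \<Omega>2 :: "(real^'n::finite) set"
    and \<mu> \<nu> :: "(real^'n) measure"
    and \<rho>\<mu> \<rho>\<nu> :: "real^'n \<Rightarrow> real"
    and T :: "real^'n \<Rightarrow> real^'n"
    and F :: "'k::finite \<Rightarrow> real^'n \<Rightarrow> real^'n"
    and C \<epsilon> :: real
  assumes "open \<Omega>1" "bounded \<Omega>1" "smooth_uniformly_convex \<Omega>1"
    and "open \<Omega>2" "bounded \<Omega>2" "smooth_uniformly_convex \<Omega>2"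
    and "\<mu> = density lborel (\<lambda>x. indicator \<Omega>1 x * ennreal (\<rho>\<mu> x))" "prob_space \<mu>"
    and "\<nu> = density lborel (\<lambda>x. indicator \<Omega>2 x * ennreal (\<rho>\<nu> x))" "prob_space \<nu>"
    and "C > 1"
    and "\<forall>x\<in>\<Omega>1. 1 / C \<le> \<rho>\<mu> x \<and> \<rho>\<mu> x \<le> C"
    and "\<forall>x\<in>\<Omega>2. 1 / C \<le> \<rho>\<nu> x \<and> \<rho>\<nu> x \<le> C"
    and "smooth_closure \<Omega>1 \<rho>\<mu>" "smooth_closure \<Omega>2 \<rho>\<nu>"
    and "optimal_transport_map \<mu> \<nu> T"
    and "continuous_on (closure \<Omega>1) T" "T ` closure \<Omega>1 \<subseteq> closure \<Omega>2"
    and "\<forall>i. smooth_on UNIV (F i)"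
    and "\<forall>i. \<exists>L. L-lipschitz_on UNIV (F i)"
    and "lie_strong_approximating F"
    and "\<epsilon> > 0"
  shows "\<exists>\<beta>0>0. \<forall>\<beta>\<in>{0<..\<beta>0}. kappa F \<mu> T \<beta> \<le> ennreal \<epsilon>"
proof -
  let ?d = "\<lambda>x. indicator \<Omega>1 x * ennreal (\<rho>\<mu> x)"
  \<comment> \<open>Continuity inside the domain makes the density Borel measurable, as the facts
    about \<open>density\<close> below require.\<close>
  have "continuous_on \<Omega>1 \<rho>\<mu>"
  proof -
    have "Ck_closure 0 \<Omega>1 \<rho>\<mu>" using assms(14) unfolding smooth_closure_def by blast
    then obtain g where g: "continuous_on (closure \<Omega>1) g" "\<forall>x\<in>\<Omega>1. g x = \<rho>\<mu> x" by auto
    then show ?thesis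
      using continuous_on_cong[of \<Omega>1 \<Omega>1 g \<rho>\<mu>] continuous_on_subset[OF g(1) closure_subset] by simp
  qed
  then have "(\<lambda>x. indicator \<Omega>1 x *\<^sub>R \<rho>\<mu> x) \<in> borel_measurable borel"
    using assms(1) by (intro borel_measurable_continuous_on_indicator) auto
  then have "(\<lambda>x. ennreal (indicator \<Omega>1 x *\<^sub>R \<rho>\<mu> x)) \<in> borel_measurable borel" by measurable
  moreover have "(\<lambda>x. ennreal (indicator \<Omega>1 x *\<^sub>R \<rho>\<mu> x)) = ?d" by (auto simp: indicator_def)
  ultimately have d_meas: "?d \<in> borel_measurable lborel" by simp
  have sets: "sets \<mu> = sets borel" using assms(7) by simp
  have AE\<Omega>: "AE x in \<mu>. x \<in> \<Omega>1"
    unfolding assms(7) by (subst AE_density[OF d_meas]) (auto simp: indicator_def)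
  \<comment> \<open>The lower bound \<open>1 / C\<close> makes the density nonzero on the domain, so
    a null set of \<open>\<mu>\<close> in it is Lebesgue null and cannot be open and
    nonempty.\<close>
  have pos: "emeasure \<mu> U \<noteq> 0" if U: "open U" "U \<subseteq> \<Omega>1" "U \<noteq> {}" for U
  proof
    assume "emeasure \<mu> U = 0"
    then have "U \<in> null_sets \<mu>" using U(1) by (intro null_setsI) (auto simp: sets)
    then have "AE x in lborel. x \<in> U \<longrightarrow> ?d x = 0"
      unfolding assms(7) null_sets_density_iff[OF d_meas] by simp
    moreover have "?d x \<noteq> 0" if "x \<in> U" for x
    proof -
      have "0 < 1 / C" using assms(11) by simp
      also have "1 / C \<le> \<rho>\<mu> x" using assms(12) U(2) that by blast
      finally show ?thesis using U(2) that by auto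
    qed
    ultimately have "AE x in lborel. x \<notin> U" by (auto elim: eventually_mono)
    then have "U \<in> null_sets lborel"
      using U(1) by (subst (asm) AE_iff_null_sets[symmetric]) auto
    then have "negligible U" using negligible_iff_null_sets null_sets_completionI by blast
    then show False using open_not_negligible U by blast
  qed
  have "\<Omega>1 \<noteq> {}"
  proof
    assume "\<Omega>1 = {}"
    then have "AE x in \<mu>. False" using AE\<Omega> by simp
    then show False using prob_space.AE_False[OF assms(8)] by simp
  qed
  have "compact (closure \<Omega>1)" using assms(2) by (simp add: compact_closure)
  then have "bounded (closure \<Omega>1 \<union> T ` closure \<Omega>1)"
    using compact_continuous_image[OF assms(17)] by (auto simp: compact_imp_bounded)
  then obtain B where B: "\<forall>x\<in>closure \<Omega>1 \<union> T ` closure \<Omega>1. norm x \<le> B" unfolding bounded_iff by blast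
  have bdd: "AE x in \<mu>. norm x \<le> B \<and> norm (T x) \<le> B"
    using AE\<Omega> by eventually_elim (use B closure_subset[of \<Omega>1] in auto)
  have mono: "(T x - T y) \<bullet> (x - y) \<ge> 0" if "x \<in> \<Omega>1" "y \<in> \<Omega>1" for x y
    by (rule optimal_transport_map_monotone_on[OF assms(8) sets assms(16) bdd assms(1)
        continuous_on_subset[OF assms(17) closure_subset] pos that])
  have "convex \<Omega>1" using assms(3) unfolding smooth_uniformly_convex_def by blast
  \<comment> \<open>Uniform accuracy at this scale makes the squared error at most
    \<open>\<epsilon> / 2\<close> after integration against a probability measure.\<close>
  have "sqrt (\<epsilon> / 2) > 0" using assms(22) by simp
  have "\<exists>r. reachable F r \<and> (\<forall>x\<in>\<Omega>1. norm (r x - T x) \<le> sqrt (\<epsilon> / 2))"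
  proof (rule reachable_approximates_monotone[OF _ assms(1,2) \<open>convex \<Omega>1\<close>
        \<open>\<Omega>1 \<noteq> {}\<close> assms(17) _ \<open>sqrt (\<epsilon> / 2) > 0\<close>])
    show "tangent F V" if "continuous_on UNIV V" for V
      by (rule tangent_continuous[OF assms(20,19,21) that])
    show "(T x - T y) \<bullet> (x - y) \<ge> 0" if "x \<in> \<Omega>1" "y \<in> \<Omega>1" for x y by (rule mono[OF that])
  qed blast
  then obtain r where r: "reachable F r" "\<And>x. x \<in> \<Omega>1 \<Longrightarrow> norm (r x - T x) \<le> sqrt (\<epsilon> / 2)"
    by blast
  obtain u where u: "u \<in> controls" "flow F u = r"
    using reachable_imp_flow[OF assms(20) r(1)] .
  have "terminal_error F \<mu> T u \<le> (\<integral>\<^sup>+ x. ennreal (\<epsilon> / 2) \<partial>\<mu>)"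
    unfolding terminal_error_def u(2)
  proof (rule nn_integral_mono_AE)
    show "AE x in \<mu>. ennreal ((norm (r x - T x))\<^sup>2) \<le> ennreal (\<epsilon> / 2)"
      using AE\<Omega>
    proof eventually_elim
      fix x assume "x \<in> \<Omega>1"
      then have "(norm (r x - T x))\<^sup>2 \<le> (sqrt (\<epsilon> / 2))\<^sup>2" by (intro power_mono r(2)) auto
      also have "\<dots> = \<epsilon> / 2" using assms(22) by simp
      finally show "ennreal ((norm (r x - T x))\<^sup>2) \<le> ennreal (\<epsilon> / 2)" by (rule ennreal_leI)
    qed
  qed
  also have "\<dots> = ennreal (\<epsilon> / 2)"
    using prob_space.emeasure_space_1[OF assms(8)] by simp
  finally have err: "terminal_error F \<mu> T u \<le> ennreal (\<epsilon> / 2)" .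
  \<comment> \<open>The control \<open>u\<close> is fixed by now; the added 1 covers a control of
    norm zero.\<close>
  define \<beta>0 where "\<beta>0 = \<epsilon> / ((control_norm u)\<^sup>2 + 1)"
  have den: "(control_norm u)\<^sup>2 + 1 > 0" by (simp add: add_nonneg_pos)
  have "\<beta>0 > 0" using assms(22) den by (simp add: \<beta>0_def)
  moreover have "kappa F \<mu> T \<beta> \<le> ennreal \<epsilon>" if \<beta>: "\<beta> \<in> {0<..\<beta>0}" for \<beta>
  proof (rule kappa_le[OF u(1) err assms(22)])
    show "\<beta> > 0" using \<beta> by simp
    have "\<beta> * (control_norm u)\<^sup>2 \<le> \<beta>0 * ((control_norm u)\<^sup>2 + 1)" using \<beta> by (intro mult_mono) auto
    also have "\<dots> = \<epsilon>" using den by (simp add: \<beta>0_def)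
    finally show "\<beta> * (control_norm u)\<^sup>2 \<le> \<epsilon>" .
  qed
  ultimately show ?thesis by blast
qed

end
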